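(* There exist a constant $s_0>0$ and a function $k\colon (0,s_0)\to[0,1)$ with $k(s)\to 0$ as $s\to 0$ such that the following holds. If $0<s<s_0$ and $\Gamma\subset\mathbb{C}$ is an $s$-quasisymmetric graph, then there is a reduced quasiconformal mapping $f\colon\mathbb{C}\to\mathbb{C}$ with constant $k(s)$ (i.e. $|f_{\bar z}|\le k(s)\,\operatorname{Re} f_z$ a.e.) such that $f(\mathbb{R})=\Gamma$.
   Context: An embedding $f\colon X\to Y$ between subsets of a Euclidean space is quasisymmetric if there is a homeomorphism $\eta\colon[0,\infty)\to[0,\infty)$ such that $|f(x)-f(a)|\le \eta(t)|f(x)-f(b)|$ with $t=|x-a|/|x-b|$ for every triple of distinct points $a,b,x\in X$. For a constant $s>0$, $f$ is $s$-quasisymmetric if $\eta$ can be chosen so that $\eta(t)\le t+s$ for $0\le t\le 1/s$. A set $\Gamma\subset\mathbb{C}$ is a quasisymmetric graph (resp. $s$-quasisymmetric graph) if the orthogonal projection $w\mapsto \operatorname{Re} w$ is a quasisymmetric (resp. $s$-quasisymmetric) homeomorphism from $\Gamma$ (with the metric induced from $\mathbb{C}$) onto $\mathbb{R}$. A nonconstant continuous mapping $f\colon\mathbb{C}\to\mathbb{C}$ in $W^{1,2}_{\rm loc}$ is reduced quasiconformal if there is a constant $k\in[0,1)$ with $|f_{\bar z}|\le k\operatorname{Re} f_z$ almost everywhere in $\mathbb{C}$. *)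

theory Defs
  imports "HOL-Analysis.Analysis"
begin

definition halfline_homeo :: "(real \<Rightarrow> real) \<Rightarrow> bool" where
  "halfline_homeo \<eta> \<longleftrightarrow> (\<exists>\<eta>'. homeomorphism {0..} {0..} \<eta> \<eta>')"

definition qs_condition ::
  "('a::metric_space) set \<Rightarrow> ('a \<Rightarrow> 'b::metric_space) \<Rightarrow> (real \<Rightarrow> real) \<Rightarrow> bool" where
  "qs_condition X f \<eta> \<longleftrightarrow>
     (\<forall>a\<in>X. \<forall>b\<in>X. \<forall>x\<in>X. a \<noteq> b \<and> a \<noteq> x \<and> b \<noteq> x \<longrightarrow>
        dist (f x) (f a) \<le> \<eta> (dist x a / dist x b) * dist (f x) (f b))"

definition quasisymmetric ::
  "('a::metric_space) set \<Rightarrow> ('a \<Rightarrow> 'b::metric_space) \<Rightarrow> bool" where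
  "quasisymmetric X f \<longleftrightarrow> inj_on f X \<and> (\<exists>\<eta>. halfline_homeo \<eta> \<and> qs_condition X f \<eta>)"

definition s_quasisymmetric ::
  "real \<Rightarrow> ('a::metric_space) set \<Rightarrow> ('a \<Rightarrow> 'b::metric_space) \<Rightarrow> bool" where
  "s_quasisymmetric s X f \<longleftrightarrow> inj_on f X \<and>
     (\<exists>\<eta>. halfline_homeo \<eta> \<and> qs_condition X f \<eta> \<and> (\<forall>t. 0 \<le> t \<and> t \<le> 1 / s \<longrightarrow> \<eta> t \<le> t + s))"

definition s_qs_graph :: "real \<Rightarrow> complex set \<Rightarrow> bool" where
  "s_qs_graph s \<Gamma> \<longleftrightarrow> (\<exists>g. homeomorphism \<Gamma> UNIV Re g) \<and> s_quasisymmetric s \<Gamma> Re"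

definition dpar :: "complex \<Rightarrow> (complex \<Rightarrow> real) \<Rightarrow> complex \<Rightarrow> real" where
  "dpar v \<phi> z = frechet_derivative \<phi> (at z) v"

definition smooth_fun :: "(complex \<Rightarrow> real) \<Rightarrow> bool" where
  "smooth_fun \<phi> \<longleftrightarrow> (\<forall>vs z. fold dpar vs \<phi> differentiable (at z))"

definition test_fun :: "(complex \<Rightarrow> real) \<Rightarrow> bool" where
  "test_fun \<phi> \<longleftrightarrow> smooth_fun \<phi> \<and> compact (closure {z. \<phi> z \<noteq> 0})"

definition L2_loc :: "(complex \<Rightarrow> complex) \<Rightarrow> bool" where
  "L2_loc g \<longleftrightarrow> g \<in> borel_measurable lebesgue \<and>
     (\<forall>K. compact K \<longrightarrow> set_integrable lebesgue K (\<lambda>z. (norm (g z))\<^sup>2))"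

definition weak_partial :: "(complex \<Rightarrow> complex) \<Rightarrow> complex \<Rightarrow> (complex \<Rightarrow> complex) \<Rightarrow> bool" where
  "weak_partial f v g \<longleftrightarrow>
     (\<forall>K. compact K \<longrightarrow> set_integrable lebesgue K f \<and> set_integrable lebesgue K g) \<and>
     (\<forall>\<phi>. test_fun \<phi> \<longrightarrow>
        integral\<^sup>L lebesgue (\<lambda>z. of_real (dpar v \<phi> z) * f z)
          = - integral\<^sup>L lebesgue (\<lambda>z. of_real (\<phi> z) * g z))"

definition W12_loc_with :: "(complex \<Rightarrow> complex) \<Rightarrow> (complex \<Rightarrow> complex) \<Rightarrow> (complex \<Rightarrow> complex) \<Rightarrow> bool" where
  "W12_loc_with f fx fy \<longleftrightarrow> L2_loc f \<and> L2_loc fx \<and> L2_loc fy \<and>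
     weak_partial f 1 fx \<and> weak_partial f \<i> fy"

text \<open>Reduced quasiconformal with constant k: |f_zbar| <= k Re f_z a.e., where
  f_z = (f_x - i f_y)/2 and f_zbar = (f_x + i f_y)/2.\<close>
definition reduced_qc_const :: "(complex \<Rightarrow> complex) \<Rightarrow> real \<Rightarrow> bool" where
  "reduced_qc_const f k \<longleftrightarrow> 0 \<le> k \<and> k < 1 \<and> (\<exists>a b. f a \<noteq> f b) \<and> continuous_on UNIV f \<and>
     (\<exists>fx fy. W12_loc_with f fx fy \<and>
        (AE z in lebesgue. norm ((fx z + \<i> * fy z) / 2) \<le> k * Re ((fx z - \<i> * fy z) / 2)))"

end

theory Submission
  imports Defs "HOL-Complex_Analysis.Complex_Analysis"
begin

text \<open>
  Let \<open>\<gamma>\<close> be the inverse of the projection of \<open>\<Gamma>\<close>, so that \<open>\<Gamma>\<close> is the graph \<open>range \<gamma>\<close>, and let \<open>f\<close> map the upper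
  half-plane conformally onto the domain above \<open>\<Gamma>\<close>. This domain is invariant under upward translations, so a
  Wolff-type argument normalises \<open>f\<close> such that \<open>Re f' > 0\<close>.
  As \<open>s \<rightarrow> 0\<close>, rescaled graphs converge to lines, hence rescaled maps to affine maps, and therefore
  \<open>Im z \<bar>f''\<bar> \<le> \<delta> \<bar>f'\<bar>\<close> with \<open>\<delta>\<close> small. This extends \<open>f\<close> to the real line, and together with the
  quasisymmetry of the projection it makes \<open>u = Re f\<close> almost linear on the real line at every scale. Comparing the
  increments of \<open>f\<close> with a multiple of the square root of \<open>1 - i z\<close> by the maximum principle carries this into the
  half-plane and improves the estimate to \<open>2 Im z \<bar>f''\<bar> \<le> k Re f'\<close>.
  Finally extend \<open>f\<close> below the real line by \<open>F z = f (cnj z) + f' (cnj z) (z - cnj z)\<close>. There the two Wirtinger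
  derivatives are \<open>f' (cnj z)\<close> and \<open>f'' (cnj z) (z - cnj z)\<close>, so the last estimate is the asserted inequality.
\<close>

text \<open>The slope of the graph is not controlled: for a line of any slope the projection is a
  similarity, so nearly vertical graphs occur. Compactness therefore compares \<open>f''\<close>
  only with the modulus of \<open>f'\<close>, whereas the claim needs \<open>Re f'\<close>, which
  may be far smaller. To close this gap quasisymmetry is used a second time: chords of the graph,
  nearly linear in the boundary parameter by the first estimate, have ratios close to those of the
  increments of \<open>u\<close>, so the error is measured in units of the increments of
  \<open>u\<close> itself. The maximum principle then compares real parts only. Its majorant must
  have positive real part and outgrow the increments of \<open>f\<close>; these grow at most like a
  fourth root once \<open>\<delta>\<close> and \<open>\<omega>\<close> are small, so a square root
  suffices. The Wolff point is sent to infinity, so that the imaginary part of the inverse map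
  \<open>h\<close> does not decrease under upward translations. Hence \<open>Re h'\<close>, and with
  it the real part of \<open>f' = 1 / h'\<close>, is nonnegative, and the open mapping theorem
  excludes 0.\<close>

abbreviation uhp :: "complex set" where "uhp \<equiv> {z. 0 < Im z}"

section \<open>Quasisymmetric graphs and their epigraphs\<close>

text \<open>The \<open>s\<close>-quasisymmetry of the projection for ratios \<open>t \<le> 1 / s\<close>, with the denominators cleared.\<close>
definition qs_curve :: "real \<Rightarrow> (real \<Rightarrow> complex) \<Rightarrow> bool" where
  "qs_curve s \<gamma> \<longleftrightarrow> continuous_on UNIV \<gamma> \<and> (\<forall>x. Re (\<gamma> x) = x) \<and>
     (\<forall>x y z. x \<noteq> z \<and> s * norm (\<gamma> x - \<gamma> y) \<le> norm (\<gamma> x - \<gamma> z) \<longrightarrow>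
        \<bar>x - y\<bar> * norm (\<gamma> x - \<gamma> z) \<le> (norm (\<gamma> x - \<gamma> y) + s * norm (\<gamma> x - \<gamma> z)) * \<bar>x - z\<bar>)"

definition epigraph :: "(real \<Rightarrow> complex) \<Rightarrow> complex set" where
  "epigraph \<gamma> = {w. Im (\<gamma> (Re w)) < Im w}"

definition graph_map :: "(real \<Rightarrow> complex) \<Rightarrow> (complex \<Rightarrow> complex) \<Rightarrow> bool" where
  "graph_map \<gamma> f \<longleftrightarrow> f holomorphic_on uhp \<and> inj_on f uhp \<and> f ` uhp = epigraph \<gamma> \<and>
     (\<forall>z\<in>uhp. 0 < Re (deriv f z))"

lemma qs_curve_Re [simp]: "qs_curve s \<gamma> \<Longrightarrow> Re (\<gamma> x) = x"
  by (simp add: qs_curve_def)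

lemma qs_curve_continuous: "qs_curve s \<gamma> \<Longrightarrow> continuous_on A \<gamma>"
  by (auto simp: qs_curve_def intro: continuous_on_subset)

lemma qs_curve_ratio:
  assumes "qs_curve s \<gamma>" "x \<noteq> z" "s * norm (\<gamma> x - \<gamma> y) \<le> norm (\<gamma> x - \<gamma> z)"
  shows "\<bar>x - y\<bar> * norm (\<gamma> x - \<gamma> z) \<le> (norm (\<gamma> x - \<gamma> y) + s * norm (\<gamma> x - \<gamma> z)) * \<bar>x - z\<bar>"
  using assms by (auto simp: qs_curve_def)

lemma qs_curve_dist_ge:
  assumes "qs_curve s \<gamma>" shows "\<bar>x - y\<bar> \<le> norm (\<gamma> x - \<gamma> y)"
  using abs_Re_le_cmod[of "\<gamma> x - \<gamma> y"] assms by simp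

lemma qs_curve_pos:
  assumes "qs_curve s \<gamma>" "x \<noteq> y" shows "0 < norm (\<gamma> x - \<gamma> y)"
  using qs_curve_dist_ge[OF assms(1), of x y] assms(2) by linarith

lemma s_qs_graph_imp_qs_curve:
  assumes "s_qs_graph s \<Gamma>" "0 < s"
  obtains \<gamma> where "qs_curve s \<gamma>" "range \<gamma> = \<Gamma>"
proof -
  obtain g where g: "homeomorphism \<Gamma> UNIV Re g" and qs: "s_quasisymmetric s \<Gamma> Re"
    using assms by (auto simp: s_qs_graph_def)
  obtain \<eta> where eta: "qs_condition \<Gamma> Re \<eta>" "\<And>t. 0 \<le> t \<Longrightarrow> t \<le> 1/s \<Longrightarrow> \<eta> t \<le> t + s"
    using qs by (auto simp: s_quasisymmetric_def)
  have rg: "range g = \<Gamma>" and cg: "continuous_on UNIV g" and Reg: "\<And>x. Re (g x) = x"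
    using g by (auto simp: homeomorphism_def)
  have "\<bar>x - y\<bar> * norm (g x - g z) \<le> (norm (g x - g y) + s * norm (g x - g z)) * \<bar>x - z\<bar>"
    if xz: "x \<noteq> z" and le: "s * norm (g x - g y) \<le> norm (g x - g z)" for x y z
  proof -
    have ne: "g a \<noteq> g b" if "a \<noteq> b" for a b using Reg that by metis
    have pos: "0 < norm (g x - g z)" using ne[OF xz] by simp
    \<comment> \<open>The quasisymmetry condition speaks of distinct triples only; in the two
      degenerate cases the cleared inequality is checked directly.\<close>
    consider "y = x" | "y = z" | "y \<noteq> x" "y \<noteq> z" by blast
    then show ?thesis
    proof cases
      case 1 then show ?thesis using assms(2) by (simp)
    next
      case 2 then show ?thesis using assms(2) pos xz by (simp add: algebra_simps)
    next
      case 3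
      let ?t = "norm (g x - g y) / norm (g x - g z)"
      have t: "0 \<le> ?t" "?t \<le> 1/s" using le pos assms(2) by (auto simp: field_simps)
      have "dist (Re (g x)) (Re (g y)) \<le> \<eta> (dist (g x) (g y) / dist (g x) (g z)) * dist (Re (g x)) (Re (g z))"
        using eta(1) 3 xz rg ne unfolding qs_condition_def by (metis rangeI)
      then have "\<bar>x - y\<bar> \<le> \<eta> ?t * \<bar>x - z\<bar>" by (simp add: Reg dist_norm)
      also have "\<dots> \<le> (?t + s) * \<bar>x - z\<bar>" using eta(2)[OF t] by (intro mult_right_mono) auto
      finally have "\<bar>x - y\<bar> * norm (g x - g z) \<le> (?t + s) * \<bar>x - z\<bar> * norm (g x - g z)"
        using pos by (intro mult_right_mono) auto
      also have "\<dots> = (norm (g x - g y) + s * norm (g x - g z)) * \<bar>x - z\<bar>"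
        using pos by (simp add: field_simps)
      finally show ?thesis .
    qed
  qed
  then have "qs_curve s g" using cg Reg unfolding qs_curve_def by blast
  then show thesis using rg that by blast
qed

text \<open>Each partial chord is compared with the whole chord from their common endpoint: relative
  to the whole it is at most \<open>1 + 2 * s\<close> times its share of the horizontal extent, and
  the shares add up to 1. A partial chord shorter than \<open>s\<close> times the whole one escapes
  this comparison, but then the triangle inequality suffices. Three points of the graph are thus
  almost collinear, whatever the slope.\<close>

lemma qs_curve_near_additive:
  assumes q: "qs_curve s \<gamma>" and s: "0 < s" "s \<le> 1/2" and ord: "x < y" "y < z"
  shows "norm (\<gamma> x - \<gamma> y) + norm (\<gamma> y - \<gamma> z) \<le> (1 + 2 * s) * norm (\<gamma> x - \<gamma> z)"
proof -
  define a where "a = norm (\<gamma> x - \<gamma> y)"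
  define b where "b = norm (\<gamma> y - \<gamma> z)"
  define c where "c = norm (\<gamma> x - \<gamma> z)"
  have pos: "0 < a" "0 < b" "0 < c" using qs_curve_pos[OF q] ord by (auto simp: a_def b_def c_def)
  have tri: "b \<le> a + c" "a \<le> b + c"
    unfolding a_def b_def c_def by norm+
  have c1: "a \<le> (1 + 2 * s) * (y - x) / (z - x) * c" if "s * c \<le> a"
  proof -
    have "\<bar>x - z\<bar> * norm (\<gamma> x - \<gamma> y) \<le> (norm (\<gamma> x - \<gamma> z) + s * norm (\<gamma> x - \<gamma> y)) * \<bar>x - y\<bar>"
      by (rule qs_curve_ratio[OF q]) (use that ord in \<open>auto simp: a_def c_def\<close>)
    then have 1: "(z - x) * a \<le> (c + s * a) * (y - x)" using ord by (simp add: a_def c_def)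
    also have "\<dots> \<le> c * (y - x) + s * a * (z - x)" using ord s pos by (simp add: algebra_simps)
    finally have 2: "a * (1 - s) * (z - x) \<le> c * (y - x)" by (simp add: algebra_simps)
    \<comment> \<open>\<open>(1 + 2 * s) * (1 - s)\<close> is at least 1 because \<open>s\<close> is
      at most 1/2.\<close>
    have "a * (z - x) \<le> a * ((1 + 2 * s) * (1 - s)) * (z - x)"
      using s pos ord by (intro mult_right_mono) (auto simp: algebra_simps power2_eq_square)
    also have "\<dots> \<le> (1 + 2 * s) * (c * (y - x))"
      using mult_left_mono[OF 2, of "1+2 * s"] s by (simp add: algebra_simps)
    finally show ?thesis using ord by (simp add: field_simps)
  qed
  have c2: "b \<le> (1 + 2 * s) * (z - y) / (z - x) * c" if "s * c \<le> b"
  proof -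
    have "\<bar>z - x\<bar> * norm (\<gamma> z - \<gamma> y) \<le> (norm (\<gamma> z - \<gamma> x) + s * norm (\<gamma> z - \<gamma> y)) * \<bar>z - y\<bar>"
      by (rule qs_curve_ratio[OF q]) (use that ord in \<open>auto simp: b_def c_def norm_minus_commute\<close>)
    then have 1: "(z - x) * b \<le> (c + s * b) * (z - y)" using ord by (simp add: b_def c_def norm_minus_commute)
    also have "\<dots> \<le> c * (z - y) + s * b * (z - x)" using ord s pos by (simp add: algebra_simps)
    finally have 2: "b * (1 - s) * (z - x) \<le> c * (z - y)" by (simp add: algebra_simps)
    have "b * (z - x) \<le> b * ((1 + 2 * s) * (1 - s)) * (z - x)"
      using s pos ord by (intro mult_right_mono) (auto simp: algebra_simps power2_eq_square)
    also have "\<dots> \<le> (1 + 2 * s) * (c * (z - y))"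
      using mult_left_mono[OF 2, of "1+2 * s"] s by (simp add: algebra_simps)
    finally show ?thesis using ord by (simp add: field_simps)
  qed
  have "a + b \<le> (1 + 2 * s) * c"
  proof (cases "s * c \<le> a")
    case False
    then show ?thesis using tri by (simp add: algebra_simps)
  next
    case ta: True
    show ?thesis
    proof (cases "s * c \<le> b")
      case False
      then show ?thesis using tri by (simp add: algebra_simps)
    next
      case True
      have "a + b \<le> (1 + 2 * s) * (y - x) / (z - x) * c + (1 + 2 * s) * (z - y) / (z - x) * c"
        using c1[OF ta] c2[OF True] by linarith
      also have "\<dots> = ((1 + 2 * s) * c / (z - x)) * ((y - x) + (z - y))"
        unfolding distrib_left by (simp add: mult_ac)
      also have "\<dots> = (1 + 2 * s) * c" using ord by simp
      finally show ?thesis .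
    qed
  qed
  then show ?thesis by (simp add: a_def b_def c_def)
qed

lemma qs_curve_affine:
  assumes q: "qs_curve s \<gamma>" and a: "0 < a"
  shows "qs_curve s (\<lambda>x. (\<gamma> (a * x + Re c) - c) / of_real a)"
  unfolding qs_curve_def
proof (intro conjI allI impI)
  show "continuous_on UNIV (\<lambda>x. (\<gamma> (a * x + Re c) - c) / complex_of_real a)"
    using a by (intro continuous_intros continuous_on_compose2[OF qs_curve_continuous[OF q, of UNIV]]) auto
  show "Re ((\<gamma> (a * x + Re c) - c) / complex_of_real a) = x" for x
    using a q by (simp)
  fix x y z
  have *: "norm ((\<gamma> (a * x + Re c) - c) / of_real a - (\<gamma> (a * y + Re c) - c) / of_real a)
      = norm (\<gamma> (a * x + Re c) - \<gamma> (a * y + Re c)) / a" for x y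
    using a by (simp flip: diff_divide_distrib add: norm_divide)
  assume h: "x \<noteq> z \<and>
       s * norm ((\<gamma> (a * x + Re c) - c) / of_real a - (\<gamma> (a * y + Re c) - c) / of_real a)
       \<le> norm ((\<gamma> (a * x + Re c) - c) / of_real a - (\<gamma> (a * z + Re c) - c) / of_real a)"
  have "\<bar>(a * x + Re c) - (a * y + Re c)\<bar> * norm (\<gamma> (a * x + Re c) - \<gamma> (a * z + Re c))
     \<le> (norm (\<gamma> (a * x + Re c) - \<gamma> (a * y + Re c)) + s * norm (\<gamma> (a * x + Re c) - \<gamma> (a * z + Re c)))
        * \<bar>(a * x + Re c) - (a * z + Re c)\<bar>"
  proof (rule qs_curve_ratio[OF q])
    have "s * (norm (\<gamma> (a * x + Re c) - \<gamma> (a * y + Re c)) / a) \<le> norm (\<gamma> (a * x + Re c) - \<gamma> (a * z + Re c)) / a"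
      using h unfolding * by blast
    then show "s * norm (\<gamma> (a * x + Re c) - \<gamma> (a * y + Re c)) \<le> norm (\<gamma> (a * x + Re c) - \<gamma> (a * z + Re c))"
      using a by (simp add: divide_le_cancel)
  qed (use h a in auto)
  moreover have "\<bar>(a * x + Re c) - (a * y + Re c)\<bar> = a * \<bar>x - y\<bar>" for x y
    using a by (simp flip: right_diff_distrib add: abs_mult)
  ultimately have "a * (\<bar>x - y\<bar> * norm (\<gamma> (a * x + Re c) - \<gamma> (a * z + Re c)))
     \<le> a * ((norm (\<gamma> (a * x + Re c) - \<gamma> (a * y + Re c)) + s * norm (\<gamma> (a * x + Re c) - \<gamma> (a * z + Re c)))
        * \<bar>x - z\<bar>)" by (simp only: mult_ac)
  then have "\<bar>x - y\<bar> * norm (\<gamma> (a * x + Re c) - \<gamma> (a * z + Re c))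
     \<le> (norm (\<gamma> (a * x + Re c) - \<gamma> (a * y + Re c)) + s * norm (\<gamma> (a * x + Re c) - \<gamma> (a * z + Re c)))
        * \<bar>x - z\<bar>" using a by (simp only: mult_le_cancel_left_pos)
  then have "\<bar>x - y\<bar> * norm (\<gamma> (a * x + Re c) - \<gamma> (a * z + Re c)) / a
     \<le> (norm (\<gamma> (a * x + Re c) - \<gamma> (a * y + Re c)) + s * norm (\<gamma> (a * x + Re c) - \<gamma> (a * z + Re c)))
        * \<bar>x - z\<bar> / a" by (rule divide_right_mono) (use a in simp)
  then show "\<bar>x - y\<bar> * norm ((\<gamma> (a * x + Re c) - c) / of_real a - (\<gamma> (a * z + Re c) - c) / of_real a)
    \<le> (norm ((\<gamma> (a * x + Re c) - c) / of_real a - (\<gamma> (a * y + Re c) - c) / of_real a) +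
        s * norm ((\<gamma> (a * x + Re c) - c) / of_real a - (\<gamma> (a * z + Re c) - c) / of_real a)) * \<bar>x - z\<bar>"
    unfolding * by (simp add: add_divide_distrib algebra_simps)
qed

lemma epigraph_affine:
  assumes a: "0 < a"
  shows "epigraph (\<lambda>x. (\<gamma> (a * x + Re c) - c) / of_real a) = (\<lambda>w. (w - c) / of_real a) ` epigraph \<gamma>"
proof (intro set_eqI iffI)
  fix w assume w: "w \<in> epigraph (\<lambda>x. (\<gamma> (a * x + Re c) - c) / of_real a)"
  then have "a * w + c \<in> epigraph \<gamma>"
    using a by (simp add: epigraph_def field_simps)
  moreover have "w = ((a * w + c) - c) / of_real a" using a by simp
  ultimately show "w \<in> (\<lambda>w. (w - c) / of_real a) ` epigraph \<gamma>" by blast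
next
  fix w assume "w \<in> (\<lambda>w. (w - c) / of_real a) ` epigraph \<gamma>"
  then show "w \<in> epigraph (\<lambda>x. (\<gamma> (a * x + Re c) - c) / of_real a)"
    using a by (auto simp: epigraph_def divide_strict_right_mono)
qed

section \<open>Topology of the epigraph\<close>

lemma open_epigraph:
  assumes "continuous_on UNIV \<gamma>" shows "open (epigraph \<gamma>)"
  unfolding epigraph_def
  by (intro open_Collect_less continuous_intros continuous_on_compose2[OF assms]) auto

lemma homeomorphic_epigraph:
  assumes c: "continuous_on UNIV \<gamma>" shows "epigraph \<gamma> homeomorphic uhp"
  unfolding homeomorphic_def
proof (intro exI homeomorphismI)
  have cc: "continuous_on A (\<lambda>x. \<gamma> (Re x))" for A
    by (intro continuous_on_compose2[OF c] continuous_intros) auto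
  show "continuous_on (epigraph \<gamma>) (\<lambda>w. w - \<i> * Im (\<gamma> (Re w)))"
    by (intro continuous_intros cc)
  show "continuous_on uhp (\<lambda>w. w + \<i> * Im (\<gamma> (Re w)))"
    by (intro continuous_intros cc)
qed (auto simp: epigraph_def complex_eq_iff)

lemma convex_uhp: "convex uhp"
  by (rule convex_halfspace_Im_gt)

lemma open_uhp: "open uhp"
  by (rule open_halfspace_Im_gt)

lemma simply_connected_epigraph:
  assumes c: "continuous_on UNIV \<gamma>" shows "simply_connected (epigraph \<gamma>)"
  using homeomorphic_simply_connected_eq[OF homeomorphic_epigraph[OF c]]
    convex_imp_simply_connected[OF convex_uhp] by simp

lemma epigraph_frontier:
  assumes c: "continuous_on UNIV \<gamma>" and R: "\<And>x. Re (\<gamma> x) = x"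
  shows "closure (epigraph \<gamma>) - epigraph \<gamma> \<subseteq> range \<gamma>"
proof
  fix w assume w: "w \<in> closure (epigraph \<gamma>) - epigraph \<gamma>"
  have "closed {w. Im (\<gamma> (Re w)) \<le> Im w}"
    by (intro closed_Collect_le continuous_intros continuous_on_compose2[OF c]) auto
  then have "closure (epigraph \<gamma>) \<subseteq> {w. Im (\<gamma> (Re w)) \<le> Im w}"
    by (intro closure_minimal) (auto simp: epigraph_def)
  then have "Im (\<gamma> (Re w)) = Im w" using w by (auto simp: epigraph_def)
  then have "w = \<gamma> (Re w)" using R by (simp add: complex_eq_iff)
  then show "w \<in> range \<gamma>" by blast
qed

lemma graph_not_epigraph: "(\<And>x. Re (\<gamma> x) = x) \<Longrightarrow> \<gamma> x \<notin> epigraph \<gamma>"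
  by (simp add: epigraph_def)

text \<open>Serves to place whole discs in the epigraph: once a disc misses the graph, a single
  point decides.\<close>

lemma connected_subset_epigraph:
  assumes c: "continuous_on UNIV \<gamma>" and R: "\<And>x. Re (\<gamma> x) = x"
    and K: "connected K" "K \<inter> range \<gamma> = {}" "K \<inter> epigraph \<gamma> \<noteq> {}"
  shows "K \<subseteq> epigraph \<gamma>"
proof (rule ccontr)
  assume "\<not> K \<subseteq> epigraph \<gamma>"
  then have "K \<inter> frontier (epigraph \<gamma>) \<noteq> {}"
    by (intro connected_Int_frontier K) auto
  moreover have "frontier (epigraph \<gamma>) \<subseteq> range \<gamma>"
    using epigraph_frontier[OF c R] open_epigraph[OF c] by (simp add: frontier_def interior_open)
  ultimately show False using K by blast
qed

text \<open>Together with \<open>qs_curve_affine\<close> this moves any point of the half-plane to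
  \<open>\<i>\<close> and normalises the map there. The domain is scaled by \<open>b\<close> and the
  target by \<open>a\<close>, independently.\<close>

lemma graph_map_affine:
  assumes g: "graph_map \<gamma> f" and a: "0 < a" and b: "0 < b"
  shows "graph_map (\<lambda>x. (\<gamma> (a * x + Re c) - c) / of_real a) (\<lambda>z. (f (of_real b * z + of_real x) - c) / of_real a)"
  unfolding graph_map_def
proof (intro conjI ballI)
  let ?l = "\<lambda>z. of_real b * z + of_real x"
  have holf: "f holomorphic_on uhp" and inj: "inj_on f uhp" and im: "f ` uhp = epigraph \<gamma>"
    and pos: "\<And>z. z \<in> uhp \<Longrightarrow> 0 < Re (deriv f z)" using g by (auto simp: graph_map_def)
  have lim: "?l ` uhp = uhp"
  proof (intro set_eqI iffI)
    fix w assume w: "w \<in> uhp"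
    have "w = ?l ((w - of_real x) / of_real b)" using b by simp
    moreover have "(w - of_real x) / of_real b \<in> uhp" using b w by simp
    ultimately show "w \<in> ?l ` uhp" by blast
  qed (use b in auto)
  have "(\<lambda>z. f (?l z)) holomorphic_on uhp"
  proof -
    have "(f \<circ> ?l) holomorphic_on uhp"
      by (rule holomorphic_on_compose_gen[OF _ holf]) (use b in \<open>auto intro!: holomorphic_intros\<close>)
    then show ?thesis by (simp add: o_def)
  qed
  then show "(\<lambda>z. (f (?l z) - c) / of_real a) holomorphic_on uhp"
    using a by (intro holomorphic_intros) auto
  show "inj_on (\<lambda>z. (f (?l z) - c) / of_real a) uhp"
  proof (rule inj_onI)
    fix z w assume zw: "z \<in> uhp" "w \<in> uhp" "(f (?l z) - c) / of_real a = (f (?l w) - c) / of_real a"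
    then have "f (?l z) = f (?l w)" using a by simp
    then have "?l z = ?l w" by (rule inj_onD[OF inj]) (use zw b in auto)
    then show "z = w" using b by simp
  qed
  have "(\<lambda>z. (f (?l z) - c) / of_real a) ` uhp = (\<lambda>w. (w - c) / of_real a) ` f ` ?l ` uhp"
    by (simp add: image_image)
  then show "(\<lambda>z. (f (?l z) - c) / of_real a) ` uhp = epigraph (\<lambda>x. (\<gamma> (a * x + Re c) - c) / of_real a)"
    using epigraph_affine[OF a] lim im by simp
  fix z assume z: "z \<in> uhp"
  then have lz: "?l z \<in> uhp" using lim by blast
  have "(f has_field_derivative deriv f (?l z)) (at (?l z))"
    using holomorphic_derivI[OF holf open_uhp lz] .
  then have "((\<lambda>z. f (?l z)) has_field_derivative deriv f (?l z) * of_real b) (at z)"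
    by (rule DERIV_chain2) (auto intro!: derivative_eq_intros)
  then have "((\<lambda>z. (f (?l z) - c) / of_real a) has_field_derivative deriv f (?l z) * of_real b / of_real a) (at z)"
    using a by (auto intro!: derivative_eq_intros)
  then have "deriv (\<lambda>z. (f (?l z) - c) / of_real a) z = of_real (b/a) * deriv f (?l z)"
    by (simp add: DERIV_imp_deriv)
  moreover have "Re (of_real (b/a) * deriv f (?l z)) = (b/a) * Re (deriv f (?l z))"
    by simp
  ultimately show "0 < Re (deriv (\<lambda>z. (f (?l z) - c) / of_real a) z)"
    using pos[OF lz] a b by simp
qed

section \<open>Conformal maps with derivative in the right half-plane\<close>

lemma moebius_eq:
  fixes a z :: complex
  assumes "norm a < 1" "norm z < 1"
  shows "1 - (norm (Moebius_function 0 a z))\<^sup>2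
       = (1 - (norm a)\<^sup>2) * (1 - (norm z)\<^sup>2) / (norm (1 - cnj a * z))\<^sup>2" and "1 - cnj a * z \<noteq> 0"
proof -
  show ne: "1 - cnj a * z \<noteq> 0"
  proof
    assume "1 - cnj a * z = 0"
    then have "norm (cnj a * z) = 1" by simp
    moreover have "norm (cnj a * z) < 1" using norm_mult_less[of "cnj a" 1 z 1] assms by simp
    ultimately show False by simp
  qed
  have "(norm (1 - cnj a * z))\<^sup>2 - (norm (z - a))\<^sup>2 = (1 - (norm a)\<^sup>2) * (1 - (norm z)\<^sup>2)"
    unfolding cmod_power2 by (simp add: algebra_simps power2_eq_square)
  then show "1 - (norm (Moebius_function 0 a z))\<^sup>2
       = (1 - (norm a)\<^sup>2) * (1 - (norm z)\<^sup>2) / (norm (1 - cnj a * z))\<^sup>2"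
    using ne by (simp add: Moebius_function_simple norm_divide power_divide field_simps)
qed

lemma Schwarz_Pick:
  assumes hol: "g holomorphic_on ball 0 1" and im: "\<And>z. norm z < 1 \<Longrightarrow> norm (g z) < 1"
    and a: "norm a < 1" and z: "norm z < 1"
  shows "norm (Moebius_function 0 (g a) (g z)) \<le> norm (Moebius_function 0 a z)"
proof -
  let ?k = "\<lambda>w. Moebius_function 0 (g a) (g (Moebius_function 0 (- a) w))"
  have na: "norm (- a) < 1" using a by simp
  have h1: "(\<lambda>w. g (Moebius_function 0 (- a) w)) holomorphic_on ball 0 1"
    using holomorphic_on_compose_gen[OF Moebius_function_holomorphic[OF na] hol, of 0] Moebius_function_norm_lt_1[OF na]
    by (auto simp: o_def image_subset_iff)
  have h2: "?k holomorphic_on ball 0 1"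
    using holomorphic_on_compose_gen[OF h1 Moebius_function_holomorphic[OF im[OF a]], of 0]
      Moebius_function_norm_lt_1[OF na] im
    by (auto simp: o_def image_subset_iff)
  let ?w = "Moebius_function 0 a z"
  have w: "norm ?w < 1" using Moebius_function_norm_lt_1[OF a z] .
  have inv_w: "Moebius_function 0 (- a) ?w = z"
    using Moebius_function_compose[of "-a" a z] a z by simp
  have "norm (?k ?w) \<le> norm ?w"
  proof (rule Schwarz_Lemma(1)[OF h2 _ _ w])
    show "?k 0 = 0" by (simp add: Moebius_function_of_zero Moebius_function_eq_zero)
    show "norm (?k z) < 1" if "norm z < 1" for z
      using that im a Moebius_function_norm_lt_1[OF na] by (intro Moebius_function_norm_lt_1) auto
  qed
  then show ?thesis by (simp add: inv_w)
qed

text \<open>The cleared form exhibits the factors \<open>1 - (norm a)\<^sup>2\<close> and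
  \<open>1 - (norm (g a))\<^sup>2\<close>, which vanish at the circle; once they are compared and
  cancelled, the remaining inequality passes to a boundary point.\<close>

lemma Schwarz_Pick_horo:
  assumes hol: "g holomorphic_on ball 0 1" and im: "\<And>z. norm z < 1 \<Longrightarrow> norm (g z) < 1"
    and a: "norm a < 1" and z: "norm z < 1"
  shows "(1 - (norm a)\<^sup>2) * (1 - (norm z)\<^sup>2) * (norm (1 - cnj (g a) * g z))\<^sup>2
      \<le> (1 - (norm (g a))\<^sup>2) * (1 - (norm (g z))\<^sup>2) * (norm (1 - cnj a * z))\<^sup>2"
proof -
  have "(norm (Moebius_function 0 (g a) (g z)))\<^sup>2 \<le> (norm (Moebius_function 0 a z))\<^sup>2"
    using Schwarz_Pick[OF assms] by simp
  then have "(1 - (norm a)\<^sup>2) * (1 - (norm z)\<^sup>2) / (norm (1 - cnj a * z))\<^sup>2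
     \<le> (1 - (norm (g a))\<^sup>2) * (1 - (norm (g z))\<^sup>2) / (norm (1 - cnj (g a) * g z))\<^sup>2"
    using moebius_eq(1)[OF a z] moebius_eq(1)[OF im[OF a] im[OF z]] by linarith
  then show ?thesis
    using moebius_eq(2)[OF a z] moebius_eq(2)[OF im[OF a] im[OF z]] by (simp add: field_simps)
qed

text \<open>A variant of Wolff's lemma: \<open>\<tau>\<close> is a limit of points \<open>\<zeta> R\<close> at last exit times from discs, so that
  \<open>\<sigma> t\<close> does not decrease their norms and Schwarz--Pick passes to the limit as invariance of horodiscs at \<open>\<tau>\<close>.\<close>
lemma Wolff_family:
  fixes \<zeta> :: "real \<Rightarrow> complex" and \<sigma> :: "real \<Rightarrow> complex \<Rightarrow> complex"
  assumes hol: "\<And>t. 0 \<le> t \<Longrightarrow> \<sigma> t holomorphic_on ball 0 1"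
    and im: "\<And>t z. 0 \<le> t \<Longrightarrow> norm z < 1 \<Longrightarrow> norm (\<sigma> t z) < 1"
    and cz: "continuous_on {0..} \<zeta>" and nz: "\<And>t. 0 \<le> t \<Longrightarrow> norm (\<zeta> t) < 1"
    and lim: "\<And>r. r < 1 \<Longrightarrow> eventually (\<lambda>t. r < norm (\<zeta> t)) at_top"
    and orb: "\<And>R t. 0 \<le> R \<Longrightarrow> 0 \<le> t \<Longrightarrow> \<sigma> t (\<zeta> R) = \<zeta> (R + t)"
  obtains \<tau> where "norm \<tau> = 1"
    "\<And>t z. 0 \<le> t \<Longrightarrow> norm z < 1 \<Longrightarrow>
       (1 - (norm z)\<^sup>2) * (norm (1 - cnj \<tau> * \<sigma> t z))\<^sup>2 \<le> (1 - (norm (\<sigma> t z))\<^sup>2) * (norm (1 - cnj \<tau> * z))\<^sup>2"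
proof -
  have ex: "\<exists>R\<ge>0. r \<le> norm (\<zeta> R) \<and> (\<forall>t\<ge>0. norm (\<zeta> R) \<le> norm (\<zeta> (R + t)))" if r: "r < 1" for r
  proof -
    \<comment> \<open>The radius is raised to at least \<open>norm (\<zeta> 0)\<close>, so that time
      0 belongs to \<open>S\<close> and a last time in the disc exists.\<close>
    define r' where "r' = max r (norm (\<zeta> 0))"
    have r': "r' < 1" using r nz[of 0] by (simp add: r'_def)
    obtain N where N: "\<And>t. N \<le> t \<Longrightarrow> r' < norm (\<zeta> t)" using lim[OF r'] by (auto simp: eventually_at_top_linorder)
    define S where "S = {R \<in> {0..N}. norm (\<zeta> R) \<le> r'}"
    have cN: "continuous_on {0..N} (\<lambda>R. norm (\<zeta> R))"
      by (intro continuous_intros continuous_on_subset[OF cz]) auto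
    have "closed S" unfolding S_def
      by (rule continuous_on_closed_Collect_le[OF cN]) auto
    then have cS: "compact S" unfolding compact_eq_bounded_closed
      using bounded_subset[OF bounded_closed_interval[of 0 N], of S] by (fastforce simp: S_def)
    have N0: "0 \<le> N" using N[of 0] by (force simp: r'_def)
    have "0 \<in> S" using N0 by (auto simp: S_def r'_def)
    then obtain R where R: "R \<in> S" "\<And>t. t \<in> S \<Longrightarrow> t \<le> R" using compact_attains_sup[OF cS] by auto
    have R0: "0 \<le> R" "R \<le> N" "norm (\<zeta> R) \<le> r'" using R(1) by (auto simp: S_def)
    have after: "r' < norm (\<zeta> t)" if "R < t" for t
    proof (rule ccontr)
      assume "\<not> r' < norm (\<zeta> t)"
      then have "t \<in> S" using N[of t] that R0 by (cases "N \<le> t") (auto simp: S_def)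
      then show False using R(2)[of t] that by simp
    qed
    have "r' \<le> norm (\<zeta> R)"
    proof (rule ccontr)
      assume a: "\<not> r' \<le> norm (\<zeta> R)"
      have "R \<noteq> N" using N[of N] R0 by auto
      then have RN: "R < N" using R0 by simp
      obtain x where "R \<le> x" "x \<le> N" "norm (\<zeta> x) = r'"
        using IVT'[of "\<lambda>R. norm (\<zeta> R)" R r' N] a N[of N] RN R0
          continuous_on_subset[OF cN, of "{R..N}"] by auto
      then show False using after[of x] a by (cases "x = R") auto
    qed
    moreover have "norm (\<zeta> R) \<le> norm (\<zeta> (R + t))" if "0 \<le> t" for t
      using after[of "R + t"] R0 that by (cases "t = 0") auto
    ultimately show ?thesis using R0 by (intro exI[of _ R]) (auto simp: r'_def)
  qed
  have "\<forall>n. \<exists>R\<ge>0. 1 - 1 / real (Suc n) \<le> norm (\<zeta> R) \<and> (\<forall>t\<ge>0. norm (\<zeta> R) \<le> norm (\<zeta> (R + t)))"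
    by (intro allI ex) auto
  then obtain R where R: "\<And>n. 0 \<le> R n" "\<And>n. 1 - 1 / real (Suc n) \<le> norm (\<zeta> (R n))"
    "\<And>n t. 0 \<le> t \<Longrightarrow> norm (\<zeta> (R n)) \<le> norm (\<zeta> (R n + t))" by metis
  have "compact (cball (0::complex) 1)" by simp
  moreover have "\<forall>n. \<zeta> (R n) \<in> cball 0 1" using nz R(1) by (auto intro: less_imp_le)
  ultimately obtain \<tau> q where q: "strict_mono (q :: nat \<Rightarrow> nat)" and lt: "((\<lambda>n. \<zeta> (R n)) \<circ> q) \<longlonglongrightarrow> \<tau>"
    unfolding compact_def by metis
  define b where "b n = \<zeta> (R (q n))" for n
  have b: "b \<longlonglongrightarrow> \<tau>" using lt unfolding b_def[abs_def] o_def .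
  have bn: "norm (b n) < 1" for n using nz R(1) by (simp add: b_def)
  have nb: "(\<lambda>n. norm (b n)) \<longlonglongrightarrow> 1"
  proof (rule tendsto_sandwich)
    show "(\<lambda>n. 1 - 1 / real (Suc (q n))) \<longlonglongrightarrow> 1"
      using LIMSEQ_subseq_LIMSEQ[OF tendsto_diff[OF tendsto_const[of 1] LIMSEQ_inverse_real_of_nat] q]
      by (simp add: o_def inverse_eq_divide)
    show "\<forall>\<^sub>F n in sequentially. 1 - 1 / real (Suc (q n)) \<le> norm (b n)" using R(2) by (simp add: b_def)
    show "\<forall>\<^sub>F n in sequentially. norm (b n) \<le> 1" using bn by (auto intro!: always_eventually less_imp_le)
  qed auto
  have tau: "norm \<tau> = 1" using tendsto_norm[OF b] nb LIMSEQ_unique by blast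
  have "(1 - (norm z)\<^sup>2) * (norm (1 - cnj \<tau> * \<sigma> t z))\<^sup>2 \<le> (1 - (norm (\<sigma> t z))\<^sup>2) * (norm (1 - cnj \<tau> * z))\<^sup>2"
    if t: "0 \<le> t" and z: "norm z < 1" for t z
  proof -
    define c where "c n = \<sigma> t (b n)" for n
    have cb: "c n = \<zeta> (R (q n) + t)" for n using orb R(1) t by (simp add: c_def b_def)
    have cn: "norm (c n) < 1" "norm (b n) \<le> norm (c n)" for n
    proof -
      show "norm (c n) < 1" unfolding c_def by (rule im[OF t bn])
      show "norm (b n) \<le> norm (c n)" unfolding cb b_def by (rule R(3)[OF t])
    qed
    text \<open>the pseudohyperbolic distance from \<open>b n\<close> to \<open>c n\<close> stays below that from \<open>\<zeta> 0\<close> to \<open>\<zeta> t\<close>\<close>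
    define \<rho> where "\<rho> = norm (Moebius_function 0 (\<zeta> 0) (\<zeta> t))"
    have rho: "0 \<le> \<rho>" "\<rho> < 1" unfolding \<rho>_def using Moebius_function_norm_lt_1 nz t by auto
    have dist: "norm (c n - b n) \<le> \<rho> * norm (1 - cnj (b n) * c n)" for n
    proof -
      have "norm (Moebius_function 0 (\<sigma> (R (q n)) (\<zeta> 0)) (\<sigma> (R (q n)) (\<zeta> t))) \<le> \<rho>"
        unfolding \<rho>_def by (rule Schwarz_Pick) (use hol im R(1) nz t in auto)
      then have "norm (Moebius_function 0 (b n) (c n)) \<le> \<rho>"
        using orb[of 0 "R (q n)"] orb[of t "R (q n)"] R(1) t by (simp add: b_def cb add.commute)
      then show ?thesis using moebius_eq(2)[OF bn cn(1)]
        by (simp add: Moebius_function_simple norm_divide pos_divide_le_eq)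
    qed
    \<comment> \<open>Writing \<open>1 - cnj b * c\<close> as
      \<open>(1 - (norm b)\<^sup>2) - cnj b * (c - b)\<close> turns the pseudohyperbolic bound into
      a Euclidean one: \<open>c n\<close> and \<open>b n\<close> have the same limit at the
      circle.\<close>
    have small: "norm (c n - b n) * (1 - \<rho>) \<le> 1 - (norm (b n))\<^sup>2" for n
    proof -
      have e: "1 - cnj (b n) * c n = of_real (1 - (norm (b n))\<^sup>2) - cnj (b n) * (c n - b n)"
        using complex_norm_square[of "b n"] by (simp add: algebra_simps)
      have "norm (1 - cnj (b n) * c n) \<le> (1 - (norm (b n))\<^sup>2) + norm (b n) * norm (c n - b n)"
      proof -
        have "norm (b n) ^ 2 \<le> 1" using bn[of n] by (intro power_le_one) auto
        then show ?thesis unfolding e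
          by (intro order_trans[OF norm_triangle_ineq4]) (auto simp: norm_mult simp del: of_real_diff)
      qed
      also have "\<dots> \<le> (1 - (norm (b n))\<^sup>2) + 1 * norm (c n - b n)"
        using bn[of n] by (intro add_left_mono mult_right_mono) auto
      finally have "\<rho> * norm (1 - cnj (b n) * c n) \<le> \<rho> * ((1 - (norm (b n))\<^sup>2) + norm (c n - b n))"
        using rho by (intro mult_left_mono) auto
      moreover have "\<rho> * (1 - (norm (b n))\<^sup>2) \<le> 1 * (1 - (norm (b n))\<^sup>2)"
        using rho bn[of n] by (intro mult_right_mono) (auto simp: abs_square_le_1 power_le_one)
      ultimately show ?thesis using dist[of n] by (simp add: algebra_simps)
    qed
    have "(\<lambda>n. c n - b n) \<longlonglongrightarrow> 0"
    proof (rule Lim_null_comparison)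
      show "(\<lambda>n. (1 - (norm (b n))\<^sup>2) / (1 - \<rho>)) \<longlonglongrightarrow> 0"
        using tendsto_divide[OF tendsto_diff[OF tendsto_const[of 1] tendsto_power[OF nb, of 2]] tendsto_const[of "1 - \<rho>"]] rho by simp
      show "\<forall>\<^sub>F n in sequentially. norm (c n - b n) \<le> (1 - (norm (b n))\<^sup>2) / (1 - \<rho>)"
        using small rho by (auto simp: pos_le_divide_eq)
    qed
    then have "(\<lambda>n. (c n - b n) + b n) \<longlonglongrightarrow> 0 + \<tau>"
      using b by (rule tendsto_add)
    then have c: "c \<longlonglongrightarrow> \<tau>" by simp
    have ineq: "(1 - (norm z)\<^sup>2) * (norm (1 - cnj (c n) * \<sigma> t z))\<^sup>2
        \<le> (1 - (norm (\<sigma> t z))\<^sup>2) * (norm (1 - cnj (b n) * z))\<^sup>2" for n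
    proof -
      have p: "0 < 1 - (norm (b n))\<^sup>2" using bn[of n] by (simp add: abs_square_less_1)
      have sz: "0 \<le> 1 - (norm (\<sigma> t z))\<^sup>2" using im[OF t z] by (simp add: power_le_one)
      have "(norm (b n))\<^sup>2 \<le> (norm (c n))\<^sup>2" using cn(2)[of n] by simp
      have "(1 - (norm (b n))\<^sup>2) * ((1 - (norm z)\<^sup>2) * (norm (1 - cnj (c n) * \<sigma> t z))\<^sup>2)
        \<le> (1 - (norm (c n))\<^sup>2) * ((1 - (norm (\<sigma> t z))\<^sup>2) * (norm (1 - cnj (b n) * z))\<^sup>2)"
        using Schwarz_Pick_horo[OF hol[OF t] im[OF t] bn z, of n] by (simp add: c_def mult_ac)
      \<comment> \<open>The choice of last exit times enters here: the norm of \<open>c n\<close> is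
        not below that of \<open>b n\<close>, so its factor can be replaced, and the common factor
        tending to 0 cancels before the limit is taken.\<close>
      also have "\<dots> \<le> (1 - (norm (b n))\<^sup>2) * ((1 - (norm (\<sigma> t z))\<^sup>2) * (norm (1 - cnj (b n) * z))\<^sup>2)"
        using sz \<open>(norm (b n))\<^sup>2 \<le> (norm (c n))\<^sup>2\<close> by (intro mult_right_mono) auto
      finally show ?thesis using p by simp
    qed
    show ?thesis
    proof (rule LIMSEQ_le)
      show "(\<lambda>n. (1 - (norm z)\<^sup>2) * (norm (1 - cnj (c n) * \<sigma> t z))\<^sup>2)
         \<longlonglongrightarrow> (1 - (norm z)\<^sup>2) * (norm (1 - cnj \<tau> * \<sigma> t z))\<^sup>2" by (intro tendsto_intros c)
      show "(\<lambda>n. (1 - (norm (\<sigma> t z))\<^sup>2) * (norm (1 - cnj (b n) * z))\<^sup>2)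
         \<longlonglongrightarrow> (1 - (norm (\<sigma> t z))\<^sup>2) * (norm (1 - cnj \<tau> * z))\<^sup>2" by (intro tendsto_intros b)
      show "\<exists>N. \<forall>n\<ge>N. (1 - (norm z)\<^sup>2) * (norm (1 - cnj (c n) * \<sigma> t z))\<^sup>2
          \<le> (1 - (norm (\<sigma> t z))\<^sup>2) * (norm (1 - cnj (b n) * z))\<^sup>2" using ineq by blast
    qed
  qed
  then show thesis using tau that by blast
qed

text \<open>The right side is the Poisson kernel of the disc at 1, constant on horocycles there.
  After the rotation by \<open>cnj \<tau>\<close> the horodisc inequality of
  \<open>Wolff_family\<close> becomes monotonicity of an imaginary part.\<close>

lemma cayley_inv_Im:
  fixes z :: complex
  assumes "norm z < 1"
  shows "Im (\<i> * (1 + z) / (1 - z)) = (1 - (norm z)\<^sup>2) / (norm (1 - z))\<^sup>2"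
proof -
  have "\<i> * (1 + z) / (1 - z) = \<i> * (1 + z) * cnj (1 - z) / of_real ((norm (1 - z))\<^sup>2)"
    by (subst complex_div_cnj) simp
  also have "Im \<dots> = Im (\<i> * (1 + z) * cnj (1 - z)) / (norm (1 - z))\<^sup>2"
    by (rule Im_divide_of_real)
  also have "Im (\<i> * (1 + z) * cnj (1 - z)) = 1 - (norm z)\<^sup>2"
    unfolding cmod_power2 by (simp add: algebra_simps power2_eq_square)
  finally show ?thesis .
qed

lemma cayley_bij:
  fixes z :: complex
  shows "0 < Im z \<Longrightarrow> norm ((z - \<i>) / (z + \<i>)) < 1"
    and "0 < Im z \<Longrightarrow> \<i> * (1 + (z - \<i>) / (z + \<i>)) / (1 - (z - \<i>) / (z + \<i>)) = z"
    and "norm w < 1 \<Longrightarrow> (\<i> * (1 + w) / (1 - w) - \<i>) / (\<i> * (1 + w) / (1 - w) + \<i>) = w"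
    and "norm w < 1 \<Longrightarrow> 0 < Im (\<i> * (1 + w) / (1 - w))"
proof -
  show "norm ((z - \<i>) / (z + \<i>)) < 1" if "0 < Im z"
  proof -
    have "(norm (z - \<i>))\<^sup>2 < (norm (z + \<i>))\<^sup>2"
      using that unfolding cmod_power2 by (simp add: power2_eq_square algebra_simps)
    then have "norm (z - \<i>) < norm (z + \<i>)" by (rule power2_less_imp_less) simp
    then show ?thesis by (simp add: norm_divide divide_less_eq)
  qed
  show "\<i> * (1 + (z - \<i>) / (z + \<i>)) / (1 - (z - \<i>) / (z + \<i>)) = z" if "0 < Im z"
  proof -
    have "z + \<i> \<noteq> 0" using that by (auto simp: complex_eq_iff)
    then have "1 + (z - \<i>) / (z + \<i>) = 2 * z / (z + \<i>)" "1 - (z - \<i>) / (z + \<i>) = 2 * \<i> / (z + \<i>)"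
      by (simp_all add: field_simps)
    then show ?thesis using \<open>z + \<i> \<noteq> 0\<close> by simp
  qed
  show "(\<i> * (1 + w) / (1 - w) - \<i>) / (\<i> * (1 + w) / (1 - w) + \<i>) = w" if "norm w < 1"
  proof -
    have ne: "1 - w \<noteq> 0" using that by auto
    have "\<i> * (1 + w) / (1 - w) - \<i> = (\<i> * (1 + w) - \<i> * (1 - w)) / (1 - w)"
      "\<i> * (1 + w) / (1 - w) + \<i> = (\<i> * (1 + w) + \<i> * (1 - w)) / (1 - w)"
      using nonzero_mult_div_cancel_right[OF ne, of \<i>] by (simp_all only: diff_divide_distrib add_divide_distrib)
    moreover have "\<i> * (1 + w) - \<i> * (1 - w) = 2 * \<i> * w" "\<i> * (1 + w) + \<i> * (1 - w) = 2 * \<i>"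
      by (simp_all add: algebra_simps)
    ultimately have "\<i> * (1 + w) / (1 - w) - \<i> = 2 * \<i> * w / (1 - w)" "\<i> * (1 + w) / (1 - w) + \<i> = 2 * \<i> / (1 - w)"
      by simp_all
    then show ?thesis using ne by simp
  qed
  show "0 < Im (\<i> * (1 + w) / (1 - w))" if "norm w < 1"
  proof -
    have "1 - w \<noteq> 0" using that by auto
    moreover have "(norm w)\<^sup>2 < 1" using that by (simp add: abs_square_less_1)
    ultimately show ?thesis unfolding cayley_inv_Im[OF that] by (intro divide_pos_pos) auto
  qed
qed

text \<open>The Riemann map conjugates the upward translations to self-maps of the disc, to which
  \<open>Wolff_family\<close> applies: the orbit of one point leaves every compact set because the
  translated points tend to infinity. Rotating \<open>\<tau>\<close> to 1 and sending it to infinity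
  gives an inverse map \<open>h\<close> whose imaginary part does not decrease upwards.\<close>

lemma graph_map_exists:
  assumes c: "continuous_on UNIV \<gamma>" and R: "\<And>x. Re (\<gamma> x) = x"
  obtains f where "graph_map \<gamma> f"
proof -
  have op: "open (epigraph \<gamma>)" using open_epigraph[OF c] .
  have ne: "epigraph \<gamma> \<noteq> {}" "epigraph \<gamma> \<noteq> UNIV"
  proof -
    have "\<gamma> 0 + \<i> \<in> epigraph \<gamma>" by (simp add: epigraph_def R)
    moreover have "\<gamma> 0 \<notin> epigraph \<gamma>" by (simp add: epigraph_def R)
    ultimately show "epigraph \<gamma> \<noteq> {}" "epigraph \<gamma> \<noteq> UNIV" by blast+
  qed
  obtain A B where AB: "A holomorphic_on epigraph \<gamma>" "B holomorphic_on ball 0 1"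
    "\<And>z. z \<in> epigraph \<gamma> \<Longrightarrow> A z \<in> ball 0 1 \<and> B (A z) = z"
    "\<And>z. z \<in> ball 0 1 \<Longrightarrow> B z \<in> epigraph \<gamma> \<and> A (B z) = z"
    using simply_connected_epigraph[OF c] ne unfolding simply_connected_eq_biholomorphic_to_disc[OF op] by blast
  define w0 where "w0 = \<gamma> 0 + \<i>"
  have up: "w + \<i> * of_real t \<in> epigraph \<gamma>" if "w \<in> epigraph \<gamma>" "0 \<le> t" for w t
    using that by (auto simp: epigraph_def)
  have w0: "w0 + \<i> * of_real t \<in> epigraph \<gamma>" if "0 \<le> t" for t
    by (rule up[OF _ that]) (simp add: w0_def epigraph_def R)
  define \<zeta> where "\<zeta> t = A (w0 + \<i> * of_real t)" for t
  define \<sigma> where "\<sigma> t z = A (B z + \<i> * of_real t)" for t z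
  have s1: "\<sigma> t holomorphic_on ball 0 1" if "0 \<le> t" for t
    unfolding \<sigma>_def
  proof (rule holomorphic_on_compose_gen[of "\<lambda>z. B z + \<i> * of_real t" "ball 0 1" A "epigraph \<gamma>", unfolded o_def])
    show "(\<lambda>z. B z + \<i> * of_real t) holomorphic_on ball 0 1" by (intro holomorphic_intros AB(2))
    show "A holomorphic_on epigraph \<gamma>" by (rule AB(1))
    show "(\<lambda>z. B z + \<i> * of_real t) ` ball 0 1 \<subseteq> epigraph \<gamma>" using AB(4) up that by blast
  qed
  have s2: "norm (\<sigma> t z) < 1" if "0 \<le> t" "norm z < 1" for t z
    using AB(3)[OF up[of "B z" t]] AB(4)[of z] that by (auto simp: \<sigma>_def)
  have z1: "continuous_on {0..} \<zeta>"
    unfolding \<zeta>_def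
    by (rule continuous_on_compose2[OF holomorphic_on_imp_continuous_on[OF AB(1)]]) (auto intro!: continuous_intros w0)
  have z2: "norm (\<zeta> t) < 1" if "0 \<le> t" for t using AB(3)[OF w0[OF that]] by (simp add: \<zeta>_def)
  have z3: "eventually (\<lambda>t. r < norm (\<zeta> t)) at_top" if r: "r < 1" for r
  proof -
    have "compact (B ` cball 0 r)"
      by (rule compact_continuous_image[OF continuous_on_subset[OF holomorphic_on_imp_continuous_on[OF AB(2)]]]) (use r in auto)
    then obtain M where M: "\<And>w. w \<in> B ` cball 0 r \<Longrightarrow> norm w \<le> M"
      using compact_imp_bounded bounded_iff by metis
    have "r < norm (\<zeta> t)" if t: "max 0 (M + norm w0 + 1) \<le> t" for t
    proof (rule ccontr)
      assume "\<not> r < norm (\<zeta> t)"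
      then have "B (\<zeta> t) \<in> B ` cball 0 r" by auto
      then have "norm (w0 + \<i> * of_real t) \<le> M" using M AB(3)[OF w0[of t]] t by (simp add: \<zeta>_def)
      moreover have "norm (\<i> * of_real t :: complex) \<le> norm (w0 + \<i> * of_real t) + norm w0"
        by (metis add_diff_cancel_left' norm_triangle_ineq4)
      ultimately show False using t by (simp add: norm_mult)
    qed
    then show ?thesis unfolding eventually_at_top_linorder by blast
  qed
  have z4: "\<sigma> t (\<zeta> R) = \<zeta> (R + t)" if "0 \<le> R" "0 \<le> t" for R t
    using AB(3)[OF w0[OF that(1)]] by (simp add: \<sigma>_def \<zeta>_def algebra_simps)
  obtain \<tau> where tau: "norm \<tau> = 1"
    and horo: "\<And>t z. 0 \<le> t \<Longrightarrow> norm z < 1 \<Longrightarrow>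
       (1 - (norm z)\<^sup>2) * (norm (1 - cnj \<tau> * \<sigma> t z))\<^sup>2 \<le> (1 - (norm (\<sigma> t z))\<^sup>2) * (norm (1 - cnj \<tau> * z))\<^sup>2"
    using Wolff_family[OF s1 s2 z1 z2 z3 z4] by blast
  have tt: "\<tau> * cnj \<tau> = 1" "cnj \<tau> * \<tau> = 1"
    using tau complex_norm_square[of \<tau>] by (auto simp: mult.commute)
  have ntau: "norm (cnj \<tau> * z) = norm z" "norm (\<tau> * z) = norm z" for z using tau by (auto simp: norm_mult)
  define h where "h w = \<i> * (1 + cnj \<tau> * A w) / (1 - cnj \<tau> * A w)" for w
  define f where "f z = B (\<tau> * ((z - \<i>) / (z + \<i>)))" for z
  have A1: "norm (cnj \<tau> * A w) < 1" if "w \<in> epigraph \<gamma>" for w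
    using AB(3)[OF that] by (simp add: ntau)
  have hne: "1 - cnj \<tau> * A w \<noteq> 0" if "w \<in> epigraph \<gamma>" for w
    using A1[OF that] by auto
  have holh: "h holomorphic_on epigraph \<gamma>"
    unfolding h_def by (intro holomorphic_intros AB(1) hne)
  have f1: "norm (\<tau> * ((z - \<i>) / (z + \<i>))) < 1" if "0 < Im z" for z
    unfolding ntau(2) by (rule cayley_bij(1)[OF that])
  have holf: "f holomorphic_on uhp"
    unfolding f_def
  proof (rule holomorphic_on_compose_gen[of "\<lambda>z. \<tau> * ((z - \<i>) / (z + \<i>))" uhp B "ball 0 1", unfolded o_def])
    show "(\<lambda>z. \<tau> * ((z - \<i>) / (z + \<i>))) holomorphic_on uhp"
      by (intro holomorphic_intros) (auto simp: complex_eq_iff)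
  qed (use AB f1 in auto)
  have hf: "h (f z) = z" if "0 < Im z" for z
  proof -
    have "A (f z) = \<tau> * ((z - \<i>) / (z + \<i>))" using AB(4) f1[OF that] by (simp add: f_def)
    then have "cnj \<tau> * A (f z) = (z - \<i>) / (z + \<i>)" using tt by (simp flip: mult.assoc)
    then show ?thesis using cayley_bij(2)[OF that] by (simp add: h_def)
  qed
  have fh: "f (h w) = w" if "w \<in> epigraph \<gamma>" for w
  proof -
    have "(h w - \<i>) / (h w + \<i>) = cnj \<tau> * A w"
      unfolding h_def by (rule cayley_bij(3)[OF A1[OF that]])
    then have "\<tau> * ((h w - \<i>) / (h w + \<i>)) = A w" using tt by (simp flip: mult.assoc)
    then show ?thesis using AB(3)[OF that] by (simp add: f_def)
  qed
  have hu: "0 < Im (h w)" if "w \<in> epigraph \<gamma>" for w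
    unfolding h_def by (rule cayley_bij(4)[OF A1[OF that]])
  have fe: "f z \<in> epigraph \<gamma>" if "0 < Im z" for z
    using AB(4) f1[OF that] by (simp add: f_def)
  have imf: "f ` uhp = epigraph \<gamma>"
  proof (intro set_eqI iffI)
    fix w assume w: "w \<in> epigraph \<gamma>"
    show "w \<in> f ` uhp" by (rule image_eqI[of _ _ "h w"]) (use fh[OF w] hu[OF w] in auto)
  qed (use fe in auto)
  have injf: "inj_on f uhp" by (rule inj_on_inverseI[of _ h]) (simp add: hf)
  have cross: "x / a \<le> y / b" if "x * b \<le> y * a" "0 < a" "0 < b" for x y a b :: real
    using that by (simp add: field_simps)
  have mono: "Im (h w) \<le> Im (h (w + \<i> * of_real t))" if w: "w \<in> epigraph \<gamma>" and t: "0 \<le> t" for w t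
  proof -
    have w': "w + \<i> * of_real t \<in> epigraph \<gamma>" using up[OF w t] .
    have "\<sigma> t (A w) = A (w + \<i> * of_real t)" using AB(3)[OF w] by (simp add: \<sigma>_def)
    then have "(1 - (norm (A w))\<^sup>2) * (norm (1 - cnj \<tau> * A (w + \<i> * of_real t)))\<^sup>2
       \<le> (1 - (norm (A (w + \<i> * of_real t)))\<^sup>2) * (norm (1 - cnj \<tau> * A w))\<^sup>2"
      using horo[OF t, of "A w"] AB(3)[OF w] by simp
    then have "(1 - (norm (A w))\<^sup>2) / (norm (1 - cnj \<tau> * A w))\<^sup>2 \<le>
       (1 - (norm (A (w + \<i> * of_real t)))\<^sup>2) / (norm (1 - cnj \<tau> * A (w + \<i> * of_real t)))\<^sup>2"
      by (rule cross) (use hne[OF w] hne[OF w'] in auto)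
    then show ?thesis
      unfolding h_def cayley_inv_Im[OF A1[OF w]] cayley_inv_Im[OF A1[OF w']] ntau .
  qed
  \<comment> \<open>Since \<open>h\<close> is holomorphic, the upward derivative of
    \<open>Im h\<close> is \<open>Re h'\<close>.\<close>
  have dh: "0 \<le> Re (deriv h w)" if w: "w \<in> epigraph \<gamma>" for w
  proof -
    have "(h has_field_derivative deriv h w) (at w)" using holomorphic_derivI[OF holh op w] .
    then have 1: "(h has_field_derivative deriv h w) (at (w + \<i> * of_real 0))" by simp
    have "((\<lambda>t. w + \<i> * of_real t) has_vector_derivative \<i>) (at 0)"
      unfolding has_vector_derivative_def scaleR_conv_of_real by (auto intro!: derivative_eq_intros)
    from field_vector_diff_chain_at[OF this 1]
    have "((\<lambda>t. h (w + \<i> * of_real t)) has_vector_derivative (\<i> * deriv h w)) (at 0)"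
      by (simp add: o_def)
    then have "((\<lambda>t. Im (h (w + \<i> * of_real t))) has_vector_derivative Im (\<i> * deriv h w)) (at 0)"
      by (rule bounded_linear.has_vector_derivative[OF bounded_linear_Im])
    then have d: "((\<lambda>t. Im (h (w + \<i> * of_real t))) has_real_derivative Re (deriv h w)) (at 0)"
      by (simp add: has_real_derivative_iff_has_vector_derivative)
    show ?thesis
    proof (rule ccontr)
      assume "\<not> 0 \<le> Re (deriv h w)"
      then have "Re (deriv h w) < 0" by simp
      from DERIV_neg_dec_right[OF d this]
      obtain d where d0: "d > 0" "\<And>t. 0 < t \<Longrightarrow> t < d \<Longrightarrow> Im (h (w + \<i> * of_real (0 + t))) < Im (h (w + \<i> * of_real 0))"
        by blast
      from d0(2)[of "d/2"] mono[OF w, of "d/2"] d0(1) show False by simp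
    qed
  qed
  have df: "deriv f z * deriv h (f z) = 1" if z: "0 < Im z" for z
  proof -
    have "(h has_field_derivative deriv h (f z)) (at (f z))"
      using holomorphic_derivI[OF holh op fe[OF z]] .
    moreover have "(f has_field_derivative deriv f z) (at z)"
      using holomorphic_derivI[OF holf open_uhp] z by simp
    ultimately have "((\<lambda>z. h (f z)) has_field_derivative deriv h (f z) * deriv f z) (at z)"
      by (rule DERIV_chain2)
    then have "((\<lambda>z. z) has_field_derivative deriv h (f z) * deriv f z) (at z)"
      by (rule has_field_derivative_transform_within_open[OF _ open_uhp]) (simp_all add: z hf)
    then have "deriv h (f z) * deriv f z = 1" by (rule DERIV_unique[OF _ DERIV_ident])
    then show ?thesis by (simp add: mult.commute)
  qed
  have ge: "0 \<le> Re (deriv f z)" if z: "0 < Im z" for z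
  proof -
    have "deriv f z = 1 / deriv h (f z)" using df[OF z]
      by (cases "deriv h (f z) = 0") (auto simp: eq_divide_eq)
    moreover have "Re (1 / deriv h (f z)) = Re (deriv h (f z)) / (norm (deriv h (f z)))\<^sup>2"
      by (simp add: Re_divide cmod_power2)
    ultimately show ?thesis using dh[OF fe[OF z]] by simp
  qed
  \<comment> \<open>A zero of \<open>Re f'\<close> makes \<open>f'\<close> constant by the open
    mapping theorem, with purely imaginary value. Then the image of \<open>f\<close> is a half-plane
    bounded by a vertical line, whereas the epigraph projects onto the whole real line.\<close>
  have "0 < Re (deriv f z)" if z: "z \<in> uhp" for z
  proof (rule ccontr)
    assume "\<not> 0 < Re (deriv f z)"
    then have Re0: "Re (deriv f z) = 0" using ge[of z] z by simp
    have hold: "deriv f holomorphic_on uhp" using holomorphic_deriv[OF holf open_uhp] .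
    have "deriv f constant_on uhp"
    proof (rule ccontr)
      assume "\<not> deriv f constant_on uhp"
      then have "open (deriv f ` uhp)"
        using open_mapping_thm[OF hold open_uhp convex_connected[OF convex_uhp] open_uhp] by blast
      then obtain e where e: "e > 0" "ball (deriv f z) e \<subseteq> deriv f ` uhp" using z openE by blast
      have "deriv f z - of_real (e/2) \<in> ball (deriv f z) e" using e(1) by (simp add: dist_norm)
      then obtain y where "y \<in> uhp" "deriv f z - of_real (e/2) = deriv f y" using e(2) by blast
      then have "Re (deriv f y) = - (e/2)" using Re0 by (metis Re_complex_of_real minus_complex.simps(1) diff_0)
      then show False using ge[of y] \<open>y \<in> uhp\<close> e(1) by simp
    qed
    then obtain k where k: "\<And>y. y \<in> uhp \<Longrightarrow> deriv f y = k" by (auto simp: constant_on_def)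
    have "\<exists>b. \<forall>y\<in>uhp. f y = k * y + b"
    proof -
      have "\<exists>b. \<forall>y\<in>uhp. f y - k * y = b"
      proof (rule has_field_derivative_zero_constant[OF convex_uhp])
        fix y assume y: "y \<in> uhp"
        have "(f has_field_derivative k) (at y)" using holomorphic_derivI[OF holf open_uhp y] k[OF y] by simp
        then show "((\<lambda>y. f y - k * y) has_field_derivative 0) (at y within uhp)"
          by (auto intro!: derivative_eq_intros intro: has_field_derivative_at_within)
      qed
      then obtain b where "\<And>y. y \<in> uhp \<Longrightarrow> f y - k * y = b" by blast
      then have "\<forall>y\<in>uhp. f y = k * y + b" by (simp add: algebra_simps)
      then show ?thesis by blast
    qed
    then obtain b where b: "\<And>y. y \<in> uhp \<Longrightarrow> f y = k * y + b" by blast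
    have Rk: "Re k = 0" using Re0 k[OF z] by simp
    \<comment> \<open>A point over this \<open>x\<close> would need a preimage with imaginary part
      -1.\<close>
    define x where "x = Re b + Im k"
    have "\<gamma> x + \<i> \<in> epigraph \<gamma>" by (simp add: epigraph_def R)
    then obtain y where y: "y \<in> uhp" "f y = \<gamma> x + \<i>" unfolding imf[symmetric] by (elim imageE) (rule that, simp_all)
    have "Re (\<gamma> x + \<i>) = x" using R[of x] by simp
    then have "Re (k * y + b) = x" using b[OF y(1)] y(2) by metis
    then have "x = - Im k * Im y + Re b" using Rk by simp
    then have 1: "Im k * (1 + Im y) = 0" by (simp add: x_def algebra_simps)
    have "Im k \<noteq> 0"
    proof
      assume "Im k = 0"
      then have "k = 0" using Rk by (simp add: complex_eq_iff)
      then show False using df[of z] z k[OF z] by simp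
    qed
    then show False using 1 y(1) by simp
  qed
  then have "graph_map \<gamma> f" using holf injf imf unfolding graph_map_def by blast
  then show thesis using that by blast
qed

section \<open>Compactness\<close>

text \<open>The Cayley transform centred at \<open>p z0\<close> reduces this to the Schwarz lemma.
  The bound is in terms of \<open>Re (p z0)\<close> and not of the modulus; this is what later keeps
  the errors proportional to \<open>Re f'\<close>.\<close>

lemma Re_pos_Schwarz:
  fixes p :: "complex \<Rightarrow> complex"
  assumes hol: "p holomorphic_on ball z0 r" and pos: "\<And>z. z \<in> ball z0 r \<Longrightarrow> 0 < Re (p z)"
    and r: "0 < r" and z: "norm (z - z0) \<le> \<rho> * r" and rho: "0 \<le> \<rho>" "\<rho> < 1"
  shows "norm (p z - p z0) \<le> 2 * Re (p z0) * (\<rho> / (1 - \<rho>))"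
proof -
  define a where "a = p z0"
  have a: "0 < Re a" using pos[of z0] r by (simp add: a_def)
  define g where "g \<zeta> = (p (z0 + r * \<zeta>) - a) / (p (z0 + r * \<zeta>) + cnj a)" for \<zeta> :: complex
  have inb: "z0 + r * \<zeta> \<in> ball z0 r" if "norm \<zeta> < 1" for \<zeta> :: complex
    using that r by (simp add: dist_norm norm_mult)
  have ne: "p (z0 + r * \<zeta>) + cnj a \<noteq> 0" if "norm \<zeta> < 1" for \<zeta> :: complex
  proof
    assume "p (z0 + r * \<zeta>) + cnj a = 0"
    then have "Re (p (z0 + r * \<zeta>) + cnj a) = 0" by simp
    then show False using pos[OF inb[OF that]] a by simp
  qed
  have comp: "(\<lambda>\<zeta>. p (z0 + r * \<zeta>)) holomorphic_on ball 0 1"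
    by (rule holomorphic_on_compose_gen[OF _ hol, unfolded o_def])
      (use inb in \<open>auto intro!: holomorphic_intros simp del: mem_ball\<close>)
  have holg: "g holomorphic_on ball 0 1"
    unfolding g_def by (intro holomorphic_intros comp) (use ne in auto)
  have lt: "norm (g \<zeta>) < 1" if "norm \<zeta> < 1" for \<zeta> :: complex
  proof -
    define w where "w = p (z0 + r * \<zeta>)"
    have "0 < Re w" using pos[OF inb[OF that]] by (simp add: w_def)
    then have "(norm (w - a))\<^sup>2 < (norm (w + cnj a))\<^sup>2"
      using a mult_pos_pos[of "Re w" "Re a"] unfolding cmod_power2 by (simp add: power2_eq_square algebra_simps)
    then have "norm (w - a) < norm (w + cnj a)" by (rule power2_less_imp_less) simp
    then show ?thesis by (simp add: g_def w_def norm_divide divide_less_eq)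
  qed
  define \<xi> where "\<xi> = (z - z0) / r"
  have nxi: "norm \<xi> \<le> \<rho>" using z r by (simp add: \<xi>_def norm_divide divide_le_eq)
  then have xi1: "norm \<xi> < 1" using rho by simp
  have zx: "z0 + r * \<xi> = z" using r by (simp add: \<xi>_def)
  have "norm (g \<xi>) \<le> norm \<xi>"
    by (rule Schwarz_Lemma(1)[OF holg _ lt xi1]) (simp_all add: g_def a_def)
  then have gr: "norm (g \<xi>) \<le> \<rho>" using nxi by simp
  have "g \<xi> * (p z + cnj a) = p z - a" using ne[OF xi1] by (simp add: g_def zx)
  then have "(p z - a) * (1 - g \<xi>) = g \<xi> * (a + cnj a)" by (simp add: algebra_simps)
  then have "norm (p z - a) * norm (1 - g \<xi>) = norm (g \<xi>) * (2 * Re a)"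
    unfolding complex_add_cnj norm_mult[symmetric] using a by (simp add: norm_mult)
  moreover have "1 - \<rho> \<le> norm (1 - g \<xi>)"
    using norm_triangle_ineq2[of 1 "g \<xi>"] gr by simp
  ultimately have "norm (p z - a) * (1 - \<rho>) \<le> \<rho> * (2 * Re a)"
    using mult_left_mono[of "1-\<rho>" "norm (1 - g \<xi>)" "norm (p z - a)", OF _ norm_ge_zero]
      mult_right_mono[OF gr, of "2 * Re a"] a by linarith
  then have "norm (p z - a) \<le> \<rho> * (2 * Re a) / (1 - \<rho>)" using rho by (simp add: pos_le_divide_eq)
  then show ?thesis by (simp add: a_def mult_ac)
qed

text \<open>Harnack's inequality; the second half is the first applied to \<open>1 / p\<close>,
  whose real part is positive as well.\<close>

lemma Re_pos_bound:
  fixes p :: "complex \<Rightarrow> complex"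
  assumes "p holomorphic_on ball z0 r" "\<And>z. z \<in> ball z0 r \<Longrightarrow> 0 < Re (p z)"
    and "0 < r" "norm (z - z0) \<le> \<rho> * r" and rho: "0 \<le> \<rho>" "\<rho> < 1"
  shows "norm (p z) \<le> norm (p z0) * ((1 + \<rho>) / (1 - \<rho>))"
    "norm (p z0) \<le> norm (p z) * ((1 + \<rho>) / (1 - \<rho>))"
proof -
  have key: "norm (q z) \<le> norm (q z0) * ((1 + \<rho>) / (1 - \<rho>))"
    if "q holomorphic_on ball z0 r" "\<And>z. z \<in> ball z0 r \<Longrightarrow> 0 < Re (q z)" for q :: "complex \<Rightarrow> complex"
  proof -
    have "norm (q z - q z0) \<le> 2 * Re (q z0) * (\<rho> / (1 - \<rho>))"
      by (rule Re_pos_Schwarz[OF that assms(3,4) rho])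
    also have "\<dots> \<le> 2 * norm (q z0) * (\<rho> / (1 - \<rho>))"
      using rho complex_Re_le_cmod[of "q z0"] by (intro mult_right_mono) auto
    finally have "norm (q z) \<le> norm (q z0) + 2 * norm (q z0) * (\<rho> / (1 - \<rho>))"
      using norm_triangle_sub[of "q z" "q z0"] by linarith
    also have "\<dots> = norm (q z0) * ((1 + \<rho>) / (1 - \<rho>))"
    proof -
      have "1 + 2 * (\<rho> / (1 - \<rho>)) = (1 + \<rho>) / (1 - \<rho>)" using rho by (simp add: divide_simps)
      moreover have "norm (q z0) + 2 * norm (q z0) * (\<rho> / (1 - \<rho>)) = norm (q z0) * (1 + 2 * (\<rho> / (1 - \<rho>)))"
        by (simp add: distrib_left)
      ultimately show ?thesis by simp
    qed
    finally show ?thesis .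
  qed
  show "norm (p z) \<le> norm (p z0) * ((1 + \<rho>) / (1 - \<rho>))" by (rule key[OF assms(1,2)])
  have pn: "p w \<noteq> 0" if "w \<in> ball z0 r" for w using assms(2)[OF that] by auto
  have "\<rho> * r < r" using rho assms(3) by simp
  then have "norm (z - z0) < r" using assms(4) by linarith
  then have zb: "z \<in> ball z0 r" "z0 \<in> ball z0 r" using assms(3) by (auto simp: dist_norm norm_minus_commute)
  have cross: "y \<le> x * c" if "0 < x" "0 < y" "1 / x \<le> 1 / y * c" for x y c :: real
    using that by (simp add: field_simps)
  have "norm (1 / p z) \<le> norm (1 / p z0) * ((1 + \<rho>) / (1 - \<rho>))"
  proof (rule key)
    show "(\<lambda>z. 1 / p z) holomorphic_on ball z0 r" using pn by (intro holomorphic_intros assms(1)) auto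
    show "0 < Re (1 / p w)" if w: "w \<in> ball z0 r" for w
    proof -
      have "Re (1 / p w) = Re (p w) / (norm (p w))\<^sup>2" by (simp add: Re_divide cmod_power2)
      moreover have "0 < (norm (p w))\<^sup>2" using pn[OF w] by simp
      ultimately show ?thesis using assms(2)[OF w] by simp
    qed
  qed
  then have "1 / norm (p z) \<le> 1 / norm (p z0) * ((1 + \<rho>) / (1 - \<rho>))" unfolding norm_divide norm_one .
  then show "norm (p z0) \<le> norm (p z) * ((1 + \<rho>) / (1 - \<rho>))"
    using pn[OF zb(1)] pn[OF zb(2)] by (intro cross[of "norm (p z)" "norm (p z0)"]) auto
qed

text \<open>Large discs tangent to the real line at 0 exhaust the half-plane, and concentric smaller
  discs give the fixed ratio that Harnack's inequality wants.\<close>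

lemma compact_in_uhp_ball:
  assumes K: "compact K" "K \<subseteq> uhp"
  obtains N r where "0 < N" "0 < r" "r < N" "K \<subseteq> cball (\<i> * of_real N) r" "\<i> \<in> cball (\<i> * of_real N) r"
    "ball (\<i> * of_real N) N \<subseteq> uhp"
proof -
  define K' where "K' = insert \<i> K"
  have cK: "compact K'" "K' \<subseteq> uhp" "K' \<noteq> {}" using K by (auto simp: K'_def compact_insert)
  obtain B where B: "B > 0" "\<And>z. z \<in> K' \<Longrightarrow> norm z \<le> B" using compact_imp_bounded[OF cK(1)] bounded_pos by metis
  obtain w where w: "w \<in> K'" "\<And>z. z \<in> K' \<Longrightarrow> Im w \<le> Im z"
    using continuous_attains_inf[OF cK(1,3) continuous_on_Im[OF continuous_on_id]] by auto
  define m where "m = Im w"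
  have m: "0 < m" using w(1) cK(2) by (auto simp: m_def)
  have mB: "m \<le> B" using B(2)[OF w(1)] abs_Im_le_cmod[of w] by (simp add: m_def)
  \<comment> \<open>With \<open>N * m = 2 * B^2\<close> the term \<open>2 * N * Im z\<close> in the
    squared distance to the centre exceeds \<open>(norm z)\<^sup>2\<close> by at least
    \<open>B^2\<close>.\<close>
  define N where "N = (B^2 + B^2) / m"
  have N: "0 < N" using m B by (simp add: N_def)
  have Nm: "N * m = 2 * B^2" using m by (simp add: N_def)
  have BN: "B < N"
  proof -
    have "B * m \<le> B * B" using mB B(1) by simp
    also have "\<dots> < 2 * B^2" using B(1) by (simp add: power2_eq_square)
    finally have "B * m < N * m" using Nm by simp
    then show ?thesis using m by simp
  qed
  define r where "r = sqrt (N^2 - B^2)"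
  have N2: "B^2 < N^2" using BN B(1) by (intro power_strict_mono) auto
  have r: "0 < r" "r < N"
    using N2 N B(1) by (auto simp: r_def intro!: real_less_lsqrt)
  have sub: "z \<in> cball (\<i> * of_real N) r" if z: "z \<in> K'" for z
  proof -
    have "(norm (z - \<i> * of_real N))\<^sup>2 = (norm z)\<^sup>2 - 2 * (N * Im z) + N^2"
      unfolding cmod_power2 by (simp add: power2_eq_square algebra_simps)
    also have "\<dots> \<le> B^2 - 2 * (N * m) + N^2"
    proof -
      have "(norm z)\<^sup>2 \<le> B^2" using B(2)[OF z] by (intro power_mono) auto
      moreover have "N * m \<le> N * Im z" using w(2)[OF z] N by (simp add: m_def)
      ultimately show ?thesis by linarith
    qed
    also have "\<dots> \<le> N^2 - B^2" using Nm by simp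
    finally have "norm (z - \<i> * of_real N) \<le> r" unfolding r_def by (rule real_le_rsqrt)
    then show ?thesis by (simp add: dist_norm norm_minus_commute)
  qed
  have "ball (\<i> * of_real N) N \<subseteq> uhp"
  proof
    fix z assume "z \<in> ball (\<i> * of_real N) N"
    then have "norm (\<i> * of_real N - z) < N" by (simp add: dist_norm)
    then have "\<bar>Im (\<i> * of_real N - z)\<bar> < N" using abs_Im_le_cmod[of "\<i> * of_real N - z"] by linarith
    then show "z \<in> uhp" by simp
  qed
  moreover have "K \<subseteq> cball (\<i> * of_real N) r" "\<i> \<in> cball (\<i> * of_real N) r" using sub by (auto simp: K'_def simp del: mem_cball)
  ultimately show thesis using that[of N r] N r by blast
qed

text \<open>Harnack twice, from \<open>z\<close> to the centre of the large disc and from there to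
  \<open>\<i>\<close>; the constant depends on \<open>K\<close> only.\<close>

lemma Re_pos_uhp_bound:
  assumes K: "compact K" "K \<subseteq> uhp"
  obtains C where "0 < C"
    "\<And>p z. p holomorphic_on uhp \<Longrightarrow> (\<And>z. z \<in> uhp \<Longrightarrow> 0 < Re (p z)) \<Longrightarrow> z \<in> K \<Longrightarrow> norm (p z) \<le> C * norm (p \<i>)"
proof -
  obtain N r where N: "0 < N" "0 < r" "r < N" "K \<subseteq> cball (\<i> * of_real N) r" "\<i> \<in> cball (\<i> * of_real N) r"
    "ball (\<i> * of_real N) N \<subseteq> uhp" using compact_in_uhp_ball[OF K] by blast
  define \<rho> where "\<rho> = r / N"
  have rho: "0 \<le> \<rho>" "\<rho> < 1" "\<rho> * N = r" using N by (auto simp: \<rho>_def)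
  define c where "c = (1 + \<rho>) / (1 - \<rho>)"
  have c: "0 < c" using rho by (simp add: c_def)
  have "norm (p z) \<le> (c * c) * norm (p \<i>)"
    if p: "p holomorphic_on uhp" "\<And>z. z \<in> uhp \<Longrightarrow> 0 < Re (p z)" and z: "z \<in> K" for p z
  proof -
    have h: "p holomorphic_on ball (\<i> * of_real N) N" using holomorphic_on_subset[OF p(1) N(6)] .
    have ps: "\<And>z. z \<in> ball (\<i> * of_real N) N \<Longrightarrow> 0 < Re (p z)" using p(2) N(6) by blast
    have "norm (z - \<i> * of_real N) \<le> \<rho> * N" using z N(4) unfolding rho(3) by (auto simp: dist_norm norm_minus_commute)
    from Re_pos_bound(1)[OF h ps N(1) this rho(1,2)]
    have 1: "norm (p z) \<le> norm (p (\<i> * of_real N)) * c" by (simp add: c_def)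
    have "norm (\<i> - \<i> * of_real N) \<le> \<rho> * N" using N(5) unfolding rho(3) by (auto simp: dist_norm norm_minus_commute)
    from Re_pos_bound(2)[OF h ps N(1) this rho(1,2)]
    have 2: "norm (p (\<i> * of_real N)) \<le> norm (p \<i>) * c" by (simp add: c_def)
    have "norm (p (\<i> * of_real N)) * c \<le> norm (p \<i>) * c * c" using 2 c by (intro mult_right_mono) auto
    then show ?thesis using 1 by (simp add: mult_ac)
  qed
  then show thesis using that[of "c * c"] c by auto
qed

section \<open>Rigidity of conformal maps onto half-planes\<close>

lemma uhp_automorphism_fixing_i:
  assumes hol: "N holomorphic_on uhp" and inj: "inj_on N uhp" and im: "N ` uhp = uhp" and fix_i: "N \<i> = \<i>"
  obtains \<mu> where "norm \<mu> = 1" "\<And>z. z \<in> uhp \<Longrightarrow> (N z - \<i>) / (N z + \<i>) = \<mu> * ((z - \<i>) / (z + \<i>))"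
proof -
  define C where "C z = (z - \<i>) / (z + \<i>)" for z :: complex
  define D where "D w = \<i> * (1 + w) / (1 - w)" for w :: complex
  have C1: "norm (C z) < 1" "D (C z) = z" if "z \<in> uhp" for z
    using cayley_bij(1,2)[of z] that by (auto simp: C_def D_def)
  have D1: "D w \<in> uhp" "C (D w) = w" if "norm w < 1" for w
    using cayley_bij(3,4)[OF that] by (auto simp: C_def D_def)
  have holC: "C holomorphic_on uhp" unfolding C_def by (intro holomorphic_intros) (auto simp: complex_eq_iff)
  have holD: "D holomorphic_on ball 0 1" unfolding D_def by (intro holomorphic_intros) auto
  have conj: "(\<lambda>w. C (g (D w))) holomorphic_on ball 0 1" if "g holomorphic_on uhp" "g ` uhp \<subseteq> uhp" for g
  proof -
    have "(\<lambda>w. g (D w)) holomorphic_on ball 0 1"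
      by (rule holomorphic_on_compose_gen[OF holD that(1), unfolded o_def]) (use D1 in auto)
    then show ?thesis
    proof (rule holomorphic_on_compose_gen[OF _ holC, unfolded o_def])
      show "(\<lambda>w. g (D w)) ` ball 0 1 \<subseteq> uhp" using D1(1) that(2) by (force simp: image_subset_iff)
    qed
  qed
  have S: "norm (C (g (D w))) \<le> norm w" if g: "g holomorphic_on uhp" "g ` uhp \<subseteq> uhp" "g \<i> = \<i>" and w: "norm w < 1" for g w
  proof (rule Schwarz_Lemma(1)[OF conj[OF g(1,2)] _ _ w])
    show "C (g (D 0)) = 0" using g(3) by (simp add: C_def D_def)
    show "norm (C (g (D z))) < 1" if "norm z < 1" for z using C1(1) D1(1)[OF that] g(2) by blast
  qed
  obtain h where h: "h holomorphic_on N ` uhp" "\<And>z. z \<in> uhp \<Longrightarrow> h (N z) = z"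
    by (rule holomorphic_has_inverse[OF hol open_uhp inj]) (rule that)
  have hu: "h ` uhp \<subseteq> uhp" "h \<i> = \<i>" "h holomorphic_on uhp"
  proof -
    show "h holomorphic_on uhp" using h(1) unfolding im .
    show "h \<i> = \<i>" using h(2)[of \<i>] fix_i by simp
    show "h ` uhp \<subseteq> uhp"
    proof (rule image_subsetI)
      fix w assume "w \<in> uhp"
      then have "w \<in> N ` uhp" unfolding im .
      then obtain z where "z \<in> uhp" "w = N z" by (elim imageE)
      then show "h w \<in> uhp" using h(2) by simp
    qed
  qed
  define k where "k w = C (N (D w))" for w
  have kk: "k w = C (N (D w))" "C (h (D (k w))) = w" if w: "norm w < 1" for w
  proof -
    have "N (D w) \<in> N ` uhp" using D1(1)[OF w] by (rule imageI)
    then have "N (D w) \<in> uhp" unfolding im .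
    then show "C (h (D (k w))) = w" using C1(2) h(2) D1[OF w] by (simp add: k_def)
  qed (simp add: k_def)
  have k1: "norm (k w) < 1" if "norm w < 1" for w
    unfolding k_def using imageI[OF D1(1)[OF that], of N] unfolding im by (rule C1(1))
  \<comment> \<open>The Schwarz lemma is applied to the map and to its inverse; equality of norms
    leaves only a rotation.\<close>
  have keq: "norm (k w) = norm w" if w: "norm w < 1" for w
  proof (rule antisym)
    show "norm (k w) \<le> norm w" unfolding k_def using S[OF hol _ fix_i w] im by simp
    show "norm w \<le> norm (k w)" using S[OF hu(3,1,2) k1[OF w]] kk(2)[OF w] by simp
  qed
  have "\<exists>\<alpha>. (\<forall>z. norm z < 1 \<longrightarrow> k z = \<alpha> * z) \<and> norm \<alpha> = 1"
  proof (rule Schwarz_Lemma(3)[of k 0])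
    show "k holomorphic_on ball 0 1" unfolding k_def using conj[OF hol] im by simp
    show "k 0 = 0" using fix_i by (simp add: k_def C_def D_def)
    show "(\<exists>z. norm z < 1 \<and> z \<noteq> 0 \<and> norm (k z) = norm z) \<or> norm (deriv k 0) = 1"
      by (intro disjI1 exI[of _ "1/2"]) (use keq[of "1/2"] in auto)
  qed (use k1 in auto)
  then obtain \<mu> where l: "norm \<mu> = 1" "\<And>z. norm z < 1 \<Longrightarrow> k z = \<mu> * z" by blast
  have "C (N z) = \<mu> * C z" if z: "z \<in> uhp" for z
    using l(2)[OF C1(1)[OF z]] C1(2)[OF z] by (simp add: k_def)
  then show thesis using that l(1) by (auto simp: C_def)
qed

text \<open>Up to an affine normalisation of the target the map is a Moebius automorphism, so its
  derivative is either constant or of the form \<open>c * (e / w\<^sup>2)\<close> about a real pole.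
  In the second case \<open>w\<^sup>2\<close> takes every argument strictly between 0 and 2 pi, so
  the derivative cannot stay in the right half-plane.\<close>

lemma half_plane_map_affine:
  assumes hol: "f holomorphic_on uhp" and inj: "inj_on f uhp" and e: "norm e = 1"
    and im: "f ` uhp = {w. 0 < Im ((w - p) * cnj e)}"
    and pos: "\<And>z. z \<in> uhp \<Longrightarrow> 0 \<le> Re (deriv f z)"
  obtains k where "\<And>z. z \<in> uhp \<Longrightarrow> deriv f z = k"
proof -
  have ee: "e * cnj e = 1" "cnj e * e = 1" using e complex_norm_square[of e] by (auto simp: mult.commute)
  define M where "M z = (f z - p) * cnj e" for z
  define \<alpha> where "\<alpha> = Im (M \<i>)"
  define \<beta> where "\<beta> = Re (M \<i>)"
  have fp: "0 < Im ((f z - p) * cnj e)" if "z \<in> uhp" for z using imageI[OF that, of f] unfolding im by blast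
  have a: "0 < \<alpha>" using fp[of \<i>] by (simp add: \<alpha>_def M_def)
  define N where "N z = (M z - \<beta>) / \<alpha>" for z
  have fN: "f z = e * (\<alpha> * N z + \<beta>) + p" for z
  proof -
    have "e * (\<alpha> * N z + \<beta>) + p = (e * cnj e) * (f z - p) + p"
      using a by (simp add: N_def M_def mult_ac)
    then show ?thesis using ee by simp
  qed
  have holN: "N holomorphic_on uhp" unfolding N_def M_def by (intro holomorphic_intros hol) (use a in auto)
  have injN: "inj_on N uhp" using inj a unfolding inj_on_def fN by simp
  have Nu: "N z \<in> uhp" if "z \<in> uhp" for z
    using fp[OF that] a by (simp add: N_def M_def)
  have imN: "N ` uhp = uhp"
  proof (intro set_eqI iffI)
    fix w assume w: "w \<in> uhp"
    have "((e * (\<alpha> * w + \<beta>) + p) - p) * cnj e = (e * cnj e) * (\<alpha> * w + \<beta>)" by (simp add: mult_ac)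
    also have "\<dots> = \<alpha> * w + \<beta>" by (simp only: ee mult_1)
    finally have e1: "((e * (\<alpha> * w + \<beta>) + p) - p) * cnj e = \<alpha> * w + \<beta>" .
    have "0 < Im (((e * (\<alpha> * w + \<beta>) + p) - p) * cnj e)" unfolding e1 using w a by simp
    then have "e * (\<alpha> * w + \<beta>) + p \<in> f ` uhp" unfolding im by (rule CollectI)
    then obtain z where z: "z \<in> uhp" "e * (\<alpha> * w + \<beta>) + p = f z" by (elim imageE)
    have "w = N z"
    proof -
      have "e * (\<alpha> * w + \<beta>) = e * (\<alpha> * N z + \<beta>)" using z(2) fN[of z] by simp
      moreover have "e \<noteq> 0" using e by auto
      ultimately show ?thesis using a by simp
    qed
    then show "w \<in> N ` uhp" using z(1) by blast
  qed (use Nu in auto)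
  have Ni: "N \<i> = \<i>" using a by (simp add: N_def \<alpha>_def \<beta>_def complex_eq_iff)
  obtain \<mu> where mu: "norm \<mu> = 1" "\<And>z. z \<in> uhp \<Longrightarrow> (N z - \<i>) / (N z + \<i>) = \<mu> * ((z - \<i>) / (z + \<i>))"
    using uhp_automorphism_fixing_i[OF holN injN imN Ni] by blast
  have mm: "\<mu> * cnj \<mu> = 1" using mu(1) complex_norm_square[of \<mu>] by (simp add: mult.commute)
  define D where "D z = (z + \<i>) - \<mu> * (z - \<i>)" for z
  have up: "z + \<i> \<noteq> 0" if "z \<in> uhp" for z using that by (auto simp: complex_eq_iff)
  have eq: "N z * D z = \<i> * ((z + \<i>) + \<mu> * (z - \<i>))" if z: "z \<in> uhp" for z
  proof -
    have "(N z - \<i>) * (z + \<i>) = \<mu> * (z - \<i>) * (N z + \<i>)"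
      using mu(2)[OF z] up[OF z] up[OF Nu[OF z]] by (simp add: frac_eq_eq)
    then show ?thesis by (simp add: D_def algebra_simps)
  qed
  have D0: "D z \<noteq> 0" if z: "z \<in> uhp" for z
  proof
    assume d: "D z = 0"
    then have "(z + \<i>) + \<mu> * (z - \<i>) = 0" using eq[OF z] by simp
    then have "(z + \<i>) + (z + \<i>) = 0" using d by (simp add: D_def)
    then have "2 * (z + \<i>) = 0" by simp
    then show False using up[OF z] by (simp only: mult_eq_0_iff) simp
  qed
  have df: "deriv f z = e * \<alpha> * (- 4 * \<mu> / (D z)\<^sup>2)" if z: "z \<in> uhp" for z
  proof -
    have dD: "(D has_field_derivative 1 - \<mu>) (at z)" unfolding D_def by (auto intro!: derivative_eq_intros)
    have "((\<lambda>z. \<i> * ((z + \<i>) + \<mu> * (z - \<i>)) / D z) has_field_derivative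
        ((\<i> * (1 + \<mu>)) * D z - \<i> * ((z + \<i>) + \<mu> * (z - \<i>)) * (1 - \<mu>)) / (D z * D z)) (at z)"
      by (rule DERIV_divide[OF _ dD D0[OF z]]) (auto intro!: derivative_eq_intros)
    moreover have "(\<i> * (1 + \<mu>)) * D z - \<i> * ((z + \<i>) + \<mu> * (z - \<i>)) * (1 - \<mu>) = - 4 * \<mu>"
      by (simp add: D_def algebra_simps)
    ultimately have "((\<lambda>z. \<i> * ((z + \<i>) + \<mu> * (z - \<i>)) / D z) has_field_derivative - 4 * \<mu> / (D z)\<^sup>2) (at z)"
      by (simp add: power2_eq_square)
    then have "(N has_field_derivative - 4 * \<mu> / (D z)\<^sup>2) (at z)"
      by (rule has_field_derivative_transform_within_open[OF _ open_uhp z])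
         (use eq D0 in \<open>auto simp: divide_eq_eq\<close>)
    then have "((\<lambda>z. e * (\<alpha> * N z + \<beta>) + p) has_field_derivative e * (\<alpha> * (- 4 * \<mu> / (D z)\<^sup>2))) (at z)"
      by (auto intro!: derivative_eq_intros)
    then have "(f has_field_derivative e * (\<alpha> * (- 4 * \<mu> / (D z)\<^sup>2))) (at z)"
      unfolding fN[symmetric] .
    then show ?thesis by (simp add: DERIV_imp_deriv mult.assoc)
  qed
  show thesis
  proof (cases "\<mu> = 1")
    case True
    then have "D z = 2 * \<i>" for z by (simp add: D_def)
    then show thesis using that[of "e * \<alpha> * (- 4 * \<mu> / (2 * \<i>)\<^sup>2)"] df by simp
  next
    case False
    define q where "q = 1 - \<mu>"
    have q0: "q \<noteq> 0" using False by (simp add: q_def)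
    \<comment> \<open>The zero of \<open>D\<close>, real because
      \<open>norm \<mu> = 1\<close>.\<close>
    define X where "X = - \<i> * (1 + \<mu>) / q"
    have "cnj X = X"
    proof -
      have q1: "cnj q \<noteq> 0" using q0 by simp
      have "(\<i> * (1 + cnj \<mu>)) * q = (- \<i> * (1 + \<mu>)) * cnj q"
        using mm by (simp add: q_def algebra_simps)
      then have "(\<i> * (1 + cnj \<mu>)) / cnj q = (- \<i> * (1 + \<mu>)) / q" by (subst frac_eq_eq[OF q1 q0])
      then show ?thesis by (simp add: X_def)
    qed
    then have Xr: "of_real (Re X) = X" by (simp add: complex_eq_iff)
    have Dq: "D (Re X + w) = q * w" for w :: complex
    proof -
      have "q * X = - \<i> * (1 + \<mu>)" using q0 by (simp add: X_def)
      then show ?thesis unfolding Xr by (simp add: D_def q_def algebra_simps)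
    qed
    define c where "c = \<alpha> * 4 / (norm q)\<^sup>2"
    have c: "0 < c" using a q0 by (simp add: c_def)
    have dfw: "deriv f (Re X + w) = c * (e / w\<^sup>2)" if w: "w \<in> uhp" for w :: complex
    proof -
      have "q\<^sup>2 = - \<mu> * (q * cnj q)" using mm by (simp add: q_def power2_eq_square algebra_simps)
      also have "q * cnj q = of_real ((norm q)\<^sup>2)" by (rule complex_norm_square[symmetric])
      finally have q2: "q\<^sup>2 = - \<mu> * of_real ((norm q)\<^sup>2)" .
      have mu0: "\<mu> \<noteq> 0" using mu(1) by auto
      have w0: "w \<noteq> 0" using w by auto
      have "deriv f (Re X + w) = e * \<alpha> * (- 4 * \<mu> / (q * w)\<^sup>2)"
        using df[of "Re X + w"] w unfolding Dq by simp
      also have "\<dots> = e * \<alpha> * (- 4 * \<mu> / (- \<mu> * of_real ((norm q)\<^sup>2) * w\<^sup>2))"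
        unfolding power_mult_distrib q2 ..
      also have "\<dots> = c * (e / w\<^sup>2)" using mu0 w0 q0 by (simp add: c_def)
      finally show ?thesis .
    qed
    have key: "0 \<le> Re (e / w\<^sup>2)" if w: "w \<in> uhp" for w :: complex
    proof -
      have "0 \<le> Re (deriv f (Re X + w))" using w by (intro pos) simp
      moreover have "Re (of_real c * x) = c * Re x" for x by simp
      ultimately have "0 \<le> c * Re (e / w\<^sup>2)" unfolding dfw[OF w] by metis
      then show ?thesis using c by (simp add: zero_le_mult_iff)
    qed
    \<comment> \<open>Four sample squares, in the directions of \<open>\<i>\<close>,
      \<open>- \<i>\<close>, \<open>3 + 4 * \<i>\<close> and -1, already force
      \<open>e = 0\<close>.\<close>
    have sq: "(1 + \<i>)\<^sup>2 = 2 * \<i>" "(-1 + \<i>)\<^sup>2 = - 2 * \<i>" "(2 + \<i>)\<^sup>2 = 3 + 4 * \<i>" "\<i>\<^sup>2 = -1"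
      by (simp_all add: power2_eq_square algebra_simps)
    have 1: "0 \<le> Im e" using key[of "1 + \<i>"] unfolding sq by (simp add: Re_divide)
    have 2: "Im e \<le> 0" using key[of "-1 + \<i>"] unfolding sq by (simp add: Re_divide)
    have 3: "Re e \<le> 0" using key[of "\<i>"] unfolding sq by (simp add: Re_divide)
    have 4: "0 \<le> Re e * 3 + Im e * 4" using key[of "2 + \<i>"] unfolding sq by (simp add: Re_divide)
    have "e = 0" using 1 2 3 4 by (simp add: complex_eq_iff)
    then show thesis using e by simp
  qed
qed

section \<open>Lines as limits of graphs\<close>

lemma near_additive_direction:
  fixes X Y :: "nat \<Rightarrow> complex"
  assumes X: "\<And>n. norm (X n) = \<rho>" and Y: "\<And>n. norm (Y n) = 1" and s: "s \<longlonglongrightarrow> 0" "\<And>n. 0 < s n"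
    and add: "\<And>n. \<rho> + 1 \<le> (1 + 2 * s n) * norm (X n + Y n)"
  shows "(\<lambda>n. X n - of_real \<rho> * Y n) \<longlonglongrightarrow> 0"
proof -
  have r: "0 \<le> \<rho>" using X[of 0] norm_ge_zero by metis
  have bd: "(norm (X n - of_real \<rho> * Y n))\<^sup>2 \<le> 2 * \<rho>\<^sup>2 - \<rho> * (((\<rho> + 1) / (1 + 2 * s n))\<^sup>2 - \<rho>\<^sup>2 - 1)" for n
  proof -
    have X2: "(Re (X n))\<^sup>2 + (Im (X n))\<^sup>2 = \<rho>\<^sup>2" using X[of n] by (metis cmod_power2)
    have Y2: "(Re (Y n))\<^sup>2 + (Im (Y n))\<^sup>2 = 1" using Y[of n] by (metis cmod_power2 one_power2)
    \<comment> \<open>The deviation from parallelism is expressed through the norm of the sum by the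
      cosine rule; near equality in the triangle inequality makes it small.\<close>
    have "(norm (X n - of_real \<rho> * Y n))\<^sup>2 = ((Re (X n))\<^sup>2 + (Im (X n))\<^sup>2) + \<rho>\<^sup>2 * ((Re (Y n))\<^sup>2 + (Im (Y n))\<^sup>2)
        - \<rho> * ((norm (X n + Y n))\<^sup>2 - ((Re (X n))\<^sup>2 + (Im (X n))\<^sup>2) - ((Re (Y n))\<^sup>2 + (Im (Y n))\<^sup>2))"
      unfolding cmod_power2 by (simp add: power2_eq_square algebra_simps)
    then have e: "(norm (X n - of_real \<rho> * Y n))\<^sup>2 = 2 * \<rho>\<^sup>2 - \<rho> * ((norm (X n + Y n))\<^sup>2 - \<rho>\<^sup>2 - 1)"
      unfolding X2 Y2 by simp
    have "(\<rho> + 1) / (1 + 2 * s n) \<le> norm (X n + Y n)"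
      using add[of n] s(2)[of n] by (simp add: divide_le_eq mult.commute)
    then have "((\<rho> + 1) / (1 + 2 * s n))\<^sup>2 \<le> (norm (X n + Y n))\<^sup>2"
      using r s(2)[of n] by (intro power_mono) auto
    then show ?thesis unfolding e using r by (simp add: mult_left_mono)
  qed
  have l: "(\<lambda>n. 2 * \<rho>\<^sup>2 - \<rho> * (((\<rho> + 1) / (1 + 2 * s n))\<^sup>2 - \<rho>\<^sup>2 - 1)) \<longlonglongrightarrow> 2 * \<rho>\<^sup>2 - \<rho> * (((\<rho> + 1) / (1 + 2 * 0))\<^sup>2 - \<rho>\<^sup>2 - 1)"
    by (intro tendsto_intros s(1)) auto
  have z: "2 * \<rho>\<^sup>2 - \<rho> * (((\<rho> + 1) / (1 + 2 * 0))\<^sup>2 - \<rho>\<^sup>2 - 1) = 0"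
    by (simp add: power2_eq_square algebra_simps)
  have "\<forall>\<^sub>F n in sequentially. norm ((norm (X n - of_real \<rho> * Y n))\<^sup>2)
      \<le> 2 * \<rho>\<^sup>2 - \<rho> * (((\<rho> + 1) / (1 + 2 * s n))\<^sup>2 - \<rho>\<^sup>2 - 1)"
    unfolding real_norm_def abs_power2 by (intro always_eventually allI bd)
  then have "(\<lambda>n. (norm (X n - of_real \<rho> * Y n))\<^sup>2) \<longlonglongrightarrow> 0"
    using l[unfolded z] by (rule Lim_null_comparison)
  then have "(\<lambda>n. sqrt ((norm (X n - of_real \<rho> * Y n))\<^sup>2)) \<longlonglongrightarrow> sqrt 0" by (rule tendsto_real_sqrt)
  then show ?thesis using tendsto_norm_zero_cancel[of "\<lambda>n. X n - of_real \<rho> * Y n"] by simp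
qed

text \<open>The projection does not increase distances, so moving the parameter by
  \<open>\<rho>\<close> to either side covers at least the distance \<open>\<rho>\<close>; the
  intermediate value theorem finds the exact distance. The sign \<open>d\<close> selects the
  side.\<close>

lemma qs_curve_reach:
  assumes q: "qs_curve s \<gamma>" and r: "0 < \<rho>" and d: "\<bar>d\<bar> = 1"
  obtains t where "0 < t" "norm (\<gamma> (x + d * t) - \<gamma> x) = \<rho>"
proof -
  let ?g = "\<lambda>t. norm (\<gamma> (x + d * t) - \<gamma> x)"
  have "continuous_on {0..\<rho>} ?g"
    by (intro continuous_intros continuous_on_compose2[OF qs_curve_continuous[OF q, of UNIV]]) auto
  moreover have "\<rho> \<le> ?g \<rho>" using qs_curve_dist_ge[OF q, of "x + d * \<rho>" x] r d by (simp add: abs_mult)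
  ultimately obtain t where t: "0 \<le> t" "t \<le> \<rho>" "?g t = \<rho>"
    using IVT'[of ?g 0 \<rho> \<rho>] r by auto
  then have "t \<noteq> 0" using r by auto
  then show thesis using t that[of t] by auto
qed

text \<open>The graphs may become vertical in the limit, so their points are tracked by distance
  from a base point and not by parameter. Base points and unit chords converge along
  \<open>r\<close>, and near additivity forces all other points into the limit direction. The extra
  subsequence \<open>j\<close> in the last clause allows further extractions.\<close>

lemma qs_curve_limit_line:
  assumes q: "\<And>n. qs_curve (s n) (\<gamma> n)" and s: "\<And>n. 0 < s n" "\<And>n. s n \<le> 1/2" "s \<longlonglongrightarrow> 0"
    and bd: "\<And>n. norm (\<gamma> n (x n)) \<le> B"
  obtains r p e where "strict_mono (r :: nat \<Rightarrow> nat)" "norm e = 1"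
    "\<And>\<rho>::real. \<exists>y. (\<lambda>n. \<gamma> (r n) (y n)) \<longlonglongrightarrow> p + of_real \<rho> * e"
    "\<And>y j w. strict_mono (j :: nat \<Rightarrow> nat) \<Longrightarrow> (\<lambda>n. \<gamma> (r (j n)) (y n)) \<longlonglongrightarrow> w \<Longrightarrow> \<exists>\<rho>. w = p + of_real \<rho> * e"
proof -
  have "\<forall>n. \<exists>t>0. norm (\<gamma> n (x n - t) - \<gamma> n (x n)) = 1"
  proof
    fix n obtain t where "0 < t" "norm (\<gamma> n (x n + (-1) * t) - \<gamma> n (x n)) = 1"
      using qs_curve_reach[OF q[of n], of 1 "-1" "x n"] by auto
    then show "\<exists>t>0. norm (\<gamma> n (x n - t) - \<gamma> n (x n)) = 1" by auto
  qed
  then obtain tb where tb: "\<And>n. 0 < tb n" "\<And>n. norm (\<gamma> n (x n - tb n) - \<gamma> n (x n)) = 1" by metis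
  define P where "P n = \<gamma> n (x n)" for n
  define Y where "Y n = \<gamma> n (x n) - \<gamma> n (x n - tb n)" for n
  have Y1: "norm (Y n) = 1" for n using tb(2)[of n] by (simp add: Y_def norm_minus_commute)
  have "bounded (range (\<lambda>n. (P n, Y n)))"
  proof -
    have "norm (P n, Y n) \<le> B + 1" for n
      using norm_Pair_le[of "P n" "Y n"] bd[of n] Y1[of n] by (simp add: P_def)
    then show ?thesis unfolding bounded_iff by auto
  qed
  then obtain l r where r: "strict_mono (r :: nat \<Rightarrow> nat)" and lr: "((\<lambda>n. (P n, Y n)) \<circ> r) \<longlonglongrightarrow> l"
    using bounded_imp_convergent_subsequence by blast
  define p where "p = fst l"
  define e where "e = snd l"
  have Pl: "(\<lambda>n. P (r n)) \<longlonglongrightarrow> p" using tendsto_fst[OF lr] by (simp add: o_def p_def)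
  have Yl: "(\<lambda>n. Y (r n)) \<longlonglongrightarrow> e" using tendsto_snd[OF lr] by (simp add: o_def e_def)
  have e1: "norm e = 1" using tendsto_norm[OF Yl] unfolding Y1 by (simp add: LIMSEQ_const_iff)
  have sr: "(\<lambda>n. s (r n)) \<longlonglongrightarrow> 0" using LIMSEQ_subseq_LIMSEQ[OF s(3) r] by (simp add: o_def)
  have right: "\<exists>y. (\<forall>n. x n < y n) \<and> (\<forall>n. norm (\<gamma> n (y n) - P n) = \<rho>) \<and> (\<lambda>n. \<gamma> (r n) (y (r n)) - P (r n)) \<longlonglongrightarrow> of_real \<rho> * e"
    if rho: "0 < \<rho>" for \<rho>
  proof -
    have "\<forall>n. \<exists>y>x n. norm (\<gamma> n y - P n) = \<rho>"
    proof
      fix n obtain t where "0 < t" "norm (\<gamma> n (x n + 1 * t) - \<gamma> n (x n)) = \<rho>"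
        using qs_curve_reach[OF q[of n] rho, of 1 "x n"] by auto
      then show "\<exists>y>x n. norm (\<gamma> n y - P n) = \<rho>" by (intro exI[of _ "x n + t"]) (auto simp: P_def)
    qed
    then obtain y where y: "\<And>n. x n < y n" "\<And>n. norm (\<gamma> n (y n) - P n) = \<rho>" by metis
    define X where "X n = \<gamma> n (y n) - P n" for n
    have "\<rho> + 1 \<le> (1 + 2 * s n) * norm (X n + Y n)" for n
    proof -
      have "norm (\<gamma> n (x n - tb n) - \<gamma> n (x n)) + norm (\<gamma> n (x n) - \<gamma> n (y n))
          \<le> (1 + 2 * s n) * norm (\<gamma> n (x n - tb n) - \<gamma> n (y n))"
        by (rule qs_curve_near_additive[OF q s(1,2)]) (use tb y in auto)
      moreover have "norm (\<gamma> n (x n) - \<gamma> n (y n)) = \<rho>" using y(2)[of n] by (simp add: P_def norm_minus_commute)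
      moreover have "norm (X n + Y n) = norm (\<gamma> n (x n - tb n) - \<gamma> n (y n))"
        by (simp add: X_def Y_def P_def norm_minus_commute)
      ultimately show ?thesis using tb(2)[of n] by simp
    qed
    then have "(\<lambda>n. X (r n) - of_real \<rho> * Y (r n)) \<longlonglongrightarrow> 0"
      by (intro near_additive_direction[OF _ _ sr]) (use y(2) Y1 s(1) in \<open>auto simp: X_def\<close>)
    then have "(\<lambda>n. (X (r n) - of_real \<rho> * Y (r n)) + of_real \<rho> * Y (r n)) \<longlonglongrightarrow> 0 + of_real \<rho> * e"
      by (intro tendsto_intros Yl)
    then have "(\<lambda>n. X (r n)) \<longlonglongrightarrow> of_real \<rho> * e" by simp
    then show ?thesis using y unfolding X_def by blast
  qed
  \<comment> \<open>Points to the left of the base point are compared with a unit chord to its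
    right; this chord has the same limit direction \<open>e\<close>.\<close>
  obtain ya where ya: "\<And>n. x n < ya n" "\<And>n. norm (\<gamma> n (ya n) - P n) = 1"
    "(\<lambda>n. \<gamma> (r n) (ya (r n)) - P (r n)) \<longlonglongrightarrow> of_real 1 * e" using right[of 1] by auto
  define Y' where "Y' n = \<gamma> n (ya n) - P n" for n
  have Yl': "(\<lambda>n. Y' (r n)) \<longlonglongrightarrow> e" using ya(3) by (simp add: Y'_def)
  have Y'1: "norm (Y' n) = 1" for n using ya(2) by (simp add: Y'_def)
  have A: "\<exists>y. (\<lambda>n. \<gamma> (r n) (y n)) \<longlonglongrightarrow> p + of_real \<rho> * e" for \<rho>
  proof -
    consider "\<rho> = 0" | "0 < \<rho>" | "\<rho> < 0" by linarith
    then show ?thesis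
    proof cases
      case 1
      then show ?thesis using Pl by (intro exI[of _ "\<lambda>n. x (r n)"]) (simp add: P_def)
    next
      case 2
      then obtain y where "(\<lambda>n. \<gamma> (r n) (y (r n)) - P (r n)) \<longlonglongrightarrow> of_real \<rho> * e" using right by blast
      from tendsto_add[OF Pl this] show ?thesis by (intro exI[of _ "\<lambda>n. y (r n)"]) simp
    next
      case 3
      define \<sigma> where "\<sigma> = - \<rho>"
      have sg: "0 < \<sigma>" using 3 by (simp add: \<sigma>_def)
      have "\<forall>n. \<exists>y<x n. norm (\<gamma> n y - P n) = \<sigma>"
      proof
        fix n obtain t where "0 < t" "norm (\<gamma> n (x n + (-1) * t) - \<gamma> n (x n)) = \<sigma>"
          using qs_curve_reach[OF q[of n] sg, of "-1" "x n"] by auto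
        then show "\<exists>y<x n. norm (\<gamma> n y - P n) = \<sigma>" by (intro exI[of _ "x n - t"]) (auto simp: P_def)
      qed
      then obtain y where y: "\<And>n. y n < x n" "\<And>n. norm (\<gamma> n (y n) - P n) = \<sigma>" by metis
      define X where "X n = P n - \<gamma> n (y n)" for n
      have Xn: "norm (X n) = \<sigma>" for n using y(2)[of n] by (simp add: X_def norm_minus_commute)
      have "\<sigma> + 1 \<le> (1 + 2 * s n) * norm (X n + Y' n)" for n
      proof -
        have "norm (\<gamma> n (y n) - \<gamma> n (x n)) + norm (\<gamma> n (x n) - \<gamma> n (ya n))
            \<le> (1 + 2 * s n) * norm (\<gamma> n (y n) - \<gamma> n (ya n))"
          by (rule qs_curve_near_additive[OF q s(1,2) y(1) ya(1)])
        then show ?thesis using y(2)[of n] ya(2)[of n] by (simp add: X_def Y'_def P_def norm_minus_commute)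
      qed
      then have "(\<lambda>n. X (r n) - of_real \<sigma> * Y' (r n)) \<longlonglongrightarrow> 0"
        by (intro near_additive_direction[OF _ _ sr]) (use Xn Y'1 s(1) in auto)
      then have "(\<lambda>n. P (r n) - (X (r n) - of_real \<sigma> * Y' (r n)) - of_real \<sigma> * Y' (r n)) \<longlonglongrightarrow> p - 0 - of_real \<sigma> * e"
        by (intro tendsto_intros Yl' Pl)
      then show ?thesis by (intro exI[of _ "\<lambda>n. y (r n)"]) (simp add: X_def \<sigma>_def)
    qed
  qed
  have "\<exists>\<rho>. w = p + of_real \<rho> * e" if j: "strict_mono (j :: nat \<Rightarrow> nat)" and w: "(\<lambda>n. \<gamma> (r (j n)) (y n)) \<longlonglongrightarrow> w" for y j w
  proof -
    define i where "i n = r (j n)" for n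
    have Pi: "(\<lambda>n. P (i n)) \<longlonglongrightarrow> p" and Yi: "(\<lambda>n. Y (i n)) \<longlonglongrightarrow> e" and Yi': "(\<lambda>n. Y' (i n)) \<longlonglongrightarrow> e"
      and si: "(\<lambda>n. s (i n)) \<longlonglongrightarrow> 0" and wi: "(\<lambda>n. \<gamma> (i n) (y n)) \<longlonglongrightarrow> w"
      using LIMSEQ_subseq_LIMSEQ[OF Pl j] LIMSEQ_subseq_LIMSEQ[OF Yl j] LIMSEQ_subseq_LIMSEQ[OF Yl' j]
        LIMSEQ_subseq_LIMSEQ[OF sr j] w by (simp_all add: o_def i_def)
    \<comment> \<open>\<open>La\<close> and \<open>Lb\<close> are the additivity defects for a point
      to the left and to the right of the base point. The side may change with \<open>n\<close>, so
      only their minimum is controlled; in the limit one of them gives equality in the triangle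
      inequality.\<close>
    define La where "La n = 1 + norm (P (i n) - \<gamma> (i n) (y n)) - (1 + 2 * s (i n)) * norm (P (i n) - \<gamma> (i n) (y n) + Y' (i n))" for n
    define Lb where "Lb n = 1 + norm (\<gamma> (i n) (y n) - P (i n)) - (1 + 2 * s (i n)) * norm (\<gamma> (i n) (y n) - P (i n) + Y (i n))" for n
    have "min (La n) (Lb n) \<le> 0" for n
    proof -
      consider "y n < x (i n)" | "y n = x (i n)" | "x (i n) < y n" by linarith
      then show ?thesis
      proof cases
        case 1
        have "norm (\<gamma> (i n) (y n) - \<gamma> (i n) (x (i n))) + norm (\<gamma> (i n) (x (i n)) - \<gamma> (i n) (ya (i n)))
            \<le> (1 + 2 * s (i n)) * norm (\<gamma> (i n) (y n) - \<gamma> (i n) (ya (i n)))"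
          by (rule qs_curve_near_additive[OF q s(1,2) 1 ya(1)])
        then show ?thesis using ya(2)[of "i n"] by (simp add: La_def Y'_def P_def norm_minus_commute)
      next
        case 2
        then show ?thesis using s(1)[of "i n"] Y'1[of "i n"] by (simp add: La_def P_def min_le_iff_disj)
      next
        case 3
        have "norm (\<gamma> (i n) (x (i n) - tb (i n)) - \<gamma> (i n) (x (i n))) + norm (\<gamma> (i n) (x (i n)) - \<gamma> (i n) (y n))
            \<le> (1 + 2 * s (i n)) * norm (\<gamma> (i n) (x (i n) - tb (i n)) - \<gamma> (i n) (y n))"
          by (rule qs_curve_near_additive[OF q s(1,2) _ 3]) (use tb in auto)
        then show ?thesis using tb(2)[of "i n"] by (simp add: Lb_def Y_def P_def norm_minus_commute)
      qed
    qed
    moreover have "La \<longlonglongrightarrow> 1 + norm (p - w) - (1 + 2 * 0) * norm (p - w + e)"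
      unfolding La_def[abs_def] by (intro tendsto_intros Pi wi si Yi')
    moreover have "Lb \<longlonglongrightarrow> 1 + norm (w - p) - (1 + 2 * 0) * norm (w - p + e)"
      unfolding Lb_def[abs_def] by (intro tendsto_intros Pi wi si Yi)
    ultimately have "min (1 + norm (p - w) - (1 + 2 * 0) * norm (p - w + e)) (1 + norm (w - p) - (1 + 2 * 0) * norm (w - p + e)) \<le> 0"
      by (intro LIMSEQ_le_const2[OF tendsto_min]) auto
    then have "norm e + norm (p - w) \<le> norm (p - w + e) \<or> norm e + norm (w - p) \<le> norm (w - p + e)"
      using e1 by (auto simp: min_le_iff_disj)
    then have "norm (e + (p - w)) = norm e + norm (p - w) \<or> norm (e + (w - p)) = norm e + norm (w - p)"
      using norm_triangle_ineq[of e "p - w"] norm_triangle_ineq[of e "w - p"] by (auto simp: add.commute)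
    then have "p - w = norm (p - w) *\<^sub>R e \<or> w - p = norm (w - p) *\<^sub>R e"
      unfolding norm_triangle_eq using e1 by simp
    then show ?thesis
    proof
      assume "p - w = norm (p - w) *\<^sub>R e"
      then have "w = p + of_real (- norm (p - w)) * e" by (simp add: scaleR_conv_of_real algebra_simps)
      then show ?thesis by blast
    next
      assume "w - p = norm (w - p) *\<^sub>R e"
      then have "w = p + of_real (norm (w - p)) * e" by (simp add: scaleR_conv_of_real algebra_simps)
      then show ?thesis by blast
    qed
  qed
  then show thesis using that r e1 A by blast
qed

section \<open>Estimates for inverse maps, and the limit of flat graphs\<close>

lemma inverse_Schwarz:
  assumes hol: "f holomorphic_on uhp" and inj: "inj_on f uhp" and sub: "ball (f z) r \<subseteq> f ` uhp"
    and r: "0 < r" and z: "z \<in> uhp" "z1 \<in> uhp" and d: "norm (f z1 - f z) < r"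
  shows "norm (z1 - z) * r \<le> norm (f z1 - f z) * norm (z1 - cnj z)"
proof -
  obtain h where h: "h holomorphic_on f ` uhp" "\<And>z. z \<in> uhp \<Longrightarrow> h (f z) = z"
    by (rule holomorphic_has_inverse[OF hol open_uhp inj]) (rule that)
  have hu: "h w \<in> uhp" if "w \<in> f ` uhp" for w
    using that h(2) by (elim imageE) simp
  have ne: "v - cnj z \<noteq> 0" if "v \<in> uhp" for v
  proof
    assume "v - cnj z = 0"
    then have "Im (v - cnj z) = 0" by simp
    then show False using that z(1) by simp
  qed
  have inb: "f z + r * \<zeta> \<in> f ` uhp" if "norm \<zeta> < 1" for \<zeta> :: complex
  proof -
    have "f z + r * \<zeta> \<in> ball (f z) r" using that r by (simp add: dist_norm norm_mult)
    then show ?thesis using sub by blast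
  qed
  \<comment> \<open>The inverse on the given disc, followed by the Cayley transform centred at
    \<open>z\<close>, is a self-map of the unit disc fixing 0; the Schwarz lemma for it is the
    claim.\<close>
  define k where "k \<zeta> = (h (f z + r * \<zeta>) - z) / (h (f z + r * \<zeta>) - cnj z)" for \<zeta> :: complex
  have holh: "(\<lambda>\<zeta>. h (f z + r * \<zeta>)) holomorphic_on ball 0 1"
    by (rule holomorphic_on_compose_gen[OF _ h(1), unfolded o_def]) (use inb in \<open>auto intro!: holomorphic_intros\<close>)
  have holk: "k holomorphic_on ball 0 1"
    unfolding k_def by (intro holomorphic_intros holh ne hu inb) auto
  have k1: "norm (k \<zeta>) < 1" if "norm \<zeta> < 1" for \<zeta>
  proof -
    define v where "v = h (f z + r * \<zeta>)"
    have v: "v \<in> uhp" unfolding v_def by (intro hu inb that)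
    have "0 < Im v * Im z" using v z(1) by simp
    then have "(norm (v - z))\<^sup>2 < (norm (v - cnj z))\<^sup>2"
      unfolding cmod_power2 by (simp add: power2_eq_square algebra_simps)
    then have "norm (v - z) < norm (v - cnj z)" by (rule power2_less_imp_less) simp
    then show ?thesis using ne[OF v] by (simp add: k_def v_def[symmetric] norm_divide divide_less_eq)
  qed
  define \<xi> where "\<xi> = (f z1 - f z) / r"
  have nx: "norm \<xi> = norm (f z1 - f z) / r" using r by (simp add: \<xi>_def norm_divide)
  have x1: "norm \<xi> < 1" using d r by (simp add: nx)
  have "norm (k \<xi>) \<le> norm \<xi>"
    by (rule Schwarz_Lemma(1)[OF holk _ k1 x1]) (simp_all add: k_def h(2)[OF z(1)])
  moreover have "k \<xi> = (z1 - z) / (z1 - cnj z)"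
    using r h(2)[OF z(2)] by (simp add: k_def \<xi>_def)
  ultimately have "norm (z1 - z) / norm (z1 - cnj z) \<le> norm (f z1 - f z) / r"
    by (simp add: nx norm_divide)
  moreover have "0 < norm (z1 - cnj z)" using ne[OF z(2)] by simp
  ultimately show ?thesis using r by (simp add: divide_le_eq pos_le_divide_eq mult_ac)
qed

text \<open>The infinitesimal form of \<open>inverse_Schwarz\<close>: let \<open>z1\<close> tend to
  \<open>z\<close>.\<close>

lemma inscribed_radius_le:
  assumes hol: "f holomorphic_on uhp" and inj: "inj_on f uhp" and sub: "ball (f z) r \<subseteq> f ` uhp"
    and r: "0 < r" and z: "z \<in> uhp"
  shows "r \<le> 2 * Im z * norm (deriv f z)"
proof -
  have D: "(f has_field_derivative deriv f z) (at z)" using holomorphic_derivI[OF hol open_uhp z] .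
  then have "((\<lambda>w. (f w - f z) / (w - z)) \<longlongrightarrow> deriv f z) (at z)" by (simp add: has_field_derivative_iff)
  then have "((\<lambda>w. norm ((f w - f z) / (w - z)) * norm (w - cnj z)) \<longlongrightarrow> norm (deriv f z) * norm (z - cnj z)) (at z)"
    by (intro tendsto_intros)
  moreover have "\<forall>\<^sub>F w in at z. r \<le> norm ((f w - f z) / (w - z)) * norm (w - cnj z)"
  proof -
    have "isCont f z" using D DERIV_isCont by blast
    then have "\<forall>\<^sub>F w in at z. dist (f w) (f z) < r" using r by (simp add: isCont_def tendstoD)
    moreover have "\<forall>\<^sub>F w in at z. w \<in> uhp"
      using eventually_at_topological open_uhp z by blast
    moreover have "\<forall>\<^sub>F w in at z. w \<noteq> z" by (simp add: eventually_at_filter)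
    ultimately show ?thesis
    proof eventually_elim
      case (elim w)
      have "norm (w - z) * r \<le> norm (f w - f z) * norm (w - cnj z)"
        by (rule inverse_Schwarz[OF hol inj sub r z elim(2)]) (use elim in \<open>simp add: dist_norm\<close>)
      then show ?case using elim by (simp add: norm_divide field_simps)
    qed
  qed
  ultimately have "r \<le> norm (deriv f z) * norm (z - cnj z)"
    by (rule tendsto_lowerbound) simp
  also have "norm (z - cnj z) = 2 * Im z"
    using z by (simp add: complex_diff_cnj norm_mult)
  finally show ?thesis by (simp add: mult_ac)
qed

lemma uniform_limit_shift:
  fixes F :: "nat \<Rightarrow> complex \<Rightarrow> complex"
  assumes "uniform_limit K F g sequentially" "c \<longlonglongrightarrow> l"
  shows "uniform_limit K (\<lambda>n z. F n z - c n) (\<lambda>z. g z - l) sequentially"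
proof (rule uniform_limit_minus[OF assms(1)])
  show "uniform_limit K (\<lambda>n z. c n) (\<lambda>z. l) sequentially"
    using assms(2) by (auto simp: uniform_limit_iff tendsto_iff)
qed

text \<open>A normal limit of the maps omits the limit line (Hurwitz), and is onto a half-plane by \<open>inverse_Schwarz\<close>;
  then it is a Moebius map, and \<open>Re f' \<ge> 0\<close> forces it to be affine.\<close>
lemma flat_graph_maps_affine_limit:
  assumes q: "\<And>n. qs_curve (s n) (\<gamma> n)" and s: "\<And>n. 0 < s n" "\<And>n. s n \<le> 1/2" "s \<longlonglongrightarrow> 0"
    and gm: "\<And>n. graph_map (\<gamma> n) (f n)" and f0: "\<And>n. f n \<i> = 0" and f1: "\<And>n. norm (deriv (f n) \<i>) = 1"
    and d: "0 < \<delta>" "\<And>n. \<delta> \<le> norm (deriv (deriv (f n)) \<i>)"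
  shows False
proof -
  have hol: "f n holomorphic_on uhp" and inj: "inj_on (f n) uhp" and im: "f n ` uhp = epigraph (\<gamma> n)"
    and pos: "z \<in> uhp \<Longrightarrow> 0 < Re (deriv (f n) z)" for n z using gm[of n] by (auto simp: graph_map_def)
  have ii: "\<i> \<in> uhp" by simp
  have cont: "continuous_on UNIV (\<gamma> n)" and Rg: "Re (\<gamma> n x) = x" for n x
    using q qs_curve_continuous qs_curve_Re by blast+
  \<comment> \<open>If the graph avoided the disc of radius 3 about \<open>f n \<i> = 0\<close>,
    that disc would lie in the image; but the inscribed radius there is at most 2.\<close>
  have "\<exists>x. norm (\<gamma> n x) \<le> 3" for n
  proof (rule ccontr)
    assume a: "\<not> (\<exists>x. norm (\<gamma> n x) \<le> 3)"
    have "ball 0 3 \<subseteq> epigraph (\<gamma> n)"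
    proof (rule connected_subset_epigraph[OF cont Rg])
      show "ball 0 3 \<inter> range (\<gamma> n) = {}"
      proof (rule equals0I)
        fix u assume "u \<in> ball 0 3 \<inter> range (\<gamma> n)"
        then obtain x where "norm (\<gamma> n x) < 3" by auto
        then show False using a less_imp_le by blast
      qed
      have "f n \<i> \<in> epigraph (\<gamma> n)" unfolding im[symmetric] using ii by (rule imageI)
      moreover have "f n \<i> \<in> ball 0 3" using f0[of n] by simp
      ultimately show "ball 0 3 \<inter> epigraph (\<gamma> n) \<noteq> {}" by blast
    qed simp
    then have "ball (f n \<i>) 3 \<subseteq> f n ` uhp" using f0 im by simp
    from inscribed_radius_le[OF hol inj this _ ii] show False using f1 by simp
  qed
  then obtain x where x: "\<And>n. norm (\<gamma> n (x n)) \<le> 3" by metis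
  obtain r0 p e0 where r0: "strict_mono (r0 :: nat \<Rightarrow> nat)" and e0: "norm e0 = 1"
    and on_line0: "\<And>\<rho>::real. \<exists>y. (\<lambda>n. \<gamma> (r0 n) (y n)) \<longlonglongrightarrow> p + of_real \<rho> * e0"
    and lim_line0: "\<And>y j w. strict_mono (j :: nat \<Rightarrow> nat) \<Longrightarrow> (\<lambda>n. \<gamma> (r0 (j n)) (y n)) \<longlonglongrightarrow> w \<Longrightarrow> \<exists>\<rho>. w = p + of_real \<rho> * e0"
    by (rule qs_curve_limit_line[OF q s x]) (rule that)
  define H where "H = range f"
  \<comment> \<open>The derivative has positive real part and modulus 1 at \<open>\<i>\<close>, so
    Harnack bounds it on a disc containing \<open>K\<close> and \<open>\<i>\<close>; integration
    from \<open>f n \<i> = 0\<close> bounds the maps.\<close>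
  have bnd: "\<exists>B. \<forall>h\<in>H. \<forall>z\<in>K. norm (h z) \<le> B" if K: "compact K" "K \<subseteq> uhp" for K
  proof -
    obtain N r where N: "0 < N" "0 < r" "r < N" "K \<subseteq> cball (\<i> * of_real N) r" "\<i> \<in> cball (\<i> * of_real N) r"
      "ball (\<i> * of_real N) N \<subseteq> uhp" using compact_in_uhp_ball[OF K] by blast
    let ?B = "cball (\<i> * of_real N) r"
    have "?B \<subseteq> ball (\<i> * of_real N) N" using N(3) by (simp add: cball_subset_ball_iff)
    then have Bu: "?B \<subseteq> uhp" using N(6) by blast
    obtain C where C: "0 < C" "\<And>p z. p holomorphic_on uhp \<Longrightarrow> (\<And>z. z \<in> uhp \<Longrightarrow> 0 < Re (p z)) \<Longrightarrow> z \<in> ?B \<Longrightarrow> norm (p z) \<le> C * norm (p \<i>)"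
      using Re_pos_uhp_bound[OF compact_cball Bu] by blast
    have "norm (f n z) \<le> C * (2 * r)" if z: "z \<in> K" for n z
    proof -
      have dC: "norm (deriv (f n) w) \<le> C" if "w \<in> ?B" for w
        using C(2)[OF holomorphic_deriv[OF hol open_uhp] pos that, of n] f1[of n] by simp
      have "norm (f n z - f n \<i>) \<le> C * norm (z - \<i>)"
      proof (rule field_differentiable_bound[OF convex_cball])
        show "(f n has_field_derivative deriv (f n) w) (at w within ?B)" if "w \<in> ?B" for w
          using holomorphic_derivI[OF hol open_uhp] Bu that has_field_derivative_at_within by blast
        show "z \<in> ?B" using z N(4) by blast
      qed (use dC N(5) in auto)
      moreover have "norm (z - \<i>) \<le> 2 * r"
        using norm_triangle_ineq4[of "z - \<i> * of_real N" "\<i> - \<i> * of_real N"] z N(4,5)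
        by (force simp: dist_norm norm_minus_commute)
      ultimately show ?thesis using f0[of n] C(1) order_trans[OF _ mult_left_mono[of "norm (z - \<i>)" "2 * r" C]] by simp
    qed
    then show ?thesis unfolding H_def by blast
  qed
  obtain g r1 where holg: "g holomorphic_on uhp" and r1: "strict_mono (r1 :: nat \<Rightarrow> nat)"
    and "\<And>z. z \<in> uhp \<Longrightarrow> (\<lambda>n. f (r0 (r1 n)) z) \<longlonglongrightarrow> g z"
    and ul1: "\<And>K. compact K \<Longrightarrow> K \<subseteq> uhp \<Longrightarrow> uniform_limit K ((\<lambda>n. f (r0 n)) \<circ> r1) g sequentially"
  proof (rule Montel[OF open_uhp, of H "\<lambda>n. f (r0 n)"])
    show "\<And>h. h \<in> H \<Longrightarrow> h holomorphic_on uhp" using hol by (auto simp: H_def)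
    show "range (\<lambda>n. f (r0 n)) \<subseteq> H" by (auto simp: H_def)
  qed (use bnd in auto)
  define \<phi> where "\<phi> n = f (r0 (r1 n))" for n
  define \<Gamma> where "\<Gamma> n = \<gamma> (r0 (r1 n))" for n
  have lim: "(\<lambda>n. \<phi> n z) \<longlonglongrightarrow> g z" if "z \<in> uhp" for z
    using \<open>\<And>z. z \<in> uhp \<Longrightarrow> (\<lambda>n. f (r0 (r1 n)) z) \<longlonglongrightarrow> g z\<close>[OF that] by (simp add: \<phi>_def)
  have ul: "uniform_limit K \<phi> g sequentially" if "compact K" "K \<subseteq> uhp" for K
    using ul1[OF that] by (simp add: \<phi>_def[abs_def] o_def)
  have hphi: "\<phi> n holomorphic_on uhp" "inj_on (\<phi> n) uhp" "\<phi> n ` uhp = epigraph (\<Gamma> n)" for n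
    using hol inj im by (auto simp: \<phi>_def \<Gamma>_def)
  have line1: "\<exists>y. (\<lambda>n. \<Gamma> n (y n)) \<longlonglongrightarrow> p + of_real \<rho> * e0" for \<rho>
  proof -
    obtain y where "(\<lambda>n. \<gamma> (r0 n) (y n)) \<longlonglongrightarrow> p + of_real \<rho> * e0" using on_line0 by blast
    from LIMSEQ_subseq_LIMSEQ[OF this r1] show ?thesis unfolding \<Gamma>_def o_def by (rule exI[of _ "\<lambda>n. y (r1 n)"])
  qed
  have line2: "\<exists>\<rho>. w = p + of_real \<rho> * e0" if "strict_mono j" "(\<lambda>n. \<Gamma> (j n) (y n)) \<longlonglongrightarrow> w" for y j w
  proof -
    have "strict_mono (\<lambda>n. r1 (j n))" using strict_mono_o[OF r1 that(1)] by (simp add: o_def)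
    then show ?thesis by (rule lim_line0) (use that(2) in \<open>simp add: \<Gamma>_def\<close>)
  qed
  have dlim: "(\<lambda>n. (deriv ^^ m) (\<phi> n) z) \<longlonglongrightarrow> (deriv ^^ m) g z" if z: "z \<in> uhp" for m z
  proof -
    obtain t where t: "t > 0" "cball z t \<subseteq> uhp" using open_contains_cball open_uhp z by blast
    have "uniform_limit (ball z t) \<phi> g sequentially"
      using uniform_limit_on_subset[OF ul[OF compact_cball t(2)] ball_subset_cball] .
    moreover have "\<forall>\<^sub>F n in sequentially. \<phi> n holomorphic_on ball z t"
    proof (intro always_eventually allI holomorphic_on_subset[OF hphi(1)])
      show "ball z t \<subseteq> uhp" using t(2) ball_subset_cball by (rule subset_trans[rotated])
    qed
    ultimately show ?thesis
      by (rule higher_deriv_complex_uniform_limit) (use t(1) in simp_all)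
  qed
  have d1: "(\<lambda>n. deriv (\<phi> n) z) \<longlonglongrightarrow> deriv g z" if "z \<in> uhp" for z using dlim[OF that, of 1] by simp
  have g1: "norm (deriv g \<i>) = 1"
    using tendsto_norm[OF d1[OF ii]] by (simp add: \<phi>_def f1 LIMSEQ_const_iff)
  have gpos: "0 \<le> Re (deriv g z)" if z: "z \<in> uhp" for z
  proof (rule LIMSEQ_le_const[OF tendsto_Re[OF d1[OF z]]])
    show "\<exists>N. \<forall>n\<ge>N. 0 \<le> Re (deriv (\<phi> n) z)" unfolding \<phi>_def using pos[OF z] less_imp_le by blast
  qed
  have d2: "(\<lambda>n. deriv (deriv (\<phi> n)) \<i>) \<longlonglongrightarrow> deriv (deriv g) \<i>"
    using dlim[OF ii, of "Suc (Suc 0)"] by simp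
  have g2: "\<delta> \<le> norm (deriv (deriv g) \<i>)"
  proof (rule LIMSEQ_le_const[OF tendsto_norm[OF d2]])
    show "\<exists>N. \<forall>n\<ge>N. \<delta> \<le> norm (deriv (deriv (\<phi> n)) \<i>)" unfolding \<phi>_def using d(2) by blast
  qed
  have nonconst: "\<not> g constant_on uhp"
  proof
    assume "g constant_on uhp"
    then obtain c where "\<And>z. z \<in> uhp \<Longrightarrow> g z = c" by (auto simp: constant_on_def)
    then have "(g has_field_derivative 0) (at \<i>)"
      by (intro has_field_derivative_transform_within_open[OF DERIV_const open_uhp ii]) auto
    then show False using g1 by (simp add: DERIV_imp_deriv)
  qed
  have conn: "connected uhp" using convex_connected[OF convex_uhp] .
  have injg: "inj_on g uhp"
    by (rule Hurwitz_injective[OF open_uhp conn hphi(1) holg ul nonconst hphi(2)])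
  \<comment> \<open>The graph points converging to the given line point are values omitted by the
    approximating maps. They vary with \<open>n\<close>, which is why the shifted limit
    \<open>uniform_limit_shift\<close> is fed to Hurwitz.\<close>
  have missline: "g z \<noteq> p + of_real \<rho> * e0" if z: "z \<in> uhp" for z \<rho>
  proof -
    obtain y where y: "(\<lambda>n. \<Gamma> n (y n)) \<longlonglongrightarrow> p + of_real \<rho> * e0" using line1 by blast
    have "g z - (p + of_real \<rho> * e0) \<noteq> 0"
    proof (rule Hurwitz_no_zeros[OF open_uhp conn, of "\<lambda>n z. \<phi> n z - \<Gamma> n (y n)" "\<lambda>z. g z - (p + of_real \<rho> * e0)"])
      show "(\<lambda>z. \<phi> n z - \<Gamma> n (y n)) holomorphic_on uhp" for n by (intro holomorphic_intros hphi)
      show "(\<lambda>z. g z - (p + of_real \<rho> * e0)) holomorphic_on uhp" by (intro holomorphic_intros holg)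
      show "uniform_limit K (\<lambda>n z. \<phi> n z - \<Gamma> n (y n)) (\<lambda>z. g z - (p + of_real \<rho> * e0)) sequentially"
        if "compact K" "K \<subseteq> uhp" for K by (rule uniform_limit_shift[OF ul[OF that] y])
      show "\<not> (\<lambda>z. g z - (p + of_real \<rho> * e0)) constant_on uhp"
        using nonconst unfolding constant_on_def by (metis diff_eq_eq)
      show "\<phi> n z - \<Gamma> n (y n) \<noteq> 0" if "z \<in> uhp" for n z
      proof -
        have "\<phi> n z \<in> epigraph (\<Gamma> n)" unfolding hphi(3)[symmetric] using that by (rule imageI)
        moreover have "\<Gamma> n (y n) \<notin> epigraph (\<Gamma> n)" using graph_not_epigraph[of "\<Gamma> n"] Rg by (simp add: \<Gamma>_def)
        ultimately show ?thesis by auto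
      qed
    qed (rule z)
    then show ?thesis by simp
  qed
  have e0c: "e0 * cnj e0 = 1" using e0 complex_norm_square[of e0] by simp
  have cline: "w = p + of_real (Re ((w - p) * cnj e0)) * e0" if "Im ((w - p) * cnj e0) = 0" for w
  proof -
    have "of_real (Re ((w - p) * cnj e0)) = (w - p) * cnj e0" using that by (simp only: complex_eq_iff Re_complex_of_real Im_complex_of_real)
    then have "of_real (Re ((w - p) * cnj e0)) * e0 = (w - p) * (e0 * cnj e0)" by (simp only: mult_ac)
    then show ?thesis using e0c by simp
  qed
  \<comment> \<open>The signed distances of the values from the line form a connected set without 0,
    so \<open>g\<close> stays on one side; \<open>e\<close> is \<open>e0\<close> with the
    orientation chosen accordingly.\<close>
  define S where "S = (\<lambda>z. Im ((g z - p) * cnj e0)) ` uhp"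
  have connS: "connected S"
    unfolding S_def by (intro connected_continuous_image conn continuous_intros holomorphic_on_imp_continuous_on holg)
  have S0: "0 \<notin> S"
  proof
    assume "0 \<in> S"
    then obtain z where z: "z \<in> uhp" "Im ((g z - p) * cnj e0) = 0" unfolding S_def by (metis (no_types, lifting) imageE)
    show False using cline[OF z(2)] missline[OF z(1)] by blast
  qed
  have Sm: "Im ((g z - p) * cnj e0) \<in> S" if "z \<in> uhp" for z unfolding S_def using that by (rule imageI)
  obtain e where e: "e = e0 \<or> e = - e0" and ge: "\<And>z. z \<in> uhp \<Longrightarrow> 0 < Im ((g z - p) * cnj e)"
  proof (cases "\<exists>a\<in>S. 0 < a")
    case True
    then obtain a where a: "a \<in> S" "0 < a" by blast
    have Sp: "0 < b" if b: "b \<in> S" for b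
    proof (rule ccontr)
      assume "\<not> 0 < b"
      then have "0 \<in> S" using connectedD_interval[OF connS b a(1), of 0] a(2) by simp
      then show False using S0 by blast
    qed
    show thesis by (rule that[of e0]) (blast, rule Sp[OF Sm])
  next
    case False
    have "b < 0" if "b \<in> S" for b
      using False that S0 by (metis linorder_neqE)
    then have "Im ((g z - p) * cnj e0) < 0" if "z \<in> uhp" for z using Sm[OF that] by blast
    moreover have "Im ((g z - p) * cnj (- e0)) = - Im ((g z - p) * cnj e0)" for z by simp
    ultimately have "0 < Im ((g z - p) * cnj (- e0))" if "z \<in> uhp" for z using that by fastforce
    then show thesis using that[of "- e0"] by blast
  qed
  have e1: "norm e = 1" using e e0 by auto
  define Hp where "Hp = {w. 0 < Im ((w - p) * cnj e)}"
  have gH: "g ` uhp \<subseteq> Hp" using ge by (auto simp: Hp_def)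
  have oH: "open Hp" unfolding Hp_def by (intro open_Collect_less continuous_intros)
  have lineH: "p + of_real \<rho> * e0 \<notin> Hp" for \<rho>
  proof -
    have "(p + of_real \<rho> * e0 - p) * cnj e0 = of_real \<rho> * (e0 * cnj e0)" by simp
    also have "\<dots> = of_real \<rho>" using e0c by simp
    finally show ?thesis using e by (auto simp: Hp_def)
  qed
  have cH: "connected Hp"
  proof -
    have "Hp = {w. Im (p * cnj e) < inner (\<i> * e) w}"
      by (auto simp: Hp_def inner_complex_def algebra_simps)
    then have "convex Hp" by (simp only: convex_halfspace_gt)
    then show ?thesis by (rule convex_connected)
  qed
  have og: "open (g ` uhp)" by (rule open_mapping_thm[OF holg open_uhp conn open_uhp subset_refl nonconst])
  have "Hp \<subseteq> g ` uhp"
  proof (rule ccontr)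
    assume "\<not> Hp \<subseteq> g ` uhp"
    then have "Hp - g ` uhp \<noteq> {}" by (simp only: Diff_eq_empty_iff not_False_eq_True)
    moreover have "g \<i> \<in> g ` uhp" using ii by (rule imageI)
    then have "Hp \<inter> g ` uhp \<noteq> {}" using gH by blast
    ultimately have "Hp \<inter> frontier (g ` uhp) \<noteq> {}" by (intro connected_Int_frontier cH)
    \<comment> \<open>A point of the half-plane on the boundary of the image turns out to be a value
      after all. A disc around it eventually misses the graphs, and a nearby value of
      \<open>\<phi> n\<close> places that disc in the epigraph. So \<open>\<phi> n\<close> takes the
      value \<open>w\<close>, at points that stay in a compact set.\<close>
    then obtain w where w: "w \<in> Hp" "w \<in> closure (g ` uhp)" "w \<notin> g ` uhp"
      unfolding frontier_def interior_open[OF og] by blast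
    obtain d' where d': "0 < d'" "cball w d' \<subseteq> Hp"
      using oH[unfolded open_contains_cball] w(1) by (elim ballE[of _ _ w]) auto
    define d where "d = d' / 2"
    have d: "0 < d" "cball w (2 * d) \<subseteq> Hp" using d' by (auto simp: d_def)
    obtain z where z: "z \<in> uhp" "dist (g z) w < d / 4"
    proof -
      have "0 < d / 4" using d(1) by simp
      then obtain u where "u \<in> g ` uhp" "dist u w < d / 4" using w(2) unfolding closure_approachable by blast
      then show thesis using that by blast
    qed
    \<comment> \<open>Otherwise infinitely many graphs meet the disc, and by \<open>line2\<close> a
      subsequential limit of the common points lies on the line.\<close>
    have avoid: "\<forall>\<^sub>F n in sequentially. cball w (2 * d) \<inter> range (\<Gamma> n) = {}"
    proof (rule ccontr)
      assume "\<not> ?thesis"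
      then have "\<exists>\<^sub>F n in sequentially. cball w (2 * d) \<inter> range (\<Gamma> n) \<noteq> {}" by (simp add: frequently_def)
      then have inf: "infinite {n. cball w (2 * d) \<inter> range (\<Gamma> n) \<noteq> {}}"
        unfolding cofinite_eq_sequentially[symmetric] frequently_cofinite .
      define j where "j = enumerate {n. cball w (2 * d) \<inter> range (\<Gamma> n) \<noteq> {}}"
      have j1: "strict_mono j" unfolding j_def by (rule strict_mono_enumerate[OF inf])
      have j2: "cball w (2 * d) \<inter> range (\<Gamma> (j n)) \<noteq> {}" for n
        using enumerate_in_set[OF inf, of n] unfolding j_def mem_Collect_eq .
      note j = j1 j2
      have "\<forall>n. \<exists>y. \<Gamma> (j n) y \<in> cball w (2 * d)" using j(2) by blast
      then obtain y where y: "\<And>n. \<Gamma> (j n) (y n) \<in> cball w (2 * d)" by metis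
      have "seq_compact (cball w (2 * d))" using compact_cball compact_eq_seq_compact_metric by blast
      then obtain l i where l: "l \<in> cball w (2 * d)" "strict_mono (i :: nat \<Rightarrow> nat)" "((\<lambda>n. \<Gamma> (j n) (y n)) \<circ> i) \<longlonglongrightarrow> l"
        using seq_compactE[of "cball w (2 * d)" "\<lambda>n. \<Gamma> (j n) (y n)"] y by blast
      have "\<exists>\<rho>. l = p + of_real \<rho> * e0"
      proof (rule line2[of "\<lambda>n. j (i n)" "\<lambda>n. y (i n)"])
        show "strict_mono (\<lambda>n. j (i n))" using strict_mono_o[OF j(1) l(2)] by (simp add: o_def)
        show "(\<lambda>n. \<Gamma> (j (i n)) (y (i n))) \<longlonglongrightarrow> l" using l(3) by (simp add: o_def)
      qed
      then show False using lineH l(1) d(2) by blast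
    qed
    have near: "\<forall>\<^sub>F n in sequentially. dist (\<phi> n z) (g z) < d / 4"
      using tendstoD[OF lim[OF z(1)], of "d / 4"] d(1) by simp
    \<comment> \<open>The closed pseudohyperbolic disc of radius 1/2 about \<open>z\<close>. It
      confines the preimages of \<open>w\<close>, because \<open>w\<close> is within
      \<open>d / 2\<close> of \<open>\<phi> n z\<close> while the disc of radius \<open>d\<close>
      about \<open>\<phi> n z\<close> lies in the image.\<close>
    define K where "K = {v. norm (v - z) \<le> norm (v - cnj z) / 2}"
    have Ku: "K \<subseteq> uhp"
    proof
      fix v assume v: "v \<in> K"
      show "v \<in> uhp"
      proof (rule ccontr)
        assume "v \<notin> uhp"
        then have "Im v * Im z \<le> 0" using z(1) by (simp add: mult_nonpos_nonneg)
        then have "(norm (v - cnj z))\<^sup>2 \<le> (norm (v - z))\<^sup>2"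
          unfolding cmod_power2 by (simp add: power2_eq_square algebra_simps)
        then have "norm (v - cnj z) \<le> norm (v - z)" by (rule power2_le_imp_le) simp
        moreover have "norm (v - z) \<le> norm (v - cnj z) / 2" using v unfolding K_def by simp
        ultimately have "norm (v - z) \<le> 0" using norm_ge_zero[of "v - z"] by linarith
        then show False using \<open>v \<notin> uhp\<close> z(1) by simp
      qed
    qed
    have "closed K" unfolding K_def by (intro closed_Collect_le continuous_intros) auto
    moreover have "bounded K"
    proof -
      have "dist z v \<le> norm (z - cnj z)" if "v \<in> K" for v
      proof -
        have "norm (v - cnj z) \<le> norm (v - z) + norm (z - cnj z)" using norm_triangle_ineq[of "v - z" "z - cnj z"] by simp
        then show ?thesis using that by (simp add: K_def dist_norm norm_minus_commute)
      qed
      then show ?thesis unfolding bounded_def by blast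
    qed
    ultimately have cK: "compact K" by (simp add: compact_eq_bounded_closed)
    have ex: "\<forall>\<^sub>F n in sequentially. \<exists>v\<in>K. \<phi> n v = w"
      using avoid near
    proof eventually_elim
      case (elim n)
      have pd: "dist (\<phi> n z) w < d / 2"
        using elim(2) z(2) dist_triangle[of "\<phi> n z" w "g z"] by simp
      have pe: "\<phi> n z \<in> epigraph (\<Gamma> n)" unfolding hphi(3)[symmetric] using z(1) by (rule imageI)
      have sub: "cball w (2 * d) \<subseteq> epigraph (\<Gamma> n)"
      proof (rule connected_subset_epigraph)
        show "continuous_on UNIV (\<Gamma> n)" "Re (\<Gamma> n x) = x" for x using cont Rg by (auto simp: \<Gamma>_def)
        have "\<phi> n z \<in> cball w (2 * d)" using pd d(1) by (simp add: dist_commute)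
        then show "cball w (2 * d) \<inter> epigraph (\<Gamma> n) \<noteq> {}" using pe by blast
        show "cball w (2 * d) \<inter> range (\<Gamma> n) = {}" by (rule elim(1))
      qed simp
      then have "w \<in> \<phi> n ` uhp" unfolding hphi(3) using d(1) by auto
      then obtain v where v: "v \<in> uhp" "\<phi> n v = w" by auto
      have "ball (\<phi> n z) d \<subseteq> \<phi> n ` uhp"
      proof -
        have "ball (\<phi> n z) d \<subseteq> cball w (2 * d)"
        proof
          fix u assume "u \<in> ball (\<phi> n z) d"
          then have "dist u (\<phi> n z) < d" by (simp add: dist_commute)
          then have "dist w u < d / 2 + d"
            using pd dist_triangle[of w u "\<phi> n z"] unfolding dist_commute[of "\<phi> n z" w] dist_commute[of "\<phi> n z" u] by linarith
          then show "u \<in> cball w (2 * d)" using d(1) by simp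
        qed
        then show ?thesis using sub unfolding hphi(3) by blast
      qed
      moreover have nd: "norm (\<phi> n v - \<phi> n z) < d / 2" using pd v(2) by (simp add: dist_norm norm_minus_commute)
      ultimately have "norm (v - z) * d \<le> norm (\<phi> n v - \<phi> n z) * norm (v - cnj z)"
        using inverse_Schwarz[OF hphi(1,2) _ d(1) z(1) v(1)] d(1) by simp
      also have "\<dots> \<le> d / 2 * norm (v - cnj z)" using nd by (intro mult_right_mono) auto
      finally have "d * norm (v - z) \<le> d * (norm (v - cnj z) / 2)" by (simp add: mult_ac)
      then have "v \<in> K" using d(1) unfolding K_def by simp
      then show ?case using v(2) by blast
    qed
    have "w \<in> closure (g ` K)"
      unfolding closure_approachable
    proof (intro allI impI)
      fix \<epsilon> :: real assume "0 < \<epsilon>"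
      then have "\<forall>\<^sub>F n in sequentially. \<forall>v\<in>K. dist (\<phi> n v) (g v) < \<epsilon>"
        using ul[OF cK Ku] by (simp add: uniform_limit_iff)
      with ex have "\<forall>\<^sub>F n in sequentially. \<exists>v\<in>K. dist (g v) w < \<epsilon>"
        by eventually_elim (metis dist_commute)
      then obtain v where "v \<in> K" "dist (g v) w < \<epsilon>" using eventually_happens trivial_limit_sequentially by blast
      then show "\<exists>u\<in>g ` K. dist u w < \<epsilon>" by blast
    qed
    moreover have "closed (g ` K)"
      by (intro compact_imp_closed compact_continuous_image continuous_on_subset[OF holomorphic_on_imp_continuous_on[OF holg] Ku] cK)
    ultimately have "w \<in> g ` K" by (simp add: closure_closed)
    then show False using w(3) Ku by blast
  qed
  then have img: "g ` uhp = {w. 0 < Im ((w - p) * cnj e)}" using gH unfolding Hp_def by blast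
  obtain k where k: "\<And>z. z \<in> uhp \<Longrightarrow> deriv g z = k"
  proof (rule half_plane_map_affine[OF holg injg e1 img])
    show "0 \<le> Re (deriv g z)" if "z \<in> uhp" for z by (rule gpos[OF that])
    show thesis if "\<And>z. z \<in> uhp \<Longrightarrow> deriv g z = k" for k by (rule \<open>\<And>k. (\<And>z. z \<in> uhp \<Longrightarrow> deriv g z = k) \<Longrightarrow> thesis\<close>[OF that])
  qed
  have "(deriv g has_field_derivative 0) (at \<i>)"
    by (rule has_field_derivative_transform_within_open[OF DERIV_const open_uhp ii]) (use k in auto)
  then have "deriv (deriv g) \<i> = 0" by (rule DERIV_imp_deriv)
  then show False using g2 d(1) by simp
qed

lemma deriv_affine_comp:
  assumes hol: "f holomorphic_on uhp" and b: "0 < b" and w: "w \<in> uhp" and a: "a \<noteq> 0"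
  shows "deriv (\<lambda>w. (f (of_real b * w + of_real x) - c) / of_real a) w
      = of_real (b / a) * deriv f (of_real b * w + of_real x)"
    and "deriv (deriv (\<lambda>w. (f (of_real b * w + of_real x) - c) / of_real a)) w
      = of_real (b\<^sup>2 / a) * deriv (deriv f) (of_real b * w + of_real x)"
proof -
  let ?l = "\<lambda>w. of_real b * w + of_real x :: complex"
  have lu: "?l v \<in> uhp" if "v \<in> uhp" for v using that b by simp
  have comp: "((\<lambda>v. g (?l v)) has_field_derivative deriv g (?l v) * of_real b) (at v)"
    if "g holomorphic_on uhp" "v \<in> uhp" for g v
  proof (rule DERIV_chain2[where f = g and g = ?l])
    show "(g has_field_derivative deriv g (?l v)) (at (?l v))"
      by (rule holomorphic_derivI[OF that(1) open_uhp lu[OF that(2)]])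
    show "(?l has_field_derivative of_real b) (at v)" by (auto intro!: derivative_eq_intros)
  qed
  have d1: "deriv (\<lambda>w. (f (?l w) - c) / of_real a) v = of_real (b / a) * deriv f (?l v)" if v: "v \<in> uhp" for v
  proof -
    have "((\<lambda>w. (f (?l w) - c) / of_real a) has_field_derivative (deriv f (?l v) * of_real b) / of_real a) (at v)"
      by (auto intro!: derivative_eq_intros comp[OF hol v] simp: a)
    then show ?thesis by (simp add: DERIV_imp_deriv)
  qed
  then show "deriv (\<lambda>w. (f (?l w) - c) / of_real a) w = of_real (b / a) * deriv f (?l w)" using w .
  have hd: "deriv f holomorphic_on uhp" by (rule holomorphic_deriv[OF hol open_uhp])
  have "((\<lambda>w. of_real (b / a) * deriv f (?l w)) has_field_derivative of_real (b / a) * (deriv (deriv f) (?l w) * of_real b)) (at w)"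
    by (rule DERIV_cmult[OF comp[OF hd w]])
  then have "(deriv (\<lambda>w. (f (?l w) - c) / of_real a) has_field_derivative of_real (b / a) * (deriv (deriv f) (?l w) * of_real b)) (at w)"
    by (rule has_field_derivative_transform_within_open[OF _ open_uhp w]) (simp add: d1)
  then show "deriv (deriv (\<lambda>w. (f (?l w) - c) / of_real a)) w = of_real (b\<^sup>2 / a) * deriv (deriv f) (?l w)"
    by (simp add: DERIV_imp_deriv power2_eq_square mult_ac)
qed

text \<open>Counterexamples with \<open>s\<close> tending to 0, each moved so that the bad point
  becomes \<open>\<i>\<close> and normalised there, contradict
  \<open>flat_graph_maps_affine_limit\<close>. The ratio of \<open>Im z * norm f''\<close> to
  \<open>norm f'\<close> is invariant under these normalisations.\<close>

lemma graph_map_bloch_small: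
  assumes d: "0 < \<delta>"
  obtains s\<^sub>0 where "0 < s\<^sub>0"
    "\<And>s \<gamma> f z. 0 < s \<Longrightarrow> s < s\<^sub>0 \<Longrightarrow> qs_curve s \<gamma> \<Longrightarrow> graph_map \<gamma> f \<Longrightarrow> z \<in> uhp \<Longrightarrow>
       Im z * norm (deriv (deriv f) z) \<le> \<delta> * norm (deriv f z)"
proof (rule ccontr)
  assume nt: "\<not> thesis"
  note goal = that
  have "\<exists>s \<gamma> f z. 0 < s \<and> s < t \<and> qs_curve s \<gamma> \<and> graph_map \<gamma> f \<and> z \<in> uhp \<and>
       \<delta> * norm (deriv f z) < Im z * norm (deriv (deriv f) z)" if "0 < t" for t
  proof (rule ccontr)
    assume "\<not> ?thesis"
    then have "thesis" by (intro goal[OF \<open>0 < t\<close>]) (meson not_le)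
    then show False using nt by blast
  qed
  \<comment> \<open>The shift by 2 keeps every \<open>s n\<close> at most 1/2.\<close>
  then have "\<forall>n::nat. \<exists>s \<gamma> f z. 0 < s \<and> s < 1 / (real n + 2) \<and> qs_curve s \<gamma> \<and> graph_map \<gamma> f \<and> z \<in> uhp \<and>
       \<delta> * norm (deriv f z) < Im z * norm (deriv (deriv f) z)" by simp
  then obtain s \<gamma> f z where S: "\<And>n::nat. 0 < s n \<and> s n < 1 / (real n + 2) \<and> qs_curve (s n) (\<gamma> n) \<and> graph_map (\<gamma> n) (f n) \<and> z n \<in> uhp \<and>
       \<delta> * norm (deriv (f n) (z n)) < Im (z n) * norm (deriv (deriv (f n)) (z n))" by metis
  have s: "0 < s n" "s n < 1 / (real n + 2)" "qs_curve (s n) (\<gamma> n)" "graph_map (\<gamma> n) (f n)" "z n \<in> uhp"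
    "\<delta> * norm (deriv (f n) (z n)) < Im (z n) * norm (deriv (deriv (f n)) (z n))" for n using S[of n] by blast+
  define b where "b n = Im (z n)" for n
  \<comment> \<open>The target scale that gives the rescaled map a derivative of modulus 1 at
    \<open>\<i>\<close>.\<close>
  define a where "a n = b n * norm (deriv (f n) (z n))" for n
  define c where "c n = f n (z n)" for n
  have b: "0 < b n" for n using s(5)[of n] by (simp add: b_def)
  have hol: "f n holomorphic_on uhp" and pos: "0 < Re (deriv (f n) (z n))" for n
    using s(4,5)[of n] unfolding graph_map_def by blast+
  have fn0: "0 < norm (deriv (f n) (z n))" for n using pos[of n] by auto
  have a: "0 < a n" for n using b fn0 by (simp add: a_def)
  define F where "F n w = (f n (of_real (b n) * w + of_real (Re (z n))) - c n) / of_real (a n)" for n w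
  define G where "G n x = (\<gamma> n (a n * x + Re (c n)) - c n) / of_real (a n)" for n x
  have zz: "of_real (b n) * \<i> + of_real (Re (z n)) = z n" for n by (simp add: b_def complex_eq_iff)
  have ii: "\<i> \<in> uhp" by simp
  have D: "deriv (F n) \<i> = of_real (b n / a n) * deriv (f n) (z n)"
    "deriv (deriv (F n)) \<i> = of_real ((b n)\<^sup>2 / a n) * deriv (deriv (f n)) (z n)" for n
    using deriv_affine_comp[OF hol[of n] b[of n] ii, where a = "a n" and x = "Re (z n)" and c = "c n"] a[of n]
    unfolding zz F_def[abs_def] by auto
  show False
  proof (rule flat_graph_maps_affine_limit[where s = s and \<gamma> = G and f = F and \<delta> = \<delta>])
    show "qs_curve (s n) (G n)" for n unfolding G_def[abs_def] by (rule qs_curve_affine[OF s(3) a])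
    show "0 < s n" for n by (rule s(1))
    show "s n \<le> 1 / 2" for n
    proof -
      have "1 / (real n + 2) \<le> 1 / 2" by (rule divide_left_mono) auto
      then show ?thesis using s(2)[of n] by linarith
    qed
    show "s \<longlonglongrightarrow> 0"
    proof (rule Lim_null_comparison)
      show "\<forall>\<^sub>F n in sequentially. norm (s n) \<le> 1 / real (Suc n)"
      proof (intro always_eventually allI)
        fix n :: nat
        have "1 / (real n + 2) \<le> 1 / real (Suc n)" by (rule divide_left_mono) auto
        then show "norm (s n) \<le> 1 / real (Suc n)" using s(1,2)[of n] by simp
      qed
      show "(\<lambda>n. 1 / real (Suc n)) \<longlonglongrightarrow> 0" using LIMSEQ_inverse_real_of_nat by (simp add: inverse_eq_divide)
    qed
    show "graph_map (G n) (F n)" for n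
      unfolding G_def[abs_def] F_def[abs_def] by (rule graph_map_affine[OF s(4) a b])
    show "F n \<i> = 0" for n unfolding F_def zz by (simp add: c_def)
    show "norm (deriv (F n) \<i>) = 1" for n
      unfolding D norm_mult norm_of_real using a[of n] b[of n] fn0[of n] by (simp add: a_def)
    show "\<delta> \<le> norm (deriv (deriv (F n)) \<i>)" for n
    proof -
      have "norm (deriv (deriv (F n)) \<i>) = (b n * norm (deriv (deriv (f n)) (z n))) / norm (deriv (f n) (z n))"
        unfolding D norm_mult norm_of_real using a[of n] b[of n] fn0[of n] by (simp add: a_def power2_eq_square)
      then show ?thesis using s(6)[of n] fn0[of n] by (simp add: b_def pos_le_divide_eq)
    qed
  qed (rule d)
qed

section \<open>Boundary values of maps with small second derivative\<close>

lemma norm_exp_minus_one_le: "norm (exp z - 1) \<le> exp (norm z) - 1" for z :: complex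
proof -
  have "norm (exp (of_real 1 * z) - exp (of_real 0 * z)) \<le> exp (1 * norm z) - exp (0 * norm z)"
  proof (rule differentiable_bound_general[where f' = "\<lambda>t. exp (of_real t * z) * z" and \<phi>' = "\<lambda>t. exp (t * norm z) * norm z"])
    fix t :: real assume t: "0 < t" "t < 1"
    have "((\<lambda>t. of_real t * z) has_vector_derivative z) (at t)"
      unfolding has_vector_derivative_def by (auto intro!: derivative_eq_intros simp: scaleR_conv_of_real)
    from field_vector_diff_chain_at[OF this DERIV_exp]
    show "((\<lambda>t. exp (of_real t * z)) has_vector_derivative exp (of_real t * z) * z) (at t)"
      by (simp add: o_def mult.commute)
    show "((\<lambda>t. exp (t * norm z)) has_vector_derivative exp (t * norm z) * norm z) (at t)"
      unfolding has_real_derivative_iff_has_vector_derivative[symmetric] by (auto intro!: derivative_eq_intros)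
    have "Re (of_real t * z) \<le> t * norm z" using complex_Re_le_cmod[of z] t by (simp add: mult_left_mono)
    then show "norm (exp (of_real t * z) * z) \<le> exp (t * norm z) * norm z"
      unfolding norm_mult by (intro mult_right_mono) (auto simp: norm_exp_eq_Re)
  qed (auto intro!: continuous_intros)
  then show ?thesis by simp
qed

text \<open>The estimate says that a logarithm of \<open>f'\<close> is Lipschitz with constant
  \<open>\<delta>\<close> in the hyperbolic metric. Hence \<open>f'\<close> is almost constant on
  horizontal segments no longer than their height, and along verticals it changes at most like the
  power \<open>\<delta>\<close> of the ratio of heights.\<close>

locale bloch_map =
  fixes f :: "complex \<Rightarrow> complex" and \<delta> :: real
  assumes hol: "f holomorphic_on uhp"
    and nz: "\<And>z. z \<in> uhp \<Longrightarrow> deriv f z \<noteq> 0"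
    and bl: "\<And>z. z \<in> uhp \<Longrightarrow> Im z * norm (deriv (deriv f) z) \<le> \<delta> * norm (deriv f z)"
    and d: "0 < \<delta>" "\<delta> \<le> 1 / 8"
begin

lemma has_deriv_second_deriv:
  assumes "z \<in> uhp"
  shows "(f has_field_derivative deriv f z) (at z)"
    "(deriv f has_field_derivative deriv (deriv f) z) (at z)"
  using holomorphic_derivI[OF hol open_uhp assms]
    holomorphic_derivI[OF holomorphic_deriv[OF hol open_uhp] open_uhp assms] by auto

text \<open>The hypothesis \<open>b\<close> is required of every function with the derivative bound,
  so that estimates along any path can be plugged in without naming the branch of the
  logarithm.\<close>

lemma deriv_ratio:
  assumes z: "z \<in> uhp" and w: "w \<in> uhp"
    and b: "\<And>L. L holomorphic_on uhp \<Longrightarrow> (\<And>v. v \<in> uhp \<Longrightarrow> norm (deriv L v) \<le> \<delta> / Im v) \<Longrightarrow> norm (L z - L w) \<le> B"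
  shows "norm (deriv f z - deriv f w) \<le> norm (deriv f w) * (exp B - 1)"
    "norm (deriv f z) \<le> norm (deriv f w) * exp B"
proof -
  obtain L where L: "L holomorphic_on uhp" "\<And>z. z \<in> uhp \<Longrightarrow> deriv f z = exp (L z)"
    by (rule contractible_imp_holomorphic_log[OF holomorphic_deriv[OF hol open_uhp] convex_imp_contractible[OF convex_uhp]])
      (rule nz, assumption, rule that, assumption, blast)
  have "norm (deriv L v) \<le> \<delta> / Im v" if v: "v \<in> uhp" for v
  proof -
    have "((\<lambda>z. exp (L z)) has_field_derivative exp (L v) * deriv L v) (at v)"
      by (rule DERIV_chain2[OF DERIV_exp holomorphic_derivI[OF L(1) open_uhp v]])
    then have "(deriv f has_field_derivative exp (L v) * deriv L v) (at v)"
      by (rule has_field_derivative_transform_within_open[OF _ open_uhp v]) (simp add: L(2))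
    then have "deriv (deriv f) v = deriv f v * deriv L v" using L(2)[OF v] by (simp add: DERIV_imp_deriv)
    then have "norm (deriv f v) * (Im v * norm (deriv L v)) \<le> norm (deriv f v) * \<delta>"
      using bl[OF v] by (simp add: norm_mult mult_ac)
    moreover have "0 < norm (deriv f v)" using nz[OF v] by simp
    ultimately have "Im v * norm (deriv L v) \<le> \<delta>" by (simp only: mult_le_cancel_left_pos)
    then show ?thesis using v by (simp add: pos_le_divide_eq mult.commute)
  qed
  then have B: "norm (L z - L w) \<le> B" by (rule b[OF L(1)])
  have e: "deriv f z = deriv f w * exp (L z - L w)" using L(2) z w by (simp add: exp_diff)
  have "norm (deriv f w * (exp (L z - L w) - 1)) \<le> norm (deriv f w) * (exp B - 1)"
    unfolding norm_mult using norm_exp_minus_one_le[of "L z - L w"] B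
    by (intro mult_left_mono) (auto intro: order_trans)
  then show "norm (deriv f z - deriv f w) \<le> norm (deriv f w) * (exp B - 1)"
    unfolding e by (simp add: algebra_simps)
  have "norm (exp (L z - L w)) \<le> exp B"
    using complex_Re_le_cmod[of "L z - L w"] B by (simp add: norm_exp_eq_Re)
  then show "norm (deriv f z) \<le> norm (deriv f w) * exp B"
    unfolding e norm_mult by (intro mult_left_mono) auto
qed

lemma log_bound_vertical:
  assumes L: "L holomorphic_on uhp" and b: "\<And>v. v \<in> uhp \<Longrightarrow> norm (deriv L v) \<le> \<delta> / Im v"
    and \<eta>: "0 < \<eta>" "\<eta> \<le> t"
  shows "norm (L (Complex x t) - L (Complex x \<eta>)) \<le> \<delta> * ln (t / \<eta>)"
proof (cases "\<eta> = t")
  case False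
  then have lt: "\<eta> < t" using \<eta> by simp
  have dv: "((\<lambda>v. L (Complex x v)) has_vector_derivative (\<i> * deriv L (Complex x v))) (at v)" if "0 < v" for v
  proof -
    have "((\<lambda>v. Complex x v) has_vector_derivative \<i>) (at v)"
      unfolding has_vector_derivative_def Complex_eq by (auto intro!: derivative_eq_intros simp: scaleR_conv_of_real)
    from field_vector_diff_chain_at[OF this, of L "deriv L (Complex x v)"]
    show ?thesis using holomorphic_derivI[OF L open_uhp, of "Complex x v"] that by (simp add: o_def)
  qed
  have "norm (L (Complex x t) - L (Complex x \<eta>)) \<le> \<delta> * ln t - \<delta> * ln \<eta>"
  proof (rule differentiable_bound_general[OF lt, where f' = "\<lambda>v. \<i> * deriv L (Complex x v)" and \<phi>' = "\<lambda>v. \<delta> / v"])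
    show "continuous_on {\<eta>..t} (\<lambda>v. L (Complex x v))"
      by (intro continuous_at_imp_continuous_on ballI has_vector_derivative_continuous[OF dv]) (use \<eta> in auto)
    show "continuous_on {\<eta>..t} (\<lambda>v. \<delta> * ln v)" using \<eta> by (intro continuous_intros) auto
    fix v assume v: "\<eta> < v" "v < t"
    then show "((\<lambda>v. L (Complex x v)) has_vector_derivative \<i> * deriv L (Complex x v)) (at v)" using dv \<eta> by simp
    show "((\<lambda>v. \<delta> * ln v) has_vector_derivative \<delta> / v) (at v)"
      unfolding has_real_derivative_iff_has_vector_derivative[symmetric]
      using v \<eta> by (auto intro!: derivative_eq_intros)
    show "norm (\<i> * deriv L (Complex x v)) \<le> \<delta> / v" using b[of "Complex x v"] v \<eta> by (simp add: norm_mult)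
  qed
  then show ?thesis using \<eta> by (simp add: ln_div algebra_simps)
qed (use \<eta> in simp)

lemma log_bound_horizontal:
  assumes L: "L holomorphic_on uhp" and b: "\<And>v. v \<in> uhp \<Longrightarrow> norm (deriv L v) \<le> \<delta> / Im v"
    and t: "0 < t"
  shows "norm (L (Complex x t) - L (Complex x' t)) \<le> \<delta> * \<bar>x - x'\<bar> / t"
proof -
  have "norm (L (Complex x t) - L (Complex x' t)) \<le> \<delta> / t * norm (Complex x t - Complex x' t)"
  proof (rule field_differentiable_bound[of "{v. t \<le> Im v}" L "deriv L"])
    show "convex {v. t \<le> Im v}" by (rule convex_halfspace_Im_ge)
    fix v assume v: "v \<in> {v. t \<le> Im v}"
    show "(L has_field_derivative deriv L v) (at v within {v. t \<le> Im v})"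
      by (rule has_field_derivative_at_within[OF holomorphic_derivI[OF L open_uhp]]) (use v t in auto)
    have "\<delta> / Im v \<le> \<delta> / t" using v t d by (intro divide_left_mono) auto
    then show "norm (deriv L v) \<le> \<delta> / t" using b[of v] v t by auto
  qed auto
  moreover have "norm (Complex x t - Complex x' t) = \<bar>x - x'\<bar>"
    unfolding complex_diff complex_norm by simp
  ultimately show ?thesis by simp
qed

lemma deriv_vertical:
  assumes "0 < \<eta>" "\<eta> \<le> t"
  shows "norm (deriv f (Complex x \<eta>) - deriv f (Complex x t)) \<le> norm (deriv f (Complex x t)) * ((t / \<eta>) powr \<delta> - 1)"
    "norm (deriv f (Complex x \<eta>)) \<le> norm (deriv f (Complex x t)) * (t / \<eta>) powr \<delta>"
    "norm (deriv f (Complex x t)) \<le> norm (deriv f (Complex x \<eta>)) * (t / \<eta>) powr \<delta>"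
proof -
  have "t / \<eta> \<noteq> 0" using assms by simp
  then have e: "(t / \<eta>) powr \<delta> = exp (\<delta> * ln (t / \<eta>))" unfolding powr_def by (rule if_not_P)
  have u: "Complex x \<eta> \<in> uhp" "Complex x t \<in> uhp" using assms by auto
  have lb: "norm (L (Complex x t) - L (Complex x \<eta>)) \<le> \<delta> * ln (t / \<eta>)"
    "norm (L (Complex x \<eta>) - L (Complex x t)) \<le> \<delta> * ln (t / \<eta>)"
    if "L holomorphic_on uhp" "\<And>v. v \<in> uhp \<Longrightarrow> norm (deriv L v) \<le> \<delta> / Im v" for L
    using log_bound_vertical[OF that assms, of x] by (simp_all add: norm_minus_commute)
  show "norm (deriv f (Complex x \<eta>) - deriv f (Complex x t)) \<le> norm (deriv f (Complex x t)) * ((t / \<eta>) powr \<delta> - 1)"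
    unfolding e by (rule deriv_ratio(1)[OF u]) (rule lb(2), assumption, blast)
  show "norm (deriv f (Complex x \<eta>)) \<le> norm (deriv f (Complex x t)) * (t / \<eta>) powr \<delta>"
    unfolding e by (rule deriv_ratio(2)[OF u]) (rule lb(2), assumption, blast)
  show "norm (deriv f (Complex x t)) \<le> norm (deriv f (Complex x \<eta>)) * (t / \<eta>) powr \<delta>"
    unfolding e by (rule deriv_ratio(2)[OF u(2,1)]) (rule lb(1), assumption, blast)
qed

lemma exp_delta_le: assumes "0 \<le> a" "a \<le> \<delta>" shows "exp a - 1 \<le> 2 * \<delta>" "exp a \<le> 2"
proof -
  have "exp a \<le> 1 + 2 * a" using exp_bound_lemma[of a] assms d by simp
  then show "exp a - 1 \<le> 2 * \<delta>" "exp a \<le> 2" using assms d by auto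
qed

lemma deriv_horizontal:
  assumes t: "0 < t" and le: "\<bar>x - x'\<bar> \<le> t"
  shows "norm (deriv f (Complex x t) - deriv f (Complex x' t)) \<le> 2 * \<delta> * norm (deriv f (Complex x' t))"
    "norm (deriv f (Complex x t)) \<le> 2 * norm (deriv f (Complex x' t))"
proof -
  let ?B = "\<delta> * \<bar>x - x'\<bar> / t"
  have u: "Complex x t \<in> uhp" "Complex x' t \<in> uhp" using assms by auto
  have B: "0 \<le> ?B" "?B \<le> \<delta>" using t le d by (auto simp: divide_le_eq)
  have lb: "norm (L (Complex x t) - L (Complex x' t)) \<le> ?B"
    if "L holomorphic_on uhp" "\<And>v. v \<in> uhp \<Longrightarrow> norm (deriv L v) \<le> \<delta> / Im v" for L
    using log_bound_horizontal[OF that t, of x x'] .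
  have "norm (deriv f (Complex x t) - deriv f (Complex x' t)) \<le> norm (deriv f (Complex x' t)) * (exp ?B - 1)"
    by (rule deriv_ratio(1)[OF u]) (rule lb, assumption, blast)
  also have "\<dots> \<le> norm (deriv f (Complex x' t)) * (2 * \<delta>)" using exp_delta_le(1)[OF B] by (intro mult_left_mono) auto
  finally show "norm (deriv f (Complex x t) - deriv f (Complex x' t)) \<le> 2 * \<delta> * norm (deriv f (Complex x' t))"
    by (simp add: mult_ac)
  have "norm (deriv f (Complex x t)) \<le> norm (deriv f (Complex x' t)) * exp ?B"
    by (rule deriv_ratio(2)[OF u]) (rule lb, assumption, blast)
  also have "\<dots> \<le> norm (deriv f (Complex x' t)) * 2" using exp_delta_le(2)[OF B] by (intro mult_left_mono) auto
  finally show "norm (deriv f (Complex x t)) \<le> 2 * norm (deriv f (Complex x' t))" by simp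
qed

lemma f_vertical_derivative:
  assumes "0 < v"
  shows "((\<lambda>v. f (Complex x v)) has_vector_derivative (\<i> * deriv f (Complex x v))) (at v)"
proof -
  have "((\<lambda>v. Complex x v) has_vector_derivative \<i>) (at v)"
    unfolding has_vector_derivative_def Complex_eq by (auto intro!: derivative_eq_intros simp: scaleR_conv_of_real)
  from field_vector_diff_chain_at[OF this, of f "deriv f (Complex x v)"]
  show ?thesis using has_deriv_second_deriv(1)[of "Complex x v"] assms by (simp add: o_def)
qed

text \<open>The deviation of the derivative is at most a multiple of
  \<open>(t / v) powr \<delta> - 1\<close>, which is integrable down to height 0; the bound is
  therefore uniform in \<open>\<eta>\<close> and passes to the boundary.\<close>

lemma f_vertical:
  assumes \<eta>: "0 < \<eta>" "\<eta> \<le> t"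
  shows "norm ((f (Complex x t) - f (Complex x \<eta>)) - \<i> * deriv f (Complex x t) * (t - \<eta>))
     \<le> 2 * \<delta> * t * norm (deriv f (Complex x t))"
proof (cases "\<eta> = t")
  case True then show ?thesis using d \<eta> by simp
next
  case False
  then have lt: "\<eta> < t" using \<eta> by simp
  define c where "c = deriv f (Complex x t)"
  define \<phi> where "\<phi> v = norm c * (t powr \<delta> * v powr (1 - \<delta>) / (1 - \<delta>) - v)" for v
  have "norm ((f (Complex x t) - \<i> * c * t) - (f (Complex x \<eta>) - \<i> * c * \<eta>)) \<le> \<phi> t - \<phi> \<eta>"
  proof (rule differentiable_bound_general[OF lt, where f' = "\<lambda>v. \<i> * (deriv f (Complex x v) - c)" and \<phi>' = "\<lambda>v. norm c * ((t / v) powr \<delta> - 1)"])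
    have fd: "((\<lambda>v. f (Complex x v) - \<i> * c * of_real v) has_vector_derivative \<i> * (deriv f (Complex x v) - c)) (at v)" if "0 < v" for v
    proof -
      have "((\<lambda>v. \<i> * c * of_real v) has_vector_derivative \<i> * c) (at v)"
        unfolding has_vector_derivative_def by (auto intro!: derivative_eq_intros simp: scaleR_conv_of_real)
      from has_vector_derivative_diff[OF f_vertical_derivative[OF that, of x] this] show ?thesis by (simp add: algebra_simps)
    qed
    show "continuous_on {\<eta>..t} (\<lambda>v. f (Complex x v) - \<i> * c * of_real v)"
      by (intro continuous_at_imp_continuous_on ballI has_vector_derivative_continuous[OF fd]) (use \<eta> in auto)
    show "continuous_on {\<eta>..t} \<phi>" unfolding \<phi>_def using \<eta> d by (intro continuous_intros) auto
    fix v assume v: "\<eta> < v" "v < t"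
    then show "((\<lambda>v. f (Complex x v) - \<i> * c * of_real v) has_vector_derivative \<i> * (deriv f (Complex x v) - c)) (at v)"
      using fd \<eta> by simp
    have "(\<phi> has_real_derivative norm c * (t powr \<delta> * ((1 - \<delta>) * v powr (1 - \<delta> - 1)) / (1 - \<delta>) - 1)) (at v)"
      unfolding \<phi>_def using v \<eta> d by (auto intro!: derivative_eq_intros)
    moreover have "t powr \<delta> * ((1 - \<delta>) * v powr (1 - \<delta> - 1)) / (1 - \<delta>) = (t / v) powr \<delta>"
      using v \<eta> d by (simp add: powr_divide powr_minus_divide)
    ultimately show "(\<phi> has_vector_derivative norm c * ((t / v) powr \<delta> - 1)) (at v)"
      by (simp add: has_real_derivative_iff_has_vector_derivative)
    show "norm (\<i> * (deriv f (Complex x v) - c)) \<le> norm c * ((t / v) powr \<delta> - 1)"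
      using deriv_vertical(1)[of v t x] v \<eta> by (simp add: norm_mult c_def)
  qed
  moreover have "0 \<le> \<phi> \<eta>"
  proof -
    have "\<eta> = \<eta> powr \<delta> * \<eta> powr (1 - \<delta>)" using \<eta> by (simp flip: powr_add)
    also have "\<dots> \<le> t powr \<delta> * \<eta> powr (1 - \<delta>)" using \<eta> d by (intro mult_right_mono powr_mono2) auto
    also have "\<dots> \<le> t powr \<delta> * \<eta> powr (1 - \<delta>) / (1 - \<delta>)"
      using d by (simp add: pos_le_divide_eq mult_left_le)
    finally show ?thesis by (simp add: \<phi>_def)
  qed
  moreover have "\<phi> t \<le> 2 * \<delta> * t * norm c"
  proof -
    have "t powr \<delta> * t powr (1 - \<delta>) = t" using \<eta> by (simp flip: powr_add)
    then have "\<phi> t = norm c * (t / (1 - \<delta>) - t)" by (simp add: \<phi>_def)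
    also have "t / (1 - \<delta>) - t \<le> 2 * \<delta> * t"
    proof -
      have "t / (1 - \<delta>) \<le> t * (1 + 2 * \<delta>)"
      proof -
        have "0 \<le> t * (\<delta> * (1 - 2 * \<delta>))" using \<eta> d by simp
        then have "t \<le> t * (1 + 2 * \<delta>) * (1 - \<delta>)" by (simp add: algebra_simps)
        then show ?thesis using d by (simp add: pos_divide_le_eq)
      qed
      then show ?thesis by (simp add: algebra_simps)
    qed
    then have "norm c * (t / (1 - \<delta>) - t) \<le> norm c * (2 * \<delta> * t)" by (intro mult_left_mono) auto
    finally show ?thesis by (simp add: mult_ac)
  qed
  ultimately show ?thesis by (simp add: c_def algebra_simps)
qed

text \<open>The horizontal increment at height \<open>\<eta>\<close> is compared with the one at
  height \<open>t\<close> through two vertical legs. The constant 10 is the sum 2 + 2 + 4 + 2 of the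
  errors of the crossing, of the two legs and of the change of the derivative between them.\<close>

lemma f_horizontal_diff:
  assumes t: "0 < \<eta>" "\<eta> \<le> t" and T: "\<bar>T\<bar> \<le> t"
  shows "norm (f (Complex (x + T) \<eta>) - f (Complex x \<eta>) - deriv f (Complex x t) * T) \<le> 10 * \<delta> * t * norm (deriv f (Complex x t))"
proof -
  define c where "c = deriv f (Complex x t)"
  define c' where "c' = deriv f (Complex (x + T) t)"
  define C where "C = norm c"
  have t0: "0 < t" using t by simp
  have cc: "norm (c' - c) \<le> 2 * \<delta> * C" unfolding c_def c'_def C_def by (rule deriv_horizontal(1)) (use T t0 in auto)
  have "norm c' \<le> C + norm (c' - c)" unfolding C_def by (rule norm_triangle_sub)
  then have c'2: "norm c' \<le> C * (1 + 2 * \<delta>)" using cc by (simp add: algebra_simps)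
  have A: "norm ((f (Complex x t) - f (Complex x \<eta>)) - \<i> * c * (t - \<eta>)) \<le> 2 * \<delta> * t * C"
    unfolding c_def C_def by (rule f_vertical[OF t])
  have "norm ((f (Complex (x + T) t) - f (Complex (x + T) \<eta>)) - \<i> * c' * (t - \<eta>)) \<le> 2 * \<delta> * t * norm c'"
    unfolding c'_def by (rule f_vertical[OF t])
  also have "\<dots> \<le> 2 * \<delta> * t * (C * (1 + 2 * \<delta>))" using c'2 d t0 by (intro mult_left_mono) auto
  also have "\<dots> \<le> 2 * \<delta> * t * (C * 2)" using d t0 by (intro mult_left_mono) (auto simp: C_def)
  finally have B: "norm ((f (Complex (x + T) t) - f (Complex (x + T) \<eta>)) - \<i> * c' * (t - \<eta>)) \<le> 4 * \<delta> * t * C" by simp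
  have D: "norm (f (Complex (x + T) t) - f (Complex x t) - c * T) \<le> 2 * \<delta> * t * C"
  proof -
    let ?S = "{v. Im v = t} \<inter> ({v. x - t \<le> Re v} \<inter> {v. Re v \<le> x + t})"
    have S: "\<exists>x'. v = Complex x' t \<and> \<bar>x' - x\<bar> \<le> t" if "v \<in> ?S" for v
      using that by (intro exI[of _ "Re v"]) (auto simp: complex_eq_iff)
    have "convex {v. Im v = t}" using convex_hyperplane[of \<i> t] by (simp add: inner_complex_def)
    then have cS: "convex ?S" by (intro convex_Int convex_halfspace_Re_ge convex_halfspace_Re_le)
    have "norm ((f (Complex (x + T) t) - c * Complex (x + T) t) - (f (Complex x t) - c * Complex x t))
        \<le> (2 * \<delta> * C) * norm (Complex (x + T) t - Complex x t)"
    proof (rule field_differentiable_bound[where S = ?S and f' = "\<lambda>v. deriv f v - c"])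
      fix v assume "v \<in> ?S"
      then obtain x' where v: "v = Complex x' t" "\<bar>x' - x\<bar> \<le> t" using S by blast
      then have "v \<in> uhp" using t0 by simp
      then show "((\<lambda>v. f v - c * v) has_field_derivative deriv f v - c) (at v within ?S)"
        by (auto intro!: derivative_eq_intros has_field_derivative_at_within[OF has_deriv_second_deriv(1)])
      show "norm (deriv f v - c) \<le> 2 * \<delta> * C"
        unfolding c_def C_def v(1) by (rule deriv_horizontal(1)[OF t0 v(2)])
    qed (use T t0 cS in auto)
    moreover have "Complex (x + T) t - Complex x t = of_real T" by (simp add: complex_eq_iff)
    ultimately have "norm ((f (Complex (x + T) t) - c * Complex (x + T) t) - (f (Complex x t) - c * Complex x t)) \<le> (2 * \<delta> * C) * \<bar>T\<bar>"
      by simp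
    also have "\<dots> \<le> (2 * \<delta> * C) * t" using T d by (intro mult_left_mono) (auto simp: C_def)
    finally have 1: "norm ((f (Complex (x + T) t) - c * Complex (x + T) t) - (f (Complex x t) - c * Complex x t)) \<le> 2 * \<delta> * t * C"
      by (simp add: mult_ac)
    have "(f (Complex (x + T) t) - c * Complex (x + T) t) - (f (Complex x t) - c * Complex x t)
       = f (Complex (x + T) t) - f (Complex x t) - c * (Complex (x + T) t - Complex x t)"
      by (simp add: right_diff_distrib)
    also have "\<dots> = f (Complex (x + T) t) - f (Complex x t) - c * of_real T"
      unfolding \<open>Complex (x + T) t - Complex x t = of_real T\<close> ..
    finally show ?thesis using 1 by (simp only:)
  qed
  have E: "norm (\<i> * (c - c') * (t - \<eta>)) \<le> 2 * \<delta> * t * C"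
  proof -
    have "norm (\<i> * (c - c') * (t - \<eta>)) = norm (c' - c) * (t - \<eta>)"
      using t by (simp add: norm_mult norm_minus_commute flip: of_real_diff)
    also have "\<dots> \<le> (2 * \<delta> * C) * t" using cc t d by (intro mult_mono) (auto simp: C_def)
    finally show ?thesis by (simp add: mult_ac)
  qed
  have eq: "f (Complex (x + T) \<eta>) - f (Complex x \<eta>) - c * T =
     (f (Complex (x + T) t) - f (Complex x t) - c * T)
     + ((f (Complex x t) - f (Complex x \<eta>)) - \<i> * c * (t - \<eta>))
     - ((f (Complex (x + T) t) - f (Complex (x + T) \<eta>)) - \<i> * c' * (t - \<eta>))
     + \<i> * (c - c') * (t - \<eta>)" by (simp add: algebra_simps)
  have tri: "norm (a + b - e + g) \<le> norm a + norm b + norm e + norm g" for a b e g :: complex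
    using norm_triangle_ineq[of "a + b - e" g] norm_triangle_ineq4[of "a + b" e] norm_triangle_ineq[of a b] by linarith
  have "norm (f (Complex (x + T) \<eta>) - f (Complex x \<eta>) - c * T) \<le> 2 * \<delta> * t * C + 2 * \<delta> * t * C + 4 * \<delta> * t * C + 2 * \<delta> * t * C"
    unfolding eq by (rule order_trans[OF tri add_mono[OF add_mono[OF add_mono[OF D A] B] E]])
  then show ?thesis by (simp add: c_def C_def)
qed

end

section \<open>Growth of the derivative and boundary values\<close>

context bloch_map
begin

text \<open>Compare with the point at height \<open>R\<close> straight above, and that one with
  \<open>Complex 0 R\<close>.\<close>

lemma deriv_bound_box:
  assumes R: "1 \<le> R"
  obtains M where "0 < M"
    "\<And>z. z \<in> uhp \<Longrightarrow> \<bar>Re z\<bar> \<le> R \<Longrightarrow> Im z \<le> R \<Longrightarrow> norm (deriv f z) \<le> M * Im z powr (- \<delta>)"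
proof
  define c where "c = norm (deriv f (Complex 0 R))"
  define M where "M = 2 * c * R powr \<delta>"
  have "0 < c" unfolding c_def using nz[of "Complex 0 R"] R by simp
  then show "0 < M" using R by (simp add: M_def)
  fix z assume z: "z \<in> uhp" "\<bar>Re z\<bar> \<le> R" "Im z \<le> R"
  have "norm (deriv f (Complex (Re z) (Im z))) \<le> norm (deriv f (Complex (Re z) R)) * (R / Im z) powr \<delta>"
    by (rule deriv_vertical(2)) (use z in auto)
  also have "\<dots> \<le> (2 * c) * (R / Im z) powr \<delta>"
    unfolding c_def by (intro mult_right_mono deriv_horizontal(2)) (use z R in auto)
  also have "(R / Im z) powr \<delta> = R powr \<delta> * Im z powr (- \<delta>)"
    using z R by (simp add: powr_divide powr_minus_divide)
  finally show "norm (deriv f z) \<le> M * Im z powr (- \<delta>)" by (simp add: M_def mult_ac)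
qed

text \<open>The path from \<open>\<i>\<close> goes up to height \<open>N\<close>, across and down
  again. Each vertical part costs \<open>N powr \<delta>\<close>, at most the eighth root of
  \<open>N\<close>; the resulting fourth root stays below the square root of the later
  majorant.\<close>

lemma deriv_growth:
  assumes z: "1 \<le> Im z" and N: "1 \<le> N" "Im z \<le> N" "\<bar>Re z\<bar> \<le> N"
  shows "norm (deriv f z) \<le> 2 * norm (deriv f \<i>) * N powr (1 / 4)"
proof -
  have i: "\<i> = Complex 0 1" by (simp add: complex_eq_iff)
  have Nd: "N powr \<delta> \<le> N powr (1 / 8)" using N d by (intro powr_mono) auto
  have a: "norm (deriv f (Complex 0 N)) \<le> norm (deriv f \<i>) * N powr (1 / 8)"
  proof -
    have "norm (deriv f (Complex 0 N)) \<le> norm (deriv f (Complex 0 1)) * (N / 1) powr \<delta>"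
      by (rule deriv_vertical(3)) (use N in auto)
    also have "\<dots> \<le> norm (deriv f (Complex 0 1)) * N powr (1 / 8)" using Nd by (intro mult_left_mono) auto
    finally show ?thesis by (simp add: i)
  qed
  have "norm (deriv f (Complex (Re z) (Im z))) \<le> norm (deriv f (Complex (Re z) N)) * (N / Im z) powr \<delta>"
    by (rule deriv_vertical(2)) (use z N in auto)
  also have "\<dots> \<le> (2 * norm (deriv f (Complex 0 N))) * N powr (1 / 8)"
  proof (rule mult_mono)
    show "norm (deriv f (Complex (Re z) N)) \<le> 2 * norm (deriv f (Complex 0 N))"
      by (rule deriv_horizontal(2)) (use N in auto)
    have "N / Im z \<le> N" using z N by (simp add: divide_le_eq mult_le_cancel_left1)
    then have "(N / Im z) powr \<delta> \<le> N powr \<delta>" using z N d by (intro powr_mono2) auto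
    then show "(N / Im z) powr \<delta> \<le> N powr (1 / 8)" using Nd by simp
  qed auto
  also have "\<dots> \<le> (2 * (norm (deriv f \<i>) * N powr (1 / 8))) * N powr (1 / 8)"
    using a by (intro mult_right_mono) auto
  also have "\<dots> = 2 * norm (deriv f \<i>) * N powr (1 / 4)" by (simp flip: powr_add)
  finally show ?thesis by simp
qed

lemma deriv_lower:
  assumes N: "1 \<le> N"
  shows "norm (deriv f \<i>) \<le> norm (deriv f (Complex 0 N)) * N powr (1 / 8)"
proof -
  have i: "\<i> = Complex 0 1" by (simp add: complex_eq_iff)
  have Nd: "N powr \<delta> \<le> N powr (1 / 8)" using N d by (intro powr_mono) auto
  have "norm (deriv f (Complex 0 1)) \<le> norm (deriv f (Complex 0 N)) * (N / 1) powr \<delta>"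
    by (rule deriv_vertical(2)) (use N in auto)
  also have "\<dots> \<le> norm (deriv f (Complex 0 N)) * N powr (1 / 8)" using Nd by (intro mult_left_mono) auto
  finally show ?thesis by (simp add: i)
qed

text \<open>A primitive of \<open>v powr (- \<delta>)\<close> is finite at 0, so the bound is
  uniform for \<open>a\<close> close to 0, also when \<open>z\<close> is real.\<close>

lemma vertical_increment:
  fixes a b :: real
  assumes M: "\<And>z. z \<in> uhp \<Longrightarrow> \<bar>Re z\<bar> \<le> R \<Longrightarrow> Im z \<le> R \<Longrightarrow> norm (deriv f z) \<le> M * Im z powr (- \<delta>)" "0 < M"
    and z: "0 \<le> Im z" "\<bar>Re z\<bar> \<le> R" "Im z + 1 \<le> R" and e: "0 < a" "a \<le> b" "b \<le> 1"
  shows "norm (f (z + \<i> * of_real b) - f (z + \<i> * of_real a)) \<le> 2 * M * b powr (1 - \<delta>)"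
proof (cases "a = b")
  case True then show ?thesis using M(2) by simp
next
  case False
  then have lt: "a < b" using e by simp
  define \<phi> where "\<phi> v = M * (v powr (1 - \<delta>) / (1 - \<delta>))" for v
  have fd: "((\<lambda>v. f (z + \<i> * of_real v)) has_vector_derivative \<i> * deriv f (z + \<i> * of_real v)) (at v)" if "0 < v" for v
  proof -
    have "((\<lambda>v. z + \<i> * of_real v) has_vector_derivative \<i>) (at v)"
      unfolding has_vector_derivative_def by (auto intro!: derivative_eq_intros simp: scaleR_conv_of_real)
    from field_vector_diff_chain_at[OF this has_deriv_second_deriv(1)]
    show ?thesis using that z by (simp add: o_def)
  qed
  have "norm (f (z + \<i> * of_real b) - f (z + \<i> * of_real a)) \<le> \<phi> b - \<phi> a"
  proof (rule differentiable_bound_general[OF lt, where f' = "\<lambda>v. \<i> * deriv f (z + \<i> * of_real v)" and \<phi>' = "\<lambda>v. M * v powr (- \<delta>)"])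
    show "continuous_on {a..b} (\<lambda>v. f (z + \<i> * of_real v))"
      by (intro continuous_at_imp_continuous_on ballI has_vector_derivative_continuous[OF fd]) (use e in auto)
    show "continuous_on {a..b} \<phi>" unfolding \<phi>_def using e d by (intro continuous_intros) auto
    fix v assume v: "a < v" "v < b"
    show "((\<lambda>v. f (z + \<i> * of_real v)) has_vector_derivative \<i> * deriv f (z + \<i> * of_real v)) (at v)"
      by (rule fd) (use v e in auto)
    have "(\<phi> has_real_derivative M * ((1 - \<delta>) * v powr (1 - \<delta> - 1) / (1 - \<delta>))) (at v)"
      unfolding \<phi>_def using v e d by (auto intro!: derivative_eq_intros)
    then show "(\<phi> has_vector_derivative M * v powr (- \<delta>)) (at v)"
      using d by (simp add: has_real_derivative_iff_has_vector_derivative)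
    have "norm (deriv f (z + \<i> * of_real v)) \<le> M * Im (z + \<i> * of_real v) powr (- \<delta>)"
      by (rule M(1)) (use z v e in auto)
    also have "\<dots> \<le> M * v powr (- \<delta>)"
      using M(2) z v e d by (intro mult_left_mono powr_mono2') auto
    finally show "norm (\<i> * deriv f (z + \<i> * of_real v)) \<le> M * v powr (- \<delta>)" by (simp add: norm_mult)
  qed
  also have "\<dots> \<le> \<phi> b" using M(2) d by (simp add: \<phi>_def)
  also have "\<dots> \<le> M * (2 * b powr (1 - \<delta>))"
  proof -
    have "b powr (1 - \<delta>) \<le> b powr (1 - \<delta>) * (2 * (1 - \<delta>))" using d by (simp add: mult_le_cancel_left1)
    then have "b powr (1 - \<delta>) \<le> 2 * b powr (1 - \<delta>) * (1 - \<delta>)" by (simp only: mult_ac)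
    then have "b powr (1 - \<delta>) / (1 - \<delta>) \<le> 2 * b powr (1 - \<delta>)" using d by (subst pos_divide_le_eq) auto
    then show ?thesis unfolding \<phi>_def using M(2) by (intro mult_left_mono) auto
  qed
  finally show ?thesis by simp
qed

text \<open>The sequence is shifted into the open half-plane even for real \<open>z\<close>, so one
  formula gives both \<open>f\<close> itself and its boundary values.\<close>

definition ext :: "complex \<Rightarrow> complex" where
  "ext z = lim (\<lambda>n. f (z + \<i> * of_real (1 / real (Suc n))))"

text \<open>The rate in the second part depends on the box only; it makes the convergence locally
  uniform and hence \<open>ext\<close> continuous.\<close>

lemma ext_converges:
  assumes z: "0 \<le> Im z" and R: "\<bar>Re z\<bar> \<le> R" "Im z + 1 \<le> R"
    and M: "\<And>z. z \<in> uhp \<Longrightarrow> \<bar>Re z\<bar> \<le> R \<Longrightarrow> Im z \<le> R \<Longrightarrow> norm (deriv f z) \<le> M * Im z powr (- \<delta>)" "0 < M"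
  shows "(\<lambda>n. f (z + \<i> * of_real (1 / real (Suc n)))) \<longlonglongrightarrow> ext z"
    and "norm (f (z + \<i> * of_real (1 / real (Suc n))) - ext z) \<le> 2 * M * (1 / real (Suc n)) powr (1 - \<delta>)"
proof -
  define e where "e n = 1 / real (Suc n)" for n
  define S where "S n = f (z + \<i> * of_real (e n))" for n
  have e: "0 < e n" "e n \<le> 1" for n by (auto simp: e_def)
  have em: "e m \<le> e n" if "n \<le> m" for m n using that unfolding e_def by (intro divide_left_mono) auto
  have el: "e \<longlonglongrightarrow> 0" unfolding e_def[abs_def] using LIMSEQ_inverse_real_of_nat by (simp add: inverse_eq_divide)
  have pl: "(\<lambda>n. 2 * M * e n powr (1 - \<delta>)) \<longlonglongrightarrow> 0"
  proof -
    have "(\<lambda>n. e n powr (1 - \<delta>)) \<longlonglongrightarrow> 0"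
      using d e by (intro tendsto_zero_powrI[OF el tendsto_const]) (auto intro!: always_eventually less_imp_le)
    from tendsto_mult_right_zero[OF this] show ?thesis .
  qed
  have inc: "norm (S n - S m) \<le> 2 * M * e n powr (1 - \<delta>)" if "n \<le> m" for m n
    unfolding S_def by (rule vertical_increment[OF M z R e(1) em[OF that] e(2)])
  have "Cauchy S"
  proof (rule CauchyI)
    fix r :: real assume r: "0 < r"
    obtain N where N: "\<And>n. N \<le> n \<Longrightarrow> norm (2 * M * e n powr (1 - \<delta>)) < r"
      using LIMSEQ_D[OF pl r] by auto
    have "norm (S m - S n) < r" if "N \<le> m" "N \<le> n" for m n
    proof (cases "m \<le> n")
      case True
      then show ?thesis using inc[OF True] N[OF that(1)] by simp
    next
      case False
      then show ?thesis using inc[of n m] N[OF that(2)] by (simp add: norm_minus_commute)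
    qed
    then show "\<exists>N. \<forall>m\<ge>N. \<forall>n\<ge>N. norm (S m - S n) < r" by blast
  qed
  then have cv: "S \<longlonglongrightarrow> ext z"
    unfolding ext_def S_def[abs_def] e_def[symmetric] by (simp add: Cauchy_convergent_iff convergent_LIMSEQ_iff)
  then show "(\<lambda>n. f (z + \<i> * of_real (1 / real (Suc n)))) \<longlonglongrightarrow> ext z"
    unfolding S_def[abs_def] e_def .
  have "norm (S n - ext z) \<le> 2 * M * e n powr (1 - \<delta>)"
  proof (rule LIMSEQ_le_const2)
    show "(\<lambda>m. norm (S n - S m)) \<longlonglongrightarrow> norm (S n - ext z)" by (intro tendsto_intros cv)
    show "\<exists>N. \<forall>m\<ge>N. norm (S n - S m) \<le> 2 * M * e n powr (1 - \<delta>)" using inc by blast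
  qed
  then show "norm (f (z + \<i> * of_real (1 / real (Suc n))) - ext z) \<le> 2 * M * (1 / real (Suc n)) powr (1 - \<delta>)"
    unfolding S_def e_def .
qed

lemma ext_lim:
  assumes "0 \<le> Im z" shows "(\<lambda>n. f (z + \<i> * of_real (1 / real (Suc n)))) \<longlonglongrightarrow> ext z"
proof -
  define R where "R = \<bar>Re z\<bar> + Im z + 1"
  obtain M where "0 < M" "\<And>z. z \<in> uhp \<Longrightarrow> \<bar>Re z\<bar> \<le> R \<Longrightarrow> Im z \<le> R \<Longrightarrow> norm (deriv f z) \<le> M * Im z powr (- \<delta>)"
    using deriv_bound_box[of R] assms by (auto simp: R_def)
  then show ?thesis by (intro ext_converges(1)[of z R M]) (use assms in \<open>auto simp: R_def\<close>)
qed

lemma ext_eq: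
  assumes z: "z \<in> uhp" shows "ext z = f z"
proof -
  have "(\<lambda>n. z + \<i> * of_real (1 / real (Suc n))) \<longlonglongrightarrow> z + \<i> * of_real 0"
    by (intro tendsto_intros) (use LIMSEQ_inverse_real_of_nat in \<open>simp add: inverse_eq_divide\<close>)
  then have "(\<lambda>n. f (z + \<i> * of_real (1 / real (Suc n)))) \<longlonglongrightarrow> f z"
    by (intro isCont_tendsto_compose[OF DERIV_isCont[OF has_deriv_second_deriv(1)[OF z]]]) simp
  then show ?thesis using ext_lim[of z] z LIMSEQ_unique by fastforce
qed

lemma ext_continuous: "continuous_on {z. 0 \<le> Im z} ext"
proof -
  let ?H = "{z. 0 \<le> Im z}"
  have loc: "continuous_on (?H \<inter> ball z0 1) ext" for z0
  proof -
    define R where "R = norm z0 + 2"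
    obtain M where M: "0 < M" "\<And>z. z \<in> uhp \<Longrightarrow> \<bar>Re z\<bar> \<le> R \<Longrightarrow> Im z \<le> R \<Longrightarrow> norm (deriv f z) \<le> M * Im z powr (- \<delta>)"
      using deriv_bound_box[of R] by (auto simp: R_def)
    have inR: "\<bar>Re z\<bar> \<le> R" "Im z + 1 \<le> R" if "z \<in> ball z0 1" for z
    proof -
      have "norm z \<le> norm z0 + 1" using that norm_triangle_sub[of z z0] by (simp add: dist_norm norm_minus_commute)
      then show "\<bar>Re z\<bar> \<le> R" "Im z + 1 \<le> R"
        using abs_Re_le_cmod[of z] abs_Im_le_cmod[of z] by (auto simp: R_def)
    qed
    have pl: "(\<lambda>n. 2 * M * (1 / real (Suc n)) powr (1 - \<delta>)) \<longlonglongrightarrow> 0"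
    proof -
      have "(\<lambda>n. 1 / real (Suc n)) \<longlonglongrightarrow> 0" using LIMSEQ_inverse_real_of_nat by (simp add: inverse_eq_divide)
      then have "(\<lambda>n. (1 / real (Suc n)) powr (1 - \<delta>)) \<longlonglongrightarrow> 0"
        using d by (intro tendsto_zero_powrI[OF _ tendsto_const]) (auto intro!: always_eventually)
      from tendsto_mult_right_zero[OF this] show ?thesis .
    qed
    show ?thesis
    proof (rule uniform_limit_theorem[where F = sequentially and f = "\<lambda>n z. f (z + \<i> * of_real (1 / real (Suc n)))"])
      show "\<forall>\<^sub>F n in sequentially. continuous_on (?H \<inter> ball z0 1) (\<lambda>z. f (z + \<i> * of_real (1 / real (Suc n))))"
        by (intro always_eventually allI continuous_on_compose2[OF holomorphic_on_imp_continuous_on[OF hol]] continuous_intros)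
          (auto intro!: add_nonneg_pos)
      show "uniform_limit (?H \<inter> ball z0 1) (\<lambda>n z. f (z + \<i> * of_real (1 / real (Suc n)))) ext sequentially"
      proof (rule uniform_limitI)
        fix r :: real assume r: "0 < r"
        have "\<forall>\<^sub>F n in sequentially. 2 * M * (1 / real (Suc n)) powr (1 - \<delta>) < r"
          using order_tendstoD(2)[OF pl r] .
        then show "\<forall>\<^sub>F n in sequentially. \<forall>z\<in>?H \<inter> ball z0 1. dist (f (z + \<i> * of_real (1 / real (Suc n)))) (ext z) < r"
        proof eventually_elim
          case (elim n)
          show ?case
          proof
            fix z assume z: "z \<in> ?H \<inter> ball z0 1"
            then have z1: "0 \<le> Im z" "z \<in> ball z0 1" by blast+
            show "dist (f (z + \<i> * of_real (1 / real (Suc n)))) (ext z) < r"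
              using ext_converges(2)[OF z1(1) inR[OF z1(2)] M(2,1), of n] elim unfolding dist_norm by linarith
          qed
        qed
      qed
    qed simp
  qed
  show ?thesis
    unfolding continuous_on_eq_continuous_within
  proof
    fix z assume z: "z \<in> ?H"
    have "continuous (at z within ?H \<inter> ball z 1) ext"
      using loc[of z] z unfolding continuous_on_eq_continuous_within by simp
    moreover have "at z within ?H \<inter> ball z 1 = at z within ?H"
      by (rule at_within_nhd[of z "ball z 1"]) auto
    ultimately show "continuous (at z within ?H) ext" by (simp only:)
  qed
qed

lemma ext_horizontal_diff:
  assumes t: "0 < t" and T: "\<bar>T\<bar> \<le> t"
  shows "norm (ext (of_real (x + T)) - ext (of_real x) - deriv f (Complex x t) * T) \<le> 10 * \<delta> * t * norm (deriv f (Complex x t))"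
proof (rule LIMSEQ_le_const2)
  let ?e = "\<lambda>n. 1 / real (Suc n)"
  show "(\<lambda>n. norm (f (of_real (x + T) + \<i> * of_real (?e n)) - f (of_real x + \<i> * of_real (?e n)) - deriv f (Complex x t) * T))
     \<longlonglongrightarrow> norm (ext (of_real (x + T)) - ext (of_real x) - deriv f (Complex x t) * T)"
    by (intro tendsto_intros ext_lim) auto
  obtain N where N: "1 / real (Suc N) < t" using t by (metis nat_approx_posE)
  have "norm (f (of_real (x + T) + \<i> * of_real (?e n)) - f (of_real x + \<i> * of_real (?e n)) - deriv f (Complex x t) * T)
      \<le> 10 * \<delta> * t * norm (deriv f (Complex x t))" if "N \<le> n" for n
  proof -
    have "?e n \<le> ?e N" using that by (intro divide_left_mono) auto
    then have "?e n \<le> t" using N by linarith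
    from f_horizontal_diff[OF _ this T, of x] show ?thesis by (simp add: Complex_eq add.commute)
  qed
  then show "\<exists>N. \<forall>n\<ge>N. norm (f (of_real (x + T) + \<i> * of_real (?e n)) - f (of_real x + \<i> * of_real (?e n)) - deriv f (Complex x t) * T)
      \<le> 10 * \<delta> * t * norm (deriv f (Complex x t))" by blast
qed

end

section \<open>Near linearity on the real line\<close>

text \<open>The bound 1/20 makes the error factor \<open>10 * \<delta>\<close> of
  \<open>ext_horizontal_diff\<close> at most 1/2, so boundary increments cannot collapse.\<close>

locale graph_bloch = bloch_map +
  fixes \<gamma> :: "real \<Rightarrow> complex" and s :: real
  assumes gm: "graph_map \<gamma> f" and q: "qs_curve s \<gamma>" and s0: "0 < s" and d20: "\<delta> \<le> 1 / 20"
begin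

definition u :: "real \<Rightarrow> real" where "u x = Re (ext (of_real x))"

text \<open>Boundary values lie in the closure of the epigraph. They are not inside it, because the
  continuous inverse would then carry the approaching points to a point of the open half-plane,
  while they converge to \<open>x\<close>.\<close>

lemma ext_graph: "ext (of_real x) = \<gamma> (u x)"
proof -
  let ?E = "ext (of_real x)" and ?z = "\<lambda>n. of_real x + \<i> * of_real (1 / real (Suc n)) :: complex"
  have inj: "inj_on f uhp" and im: "f ` uhp = epigraph \<gamma>" using gm by (auto simp: graph_map_def)
  have c: "continuous_on UNIV \<gamma>" by (rule qs_curve_continuous[OF q])
  have zu: "?z n \<in> uhp" for n by simp
  have l: "(\<lambda>n. f (?z n)) \<longlonglongrightarrow> ?E" by (rule ext_lim) simp
  have fe: "f (?z n) \<in> epigraph \<gamma>" for n unfolding im[symmetric] using zu by (rule imageI)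
  have cl: "?E \<in> closure (epigraph \<gamma>)" unfolding closure_sequential
    by (rule exI[of _ "\<lambda>n. f (?z n)"]) (use l fe in blast)
  have "?E \<notin> epigraph \<gamma>"
  proof
    assume E: "?E \<in> epigraph \<gamma>"
    obtain h where h: "h holomorphic_on f ` uhp" "\<And>z. z \<in> uhp \<Longrightarrow> h (f z) = z"
      by (rule holomorphic_has_inverse[OF hol open_uhp inj]) (rule that)
    have "continuous_on (epigraph \<gamma>) h" using holomorphic_on_imp_continuous_on[OF h(1)] unfolding im .
    then have "(\<lambda>n. h (f (?z n))) \<longlonglongrightarrow> h ?E"
      by (rule continuous_on_tendsto_compose[OF _ l E]) (intro always_eventually allI fe)
    then have "(\<lambda>n. ?z n) \<longlonglongrightarrow> h ?E" unfolding h(2)[OF zu] .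
    moreover have "(\<lambda>n. ?z n) \<longlonglongrightarrow> of_real x + \<i> * of_real 0"
      by (intro tendsto_intros) (use LIMSEQ_inverse_real_of_nat in \<open>simp add: inverse_eq_divide\<close>)
    ultimately have hE: "h ?E = of_real x" using LIMSEQ_unique by fastforce
    have "?E \<in> f ` uhp" using E unfolding im .
    then obtain w where "w \<in> uhp" "?E = f w" by (elim imageE)
    then show False using hE h(2)[of w] by simp
  qed
  then have "?E \<in> range \<gamma>" using epigraph_frontier[OF c qs_curve_Re[OF q]] cl by blast
  then obtain y where y: "?E = \<gamma> y" by blast
  then have "u x = y" using q by (simp add: u_def)
  then show ?thesis using y by simp
qed

lemma Re_f_mono:
  assumes "x \<le> x'" "0 < \<eta>" shows "Re (f (Complex x \<eta>)) \<le> Re (f (Complex x' \<eta>))"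
proof (rule DERIV_nonneg_imp_nondecreasing[OF assms(1)])
  fix v :: real
  have "((\<lambda>v. Complex v \<eta>) has_vector_derivative 1) (at v)"
    unfolding has_vector_derivative_def Complex_eq by (auto intro!: derivative_eq_intros simp: scaleR_conv_of_real)
  from field_vector_diff_chain_at[OF this has_deriv_second_deriv(1)]
  have "((\<lambda>v. f (Complex v \<eta>)) has_vector_derivative deriv f (Complex v \<eta>)) (at v)"
    using assms(2) by (simp add: o_def)
  from bounded_linear.has_vector_derivative[OF bounded_linear_Re this]
  have "((\<lambda>v. Re (f (Complex v \<eta>))) has_real_derivative Re (deriv f (Complex v \<eta>))) (at v)"
    by (simp add: has_real_derivative_iff_has_vector_derivative)
  moreover have "0 < Re (deriv f (Complex v \<eta>))" using gm assms(2) by (simp add: graph_map_def)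
  ultimately show "\<exists>y. ((\<lambda>v. Re (f (Complex v \<eta>))) has_real_derivative y) (at v) \<and> 0 \<le> y" by (auto intro: less_imp_le)
qed

lemma u_mono: assumes "x \<le> x'" shows "u x \<le> u x'"
  unfolding u_def
proof (rule LIMSEQ_le)
  show "(\<lambda>n. Re (f (of_real x + \<i> * of_real (1 / real (Suc n))))) \<longlonglongrightarrow> Re (ext (of_real x))"
    by (intro tendsto_intros ext_lim) simp
  show "(\<lambda>n. Re (f (of_real x' + \<i> * of_real (1 / real (Suc n))))) \<longlonglongrightarrow> Re (ext (of_real x'))"
    by (intro tendsto_intros ext_lim) simp
  show "\<exists>N. \<forall>n\<ge>N. Re (f (of_real x + \<i> * of_real (1 / real (Suc n)))) \<le> Re (f (of_real x' + \<i> * of_real (1 / real (Suc n))))"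
    unfolding Complex_eq[symmetric] using Re_f_mono[OF assms] by (intro exI[of _ 0] allI impI) simp
qed

lemma ext_diff_lower:
  assumes "0 < t" "\<bar>T\<bar> = t"
  shows "t / 2 * norm (deriv f (Complex x t)) \<le> norm (ext (of_real (x + T)) - ext (of_real x))"
proof -
  let ?c = "deriv f (Complex x t)"
  have "norm (ext (of_real (x + T)) - ext (of_real x) - ?c * T) \<le> 10 * \<delta> * t * norm ?c"
    by (rule ext_horizontal_diff) (use assms in auto)
  moreover have "10 * \<delta> * t * norm ?c \<le> t / 2 * norm ?c"
    using d20 assms by (intro mult_right_mono) auto
  moreover have "norm (?c * T) = t * norm ?c" using assms by (simp add: norm_mult)
  moreover have "norm (?c * T) \<le> norm (ext (of_real (x + T)) - ext (of_real x)) + norm (ext (of_real (x + T)) - ext (of_real x) - ?c * T)"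
    by (metis norm_minus_commute norm_triangle_sub)
  ultimately show ?thesis by linarith
qed

lemma ext_inj: assumes "x \<noteq> x'" shows "u x \<noteq> u x'" "0 < norm (ext (of_real x') - ext (of_real x))"
proof -
  have "0 < \<bar>x' - x\<bar> / 2 * norm (deriv f (Complex x \<bar>x' - x\<bar>))"
    using assms nz[of "Complex x \<bar>x' - x\<bar>"] by simp
  also have "\<dots> \<le> norm (ext (of_real (x + (x' - x))) - ext (of_real x))"
    by (rule ext_diff_lower) (use assms in auto)
  finally show 1: "0 < norm (ext (of_real x') - ext (of_real x))" by simp
  show "u x \<noteq> u x'" using 1 by (auto simp: ext_graph)
qed

lemma u_strict: assumes "x < x'" shows "u x < u x'"
  using u_mono[of x x'] ext_inj(1)[of x x'] assms by simp

lemma u_continuous: "continuous_on UNIV u"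
  unfolding u_def by (intro continuous_intros continuous_on_compose2[OF ext_continuous]) auto

text \<open>Up the imaginary axis \<open>f'\<close> decays at most like the power -1/8, so the
  increment over the distance \<open>T\<close>, at least a fixed multiple of \<open>T\<close> times
  \<open>f'\<close> at height \<open>T\<close>, is unbounded. The sign \<open>e\<close> selects the
  ray.\<close>

lemma ext_unbounded:
  assumes e: "\<bar>e\<bar> = 1" obtains T where "0 < T" "K < norm (ext (of_real (e * T)) - ext 0)"
proof -
  define c where "c = norm (deriv f \<i>)"
  have c: "0 < c" using nz[of \<i>] by (simp add: c_def)
  define X where "X = max 1 (2 * \<bar>K\<bar> / c + 1)"
  have X: "1 \<le> X" "\<bar>K\<bar> < c * X / 2" using c by (auto simp: X_def max_def field_simps)
  define T where "T = X^2"
  have T: "1 \<le> T" using X by (simp add: T_def)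
  have "c \<le> norm (deriv f (Complex 0 T)) * T powr (1 / 8)" unfolding c_def by (rule deriv_lower[OF T])
  then have 1: "c * X \<le> norm (deriv f (Complex 0 T)) * T powr (1 / 8) * X" using X by (intro mult_right_mono) auto
  have "T powr (1 / 8) * X \<le> T powr (1 / 2) * T powr (1 / 2)"
  proof (rule mult_mono)
    show "T powr (1 / 8) \<le> T powr (1 / 2)" using T by (intro powr_mono) auto
    show "X \<le> T powr (1 / 2)" using X by (simp add: T_def powr_half_sqrt)
  qed (use X in auto)
  also have "\<dots> = T" using T by (simp flip: powr_add)
  finally have "norm (deriv f (Complex 0 T)) * (T powr (1 / 8) * X) \<le> norm (deriv f (Complex 0 T)) * T"
    by (intro mult_left_mono) auto
  then have "c * X \<le> T * norm (deriv f (Complex 0 T))" using 1 by (simp add: mult_ac)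
  then have "\<bar>K\<bar> < T / 2 * norm (deriv f (Complex 0 T))" using X(2) by simp
  also have "\<dots> \<le> norm (ext (of_real (0 + e * T)) - ext (of_real 0))"
    by (rule ext_diff_lower) (use T e in \<open>auto simp: abs_mult\<close>)
  finally show thesis using that[of T] T by simp
qed

text \<open>A bounded \<open>u\<close> would keep the image of the ray in a compact arc of the
  graph.\<close>

lemma u_unbounded:
  assumes e: "\<bar>e\<bar> = 1" obtains T where "0 < T" "B < \<bar>u (e * T) - u 0\<bar>"
proof (rule ccontr)
  assume nt: "\<not> thesis"
  have b: "\<bar>u (e * T) - u 0\<bar> \<le> B" if "0 < T" for T using nt \<open>\<And>T. 0 < T \<Longrightarrow> B < \<bar>u (e * T) - u 0\<bar> \<Longrightarrow> thesis\<close> that by force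
  have "compact (\<gamma> ` {u 0 - B..u 0 + B})"
    by (intro compact_continuous_image qs_curve_continuous[OF q]) simp
  then obtain K where K: "\<And>w. w \<in> \<gamma> ` {u 0 - B..u 0 + B} \<Longrightarrow> norm w \<le> K"
    using compact_imp_bounded bounded_iff by metis
  obtain T where T: "0 < T" "K + norm (ext 0) < norm (ext (of_real (e * T)) - ext 0)" using ext_unbounded[OF e] by blast
  have "\<gamma> (u (e * T)) \<in> \<gamma> ` {u 0 - B..u 0 + B}" using b[OF T(1)] by (intro imageI) auto
  then have "norm (ext (of_real (e * T))) \<le> K" using K ext_graph by metis
  then show False using T(2) norm_triangle_ineq4[of "ext (of_real (e * T))" "ext 0"] by linarith
qed

lemma u_surj: "surj u"
proof -
  have "\<exists>x. u x = y" for y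
  proof -
    obtain T where T: "0 < T" "\<bar>y - u 0\<bar> < \<bar>u (1 * T) - u 0\<bar>" using u_unbounded[of 1] by auto
    obtain S where S: "0 < S" "\<bar>y - u 0\<bar> < \<bar>u (-1 * S) - u 0\<bar>" using u_unbounded[of "-1"] by auto
    have "u (- S) \<le> y" using S u_mono[of "- S" 0] by simp
    moreover have "y \<le> u T" using T u_mono[of 0 T] by simp
    ultimately show ?thesis
      using IVT'[of u "- S" y T] S(1) T(1) continuous_on_subset[OF u_continuous] by auto
  qed
  then show ?thesis by (metis surjI)
qed

lemma ext_real_image: "ext ` \<real> = range \<gamma>"
proof -
  have "ext ` \<real> = range (\<lambda>x. ext (of_real x))" unfolding Reals_def by (simp add: image_image)
  also have "\<dots> = \<gamma> ` range u" by (simp add: ext_graph image_image)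
  finally show ?thesis using u_surj by simp
qed

text \<open>In units of \<open>c * y\<close> the chords of the graph are within
  \<open>\<epsilon>\<close> of \<open>\<bar>T\<bar> / y\<close>, by
  \<open>ext_horizontal_diff\<close> at height \<open>R * y\<close>. Quasisymmetry turns ratios of
  chords from a common point into ratios of increments of \<open>u\<close>, from above and from
  below, and the error is measured by \<open>u (x + y) - u x\<close> itself.\<close>

lemma near_linear:
  assumes R: "2 \<le> R" and \<epsilon>: "10 * \<delta> * R \<le> \<epsilon>" "s \<le> \<epsilon>" "6 * R^2 * \<epsilon> \<le> \<omega>" "\<omega> \<le> 1" and y: "0 < y" and T: "\<bar>T\<bar> \<le> R * y"
  shows "\<bar>u (x + T) - u x - (u (x + y) - u x) * (T / y)\<bar> \<le> \<omega> * (u (x + y) - u x)"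
proof (cases "T = 0")
  case True
  then show ?thesis using u_strict[of x "x + y"] y \<epsilon> s0 R
    by (auto intro!: mult_nonneg_nonneg order_trans[OF _ \<epsilon>(3)])
next
  case False
  define c where "c = norm (deriv f (Complex x (R * y)))"
  have t: "0 < R * y" using R y by simp
  have c: "0 < c" unfolding c_def using nz[of "Complex x (R * y)"] t by simp
  have e0: "0 < \<epsilon>" using \<epsilon>(2) s0 by linarith
  have eR2: "6 * R^2 * \<epsilon> \<le> 1" using \<epsilon> by linarith
  have R4: "2 * R \<le> R^2" using R by (simp add: power2_eq_square)
  have eR: "12 * (R * \<epsilon>) \<le> 6 * R^2 * \<epsilon>" using mult_right_mono[OF R4, of "6 * \<epsilon>"] e0 by (simp add: mult_ac)
  have e1: "2 * \<epsilon> \<le> R * \<epsilon>" using R e0 by simp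
  define D where "D = u (x + y) - u x"
  have D: "0 < D" using u_strict[of x "x + y"] y by (simp add: D_def)
  \<comment> \<open>\<open>d1\<close> and \<open>D1\<close> are normalised chord lengths, close to 1
    and to \<open>p\<close>; \<open>U\<close> is the normalised increment of \<open>u\<close>, to be
    compared with \<open>p\<close>.\<close>
  define d1 where "d1 = norm (ext (of_real (x + y)) - ext (of_real x)) / (c * y)"
  define D1 where "D1 = norm (ext (of_real (x + T)) - ext (of_real x)) / (c * y)"
  define p where "p = \<bar>T\<bar> / y"
  define U where "U = \<bar>u (x + T) - u x\<bar> / D"
  have p: "0 \<le> p" "p \<le> R" using T y by (auto simp: p_def divide_le_eq)
  have gen: "\<bar>norm (ext (of_real (x + V)) - ext (of_real x)) / (c * y) - \<bar>V\<bar> / y\<bar> \<le> \<epsilon>" if V: "\<bar>V\<bar> \<le> R * y" for V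
  proof -
    let ?c = "deriv f (Complex x (R * y))"
    have "norm (ext (of_real (x + V)) - ext (of_real x) - ?c * V) \<le> 10 * \<delta> * (R * y) * c"
      unfolding c_def by (rule ext_horizontal_diff[OF t V])
    also have "\<dots> = (10 * \<delta> * R) * (y * c)" by simp
    also have "\<dots> \<le> \<epsilon> * (y * c)" using \<epsilon>(1) y c by (intro mult_right_mono) auto
    finally have "norm (ext (of_real (x + V)) - ext (of_real x) - ?c * V) \<le> \<epsilon> * (y * c)" .
    then have "\<bar>norm (ext (of_real (x + V)) - ext (of_real x)) - norm (?c * V)\<bar> \<le> \<epsilon> * (y * c)"
      using norm_triangle_ineq3[of "ext (of_real (x + V)) - ext (of_real x)" "?c * V"] by linarith
    then have "\<bar>norm (ext (of_real (x + V)) - ext (of_real x)) - c * \<bar>V\<bar>\<bar> \<le> \<epsilon> * (c * y)"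
      by (simp add: norm_mult c_def mult_ac)
    then have "\<bar>norm (ext (of_real (x + V)) - ext (of_real x)) - c * \<bar>V\<bar>\<bar> / (c * y) \<le> \<epsilon>"
      using c y by (simp add: pos_divide_le_eq)
    moreover have "\<bar>norm (ext (of_real (x + V)) - ext (of_real x)) - c * \<bar>V\<bar>\<bar> / (c * y)
       = \<bar>norm (ext (of_real (x + V)) - ext (of_real x)) / (c * y) - \<bar>V\<bar> / y\<bar>"
    proof -
      have "norm (ext (of_real (x + V)) - ext (of_real x)) / (c * y) - \<bar>V\<bar> / y
        = (norm (ext (of_real (x + V)) - ext (of_real x)) - c * \<bar>V\<bar>) / (c * y)"
        using c y by (simp add: diff_divide_distrib)
      moreover have "\<bar>a / (c * y)\<bar> = \<bar>a\<bar> / (c * y)" for a using c y by (simp add: abs_divide)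
      ultimately show ?thesis by (simp only:)
    qed
    ultimately show ?thesis by (simp only:)
  qed
  have d1: "\<bar>d1 - 1\<bar> \<le> \<epsilon>"
  proof -
    have "\<bar>y\<bar> \<le> R * y" using y R by simp
    from gen[OF this] show ?thesis using y by (simp add: d1_def)
  qed
  have D1: "\<bar>D1 - p\<bar> \<le> \<epsilon>" using gen[OF T] by (simp add: D1_def p_def)
  have d1p: "0 < d1" using ext_inj(2)[of x "x + y"] c y by (simp add: d1_def)
  have D1p: "0 < D1" using ext_inj(2)[of x "x + T"] c y False by (simp add: D1_def)
  have n1: "norm (ext (of_real (x + y)) - ext (of_real x)) = d1 * (c * y)"
    and n2: "norm (ext (of_real (x + T)) - ext (of_real x)) = D1 * (c * y)" using c y by (auto simp: d1_def D1_def)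
  have g1: "norm (\<gamma> (u x) - \<gamma> (u (x + y))) = d1 * (c * y)" "norm (\<gamma> (u x) - \<gamma> (u (x + T))) = D1 * (c * y)"
    using n1 n2 by (simp_all only: ext_graph norm_minus_commute)
  have cy: "0 < c * y" using c y by simp
  have DU: "\<bar>u x - u (x + T)\<bar> = D * U" using D by (simp add: U_def abs_minus_commute)
  have Dy: "\<bar>u x - u (x + y)\<bar> = D" using D by (simp add: D_def)
  have sD1: "s * D1 \<le> \<epsilon> * (R + 1)"
  proof (rule mult_mono)
    have "\<epsilon> \<le> 1" using e1 eR eR2 e0 by linarith
    then show "D1 \<le> R + 1" using D1 p by linarith
  qed (use D1p \<epsilon>(2) e0 in auto)
  have eR1: "\<epsilon> * (R + 1) = R * \<epsilon> + \<epsilon>" by (simp add: algebra_simps)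
  \<comment> \<open>Quasisymmetry with the chord for \<open>T\<close> over the chord for
    \<open>y\<close>; the lower bound further down exchanges the two.\<close>
  have up: "U * d1 \<le> D1 + s * d1"
  proof -
    have "s * norm (\<gamma> (u x) - \<gamma> (u (x + T))) \<le> norm (\<gamma> (u x) - \<gamma> (u (x + y)))"
    proof -
      have "s * D1 \<le> d1" using sD1 d1 eR eR2 e1 eR1 by linarith
      then have "s * D1 * (c * y) \<le> d1 * (c * y)" using cy by (intro mult_right_mono) auto
      then show ?thesis unfolding g1 by (simp add: mult.assoc)
    qed
    from qs_curve_ratio[OF q ext_inj(1) this] y
    have "D * U * (d1 * (c * y)) \<le> (D1 * (c * y) + s * (d1 * (c * y))) * D"
      unfolding g1 DU Dy by simp
    also have "\<dots> = (D1 + s * d1) * (D * (c * y))" by (simp add: algebra_simps)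
    also have "D * U * (d1 * (c * y)) = (U * d1) * (D * (c * y))" by (simp add: mult_ac)
    finally show ?thesis using mult_pos_pos[OF D cy] by (simp only: mult_le_cancel_right_pos)
  qed
  have eps1: "24 * \<epsilon> \<le> 1" "0 < \<epsilon>" using e1 eR eR2 e0 by linarith+
  have U0: "0 \<le> U" using D by (simp add: U_def)
  have main: "\<bar>U - p\<bar> \<le> \<omega>"
  proof -
    have "U \<le> p + \<omega>"
    proof (rule ccontr)
      assume "\<not> U \<le> p + \<omega>"
      then have gt: "p + 6 * R^2 * \<epsilon> \<le> U" using \<epsilon>(3) by linarith
      have "(p + 6 * R^2 * \<epsilon>) * (1 - \<epsilon>) \<le> U * d1"
        using gt d1 U0 eps1 by (intro mult_mono; linarith)
      also have "\<dots> \<le> (p + \<epsilon>) + s * d1" using up D1 by linarith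
      also have "s * d1 \<le> \<epsilon> * 2" using d1 \<epsilon>(2) s0 eps1 d1p by (intro mult_mono; linarith)
      finally have 1: "(p + 6 * R^2 * \<epsilon>) * (1 - \<epsilon>) \<le> p + 3 * \<epsilon>" by linarith
      have "(p + 6 * R^2 * \<epsilon>) * (1 - \<epsilon>) = p + 6 * R^2 * \<epsilon> - \<epsilon> * p - \<epsilon> * (6 * R^2 * \<epsilon>)" by (simp add: algebra_simps)
      moreover have "\<epsilon> * p \<le> R * \<epsilon>" using p e0 by (simp add: mult.commute)
      moreover have "\<epsilon> * (6 * R^2 * \<epsilon>) \<le> \<epsilon> * 1" using eR2 e0 by (intro mult_left_mono) auto
      ultimately have "6 * R^2 * \<epsilon> \<le> R * \<epsilon> + 4 * \<epsilon>" using 1 by linarith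
      then show False using eR e1 e0 by linarith
    qed
    moreover have "p - \<omega> \<le> U"
    \<comment> \<open>When the chord for \<open>T\<close> is too short for the quasisymmetry
      condition, \<open>p\<close> itself is at most \<open>3 * \<epsilon>\<close> and the lower
      bound is trivial.\<close>
    proof (cases "s * d1 \<le> D1")
      case False
      moreover have "s * d1 \<le> \<epsilon> * 2" using d1 \<epsilon>(2) s0 eps1 d1p by (intro mult_mono; linarith)
      ultimately have "D1 \<le> \<epsilon> * 2" by linarith
      then show ?thesis using D1 U0 \<epsilon>(3) eR e1 e0 by linarith
    next
      case True
      have "s * norm (\<gamma> (u x) - \<gamma> (u (x + y))) \<le> norm (\<gamma> (u x) - \<gamma> (u (x + T)))"
      proof -
        have "s * d1 * (c * y) \<le> D1 * (c * y)" using True cy by (intro mult_right_mono) auto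
        then show ?thesis unfolding g1 by (simp add: mult.assoc)
      qed
      from qs_curve_ratio[OF q ext_inj(1) this] False
      have "D * (D1 * (c * y)) \<le> (d1 * (c * y) + s * (D1 * (c * y))) * (D * U)"
        unfolding g1 DU Dy by simp
      also have "\<dots> = ((d1 + s * D1) * U) * (D * (c * y))" by (simp add: algebra_simps)
      also have "D * (D1 * (c * y)) = D1 * (D * (c * y))" by (simp add: mult_ac)
      finally have lo: "D1 \<le> (d1 + s * D1) * U" using mult_pos_pos[OF D cy] by (simp only: mult_le_cancel_right_pos)
      show ?thesis
      proof (rule ccontr)
        assume "\<not> p - \<omega> \<le> U"
        then have lt: "U \<le> p - 6 * R^2 * \<epsilon>" using \<epsilon>(3) by linarith
        \<comment> \<open>The error \<open>s * D1\<close> may reach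
          \<open>\<epsilon> * (R + 1)\<close> and multiplies a quantity of size up to
          \<open>R\<close>; this product is the origin of \<open>R^2\<close> in the hypothesis on
          \<open>\<omega>\<close>.\<close>
        have "(d1 + s * D1) * U \<le> (1 + \<epsilon> + \<epsilon> * (R + 1)) * (p - 6 * R^2 * \<epsilon>)"
        proof (rule mult_mono)
          show "d1 + s * D1 \<le> 1 + \<epsilon> + \<epsilon> * (R + 1)" using d1 sD1 by linarith
          show "0 \<le> 1 + \<epsilon> + \<epsilon> * (R + 1)" using e0 R by simp
        qed (use lt U0 in auto)
        then have B1: "p - \<epsilon> \<le> (1 + \<epsilon> + \<epsilon> * (R + 1)) * (p - 6 * R^2 * \<epsilon>)" using lo D1 by linarith
        have B2: "(1 + \<epsilon> + \<epsilon> * (R + 1)) * (p - 6 * R^2 * \<epsilon>) = (p - 6 * R^2 * \<epsilon>) + (R * \<epsilon> + 2 * \<epsilon>) * (p - 6 * R^2 * \<epsilon>)" by (simp add: algebra_simps)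
        have B3: "(R * \<epsilon> + 2 * \<epsilon>) * (p - 6 * R^2 * \<epsilon>) \<le> (R * \<epsilon> + R * \<epsilon>) * R"
        proof (rule mult_mono)
          show "R * \<epsilon> + 2 * \<epsilon> \<le> R * \<epsilon> + R * \<epsilon>" using e1 by linarith
          have "0 < 6 * R^2 * \<epsilon>" using eR e1 e0 by linarith
          then show "p - 6 * R^2 * \<epsilon> \<le> R" using p by linarith
          show "0 \<le> R * \<epsilon> + R * \<epsilon>" using e1 e0 by linarith
          show "0 \<le> p - 6 * R^2 * \<epsilon>" using lt U0 by linarith
        qed
        have "(R * \<epsilon> + R * \<epsilon>) * R = 2 * (R^2 * \<epsilon>)" by (simp add: power2_eq_square algebra_simps)
        moreover have "6 * R^2 * \<epsilon> = 6 * (R^2 * \<epsilon>)" by simp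
        ultimately show False using B1 B2 B3 eR e1 e0 by linarith
      qed
    qed
    ultimately show ?thesis by linarith
  qed
  \<comment> \<open>Monotonicity of \<open>u\<close> gives its increment the sign of
    \<open>T\<close>, so the estimate for absolute values becomes one for signed values.\<close>
  have "\<bar>u (x + T) - u x - D * (T / y)\<bar> = D * \<bar>U - p\<bar>"
  proof (cases "0 < T")
    case True
    then have "u (x + T) - u x = D * U" "D * (T / y) = D * p"
      using u_strict[of x "x + T"] D by (auto simp: U_def p_def)
    then have "u (x + T) - u x - D * (T / y) = D * (U - p)" by (simp only: right_diff_distrib)
    then show ?thesis using D by (simp add: abs_mult)
  next
    case F: False
    then have "u (x + T) - u x = - (D * U)" "D * (T / y) = - (D * p)"
      using u_strict[of "x + T" x] D False by (auto simp: U_def p_def)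
    then have "u (x + T) - u x - D * (T / y) = - (D * (U - p))" by (simp only: right_diff_distrib)
    then show ?thesis using D by (simp add: abs_mult)
  qed
  also have "\<dots> \<le> \<omega> * D" using main D mult_left_mono[of "\<bar>U - p\<bar>" \<omega> D] by (simp add: mult.commute)
  finally show ?thesis by (simp add: D_def)
qed

end

text \<open>\<open>R\<close> is the range of ratios \<open>T / y\<close> under control,
  \<open>\<epsilon>\<close> bounds both the chord error and \<open>s\<close>, and
  \<open>\<omega>\<close> is the resulting relative error of \<open>u\<close>. The bound 1/10 serves
  the fourth root growth in \<open>increment_growth\<close>.\<close>

locale graph_flat = graph_bloch +
  fixes R \<epsilon> \<omega> :: real
  assumes R: "2 \<le> R" and eps: "10 * \<delta> * R \<le> \<epsilon>" "s \<le> \<epsilon>" "6 * R^2 * \<epsilon> \<le> \<omega>" and w10: "\<omega> \<le> 1 / 10"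
begin

lemma omega_pos: "0 < \<omega>"
proof -
  have "0 < \<epsilon>" using eps(2) s0 by linarith
  then have "0 < 6 * R^2 * \<epsilon>" using R by simp
  then show ?thesis using eps(3) by linarith
qed

lemma flat:
  assumes "0 < y" "\<bar>T\<bar> \<le> R * y"
  shows "\<bar>u (x + T) - u x - (u (x + y) - u x) * (T / y)\<bar> \<le> \<omega> * (u (x + y) - u x)"
  by (rule near_linear[OF R eps]) (use w10 assms in auto)

text \<open>The cases \<open>T = 2 * t\<close> and \<open>T = - t\<close> of
  \<open>flat\<close>.\<close>

lemma doubling:
  assumes t: "0 < t"
  shows "u (x + 2 * t) - u x \<le> (2 + \<omega>) * (u (x + t) - u x)"
    "(2 - \<omega>) * (u (x + t) - u x) \<le> u (x + 2 * t) - u x"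
    "u x - u (x - t) \<le> (1 + \<omega>) * (u (x + t) - u x)"
proof -
  have 1: "\<bar>u (x + 2 * t) - u x - (u (x + t) - u x) * (2 * t / t)\<bar> \<le> \<omega> * (u (x + t) - u x)"
    by (rule flat[OF t]) (use t R in auto)
  have e: "2 * t / t = 2" "- t / t = -1" using t by auto
  show "u (x + 2 * t) - u x \<le> (2 + \<omega>) * (u (x + t) - u x)"
    "(2 - \<omega>) * (u (x + t) - u x) \<le> u (x + 2 * t) - u x"
    using 1 unfolding e by (auto simp: algebra_simps)
  have "\<bar>u (x + - t) - u x - (u (x + t) - u x) * (- t / t)\<bar> \<le> \<omega> * (u (x + t) - u x)"
    by (rule flat[OF t]) (use t R in auto)
  then show "u x - u (x - t) \<le> (1 + \<omega>) * (u (x + t) - u x)"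
    unfolding e by (auto simp: algebra_simps)
qed

text \<open>Iterated doubling, from 0 and from \<open>t\<close>, up to intervals of length about
  \<open>2 ^ j\<close> loses a factor of order \<open>((2 + \<omega>) / (2 - \<omega>)) ^ j\<close>.
  The fourth power of this quotient is at most 2 per step, so unit increments grow at most like the
  fourth root of \<open>\<bar>t\<bar>\<close>; fourth powers avoid real exponents.\<close>

lemma increment_growth:
  assumes t: "1 \<le> \<bar>t\<bar>"
  shows "(u (t + 1) - u t) ^ 4 \<le> 512 * \<bar>t\<bar> * (u 1 - u 0) ^ 4"
proof -
  define D where "D = u 1 - u 0"
  define X where "X = u (t + 1) - u t"
  have D: "0 < D" and X: "0 < X" using u_strict by (auto simp: D_def X_def)
  have a: "u (2 ^ j) - u 0 \<le> (2 + \<omega>) ^ j * D" for j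
  proof (induction j)
    case (Suc j)
    have "u (2 ^ Suc j) - u 0 \<le> (2 + \<omega>) * (u (2 ^ j) - u 0)" using doubling(1)[of "2 ^ j" 0] by simp
    also have "\<dots> \<le> (2 + \<omega>) * ((2 + \<omega>) ^ j * D)" using Suc omega_pos by (intro mult_left_mono) auto
    finally show ?case by simp
  qed (simp add: D_def)
  have b: "u 0 - u (- (2 ^ j)) \<le> (1 + \<omega>) * ((2 + \<omega>) ^ j * D)" for j
  proof -
    have "u 0 - u (- (2 ^ j)) \<le> (1 + \<omega>) * (u (2 ^ j) - u 0)" using doubling(3)[of "2 ^ j" 0] by simp
    also have "\<dots> \<le> (1 + \<omega>) * ((2 + \<omega>) ^ j * D)" using a omega_pos by (intro mult_left_mono) auto
    finally show ?thesis .
  qed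
  have c: "(2 - \<omega>) ^ j * X \<le> u (t + 2 ^ j) - u t" for j
  proof (induction j)
    case (Suc j)
    have "(2 - \<omega>) ^ Suc j * X = (2 - \<omega>) * ((2 - \<omega>) ^ j * X)" by simp
    also have "\<dots> \<le> (2 - \<omega>) * (u (t + 2 ^ j) - u t)" using Suc w10 by (intro mult_left_mono) auto
    also have "\<dots> \<le> u (t + 2 ^ Suc j) - u t" using doubling(2)[of "2 ^ j" t] by simp
    finally show ?case .
  qed (simp add: X_def)
  obtain m :: nat where "\<bar>t\<bar> < 2 ^ m" using real_arch_pow[of 2 "\<bar>t\<bar>"] by auto
  then have ex: "\<exists>m. \<bar>t\<bar> \<le> 2 ^ m" by (auto intro: less_imp_le)
  \<comment> \<open>The least such power of 2 lies between \<open>\<bar>t\<bar>\<close> and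
    \<open>2 * \<bar>t\<bar>\<close>, so it can be traded for \<open>\<bar>t\<bar>\<close>; the
    factor 2 turns 256 into 512.\<close>
  define j where "j = (LEAST m. \<bar>t\<bar> \<le> 2 ^ m)"
  have j1: "\<bar>t\<bar> \<le> 2 ^ j" unfolding j_def by (rule LeastI_ex[OF ex])
  have j2: "2 ^ j \<le> 2 * \<bar>t\<bar>"
  proof (cases j)
    case 0 then show ?thesis using t by simp
  next
    case (Suc i)
    have "\<not> \<bar>t\<bar> \<le> 2 ^ i" using not_less_Least[of i "\<lambda>m. \<bar>t\<bar> \<le> 2 ^ m"] Suc by (simp add: j_def)
    then show ?thesis using Suc by simp
  qed
  have "(2 - \<omega>) ^ j * X \<le> u (t + 2 ^ j) - u t" by (rule c)
  \<comment> \<open>The interval from \<open>t\<close> to \<open>t + 2 ^ j\<close> sits inside the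
    one from \<open>- (2 ^ j)\<close> to \<open>2 ^ Suc j\<close>, on which the doubling from 0 is
    available.\<close>
  also have "\<dots> \<le> u (2 ^ Suc j) - u (- (2 ^ j))"
  proof -
    have "t \<le> 2 ^ j" "- (2 ^ j) \<le> t" using j1 by linarith+
    then show ?thesis using u_mono[of "t + 2 ^ j" "2 ^ Suc j"] u_mono[of "- (2 ^ j)" t] by simp
  qed
  also have "\<dots> \<le> (2 + \<omega>) ^ Suc j * D + (1 + \<omega>) * ((2 + \<omega>) ^ j * D)" using a[of "Suc j"] b[of j] by linarith
  also have "\<dots> = ((2 + \<omega>) + (1 + \<omega>)) * ((2 + \<omega>) ^ j * D)" by (simp add: algebra_simps)
  also have "\<dots> \<le> 4 * ((2 + \<omega>) ^ j * D)" using w10 D omega_pos by (intro mult_right_mono) auto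
  finally have f: "(2 - \<omega>) ^ j * X \<le> 4 * ((2 + \<omega>) ^ j * D)" .
  have "((2 - \<omega>) ^ j * X) ^ 4 \<le> (4 * ((2 + \<omega>) ^ j * D)) ^ 4" using f X w10 by (intro power_mono) auto
  then have g: "((2 - \<omega>) ^ 4) ^ j * X ^ 4 \<le> 256 * (((2 + \<omega>) ^ 4) ^ j * D ^ 4)"
    by (simp add: power_mult_distrib power_mult[symmetric] mult.commute[of j])
  have "((2 + \<omega>) ^ 4) \<le> 2 * (2 - \<omega>) ^ 4"
  proof -
    have "(2 + \<omega>) ^ 4 \<le> (2 + 1/10) ^ 4" using w10 omega_pos by (intro power_mono) auto
    also have "\<dots> \<le> 2 * (2 - 1/10 :: real) ^ 4" by (simp add: power4_eq_xxxx)
    also have "\<dots> \<le> 2 * (2 - \<omega>) ^ 4" using w10 omega_pos by (intro mult_left_mono power_mono) auto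
    finally show ?thesis .
  qed
  then have "((2 + \<omega>) ^ 4) ^ j \<le> (2 * (2 - \<omega>) ^ 4) ^ j" using omega_pos by (intro power_mono) auto
  then have "256 * (((2 + \<omega>) ^ 4) ^ j * D ^ 4) \<le> 256 * ((2 ^ j * ((2 - \<omega>) ^ 4) ^ j) * D ^ 4)"
    using D by (intro mult_left_mono mult_right_mono) (auto simp: power_mult_distrib)
  with g have "((2 - \<omega>) ^ 4) ^ j * X ^ 4 \<le> ((2 - \<omega>) ^ 4) ^ j * (256 * 2 ^ j * D ^ 4)" by (simp add: mult_ac)
  moreover have "0 < ((2 - \<omega>) ^ 4) ^ j" using w10 by simp
  ultimately have "X ^ 4 \<le> 256 * 2 ^ j * D ^ 4" by (simp only: mult_le_cancel_left_pos)
  also have "\<dots> \<le> 512 * \<bar>t\<bar> * D ^ 4" using j2 D by (intro mult_right_mono) auto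
  finally show ?thesis by (simp add: X_def D_def)
qed

text \<open>For \<open>\<bar>t\<bar> + 1 \<le> R\<close> two applications of \<open>flat\<close>
  from 0 suffice. Beyond that linearity is lost, but the increments, of fourth root size, are below
  \<open>\<kappa>\<close> times the square root as soon as \<open>\<bar>t\<bar>\<close> reaches
  \<open>512 / \<kappa> ^ 4\<close>; this determines \<open>R\<close>.\<close>

lemma increment_near_linear:
  assumes \<kappa>: "0 < \<kappa>" "\<kappa> \<le> 1" "2 * \<omega> \<le> \<kappa>" "512 / \<kappa> ^ 4 + 1 \<le> R" and h: "0 < h" "h \<le> 1"
  shows "\<bar>u (t + h) - u t - h * (u 1 - u 0)\<bar> \<le> \<kappa> * (u 1 - u 0) * sqrt (1 + \<bar>t\<bar>)"
proof -
  define D where "D = u 1 - u 0"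
  have D: "0 < D" using u_strict by (auto simp: D_def)
  have "\<bar>u (t + h) - u t - h * D\<bar> \<le> \<kappa> * D * sqrt (1 + \<bar>t\<bar>)"
  proof (cases "\<bar>t\<bar> + 1 \<le> R")
    case True
    have f1: "\<bar>u (0 + (t + h)) - u 0 - (u (0 + 1) - u 0) * ((t + h) / 1)\<bar> \<le> \<omega> * (u (0 + 1) - u 0)"
      by (rule flat) (use True h in auto)
    have f2: "\<bar>u (0 + t) - u 0 - (u (0 + 1) - u 0) * (t / 1)\<bar> \<le> \<omega> * (u (0 + 1) - u 0)"
      by (rule flat) (use True h in auto)
    have "\<bar>u (t + h) - u t - h * D\<bar> \<le> 2 * \<omega> * D"
      using f1 f2 by (auto simp: D_def algebra_simps abs_le_iff)
    also have "\<dots> \<le> \<kappa> * D * 1" using \<kappa>(3) D by simp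
    also have "\<dots> \<le> \<kappa> * D * sqrt (1 + \<bar>t\<bar>)" using \<kappa> D by (intro mult_left_mono) auto
    finally show ?thesis .
  next
    case False
    then have tR: "512 / \<kappa> ^ 4 \<le> \<bar>t\<bar>" using \<kappa>(4) by simp
    have "1 \<le> 512 / \<kappa> ^ 4" using \<kappa>(1,2) power_le_one[of \<kappa> 4] by (simp add: pos_le_divide_eq)
    then have t1: "1 \<le> \<bar>t\<bar>" using tR by simp
    define Q where "Q = \<kappa> * D * sqrt (1 + \<bar>t\<bar>)"
    have Q0: "0 \<le> Q" using \<kappa> D by (simp add: Q_def)
    have k4: "512 \<le> \<kappa> ^ 4 * \<bar>t\<bar>" using tR \<kappa>(1) by (simp add: pos_divide_le_eq mult.commute)
    have Q4: "Q ^ 4 = \<kappa> ^ 4 * (1 + \<bar>t\<bar>)^2 * D ^ 4"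
    proof -
      have "x ^ 4 = (x ^ 2) ^ 2" for x :: real by (simp add: power4_eq_xxxx power2_eq_square mult_ac)
      from this[of "sqrt (1 + \<bar>t\<bar>)"] have "sqrt (1 + \<bar>t\<bar>) ^ 4 = (1 + \<bar>t\<bar>) ^ 2" by simp
      then show ?thesis by (simp add: Q_def power_mult_distrib)
    qed
    have big: "512 * \<bar>t\<bar> * D ^ 4 \<le> Q ^ 4"
    proof -
      have "512 * \<bar>t\<bar> \<le> \<kappa> ^ 4 * \<bar>t\<bar> * \<bar>t\<bar>" using k4 by (intro mult_right_mono) auto
      also have "\<dots> = \<kappa> ^ 4 * (\<bar>t\<bar>)^2" by (simp only: power2_eq_square mult.assoc)
      also have "\<dots> \<le> \<kappa> ^ 4 * (1 + \<bar>t\<bar>)^2" using \<kappa> by (intro mult_left_mono power_mono) auto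
      finally show ?thesis unfolding Q4 using D by (intro mult_right_mono) auto
    qed
    have "(u (t + 1) - u t) ^ 4 \<le> Q ^ 4" using increment_growth[OF t1] big by (simp add: D_def)
    \<comment> \<open>The rule is about the exponent \<open>Suc n\<close>, so 3 stands for the
      fourth power here.\<close>
    then have X: "u (t + 1) - u t \<le> Q" using Q0 by (rule power_le_imp_le_base[of _ 3, simplified])
    have "D ^ 4 \<le> 512 * \<bar>t\<bar> * D ^ 4" using t1 D by (simp add: mult_le_cancel_right1)
    then have "D ^ 4 \<le> Q ^ 4" using big by linarith
    then have DQ: "D \<le> Q" using Q0 by (rule power_le_imp_le_base[of _ 3, simplified])
    have "0 \<le> u (t + h) - u t" "u (t + h) - u t \<le> u (t + 1) - u t" using u_mono h by auto
    moreover have "0 \<le> h * D" "h * D \<le> D" using h D by auto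
    ultimately have "\<bar>u (t + h) - u t - h * D\<bar> \<le> Q" using X DQ by linarith
    then show ?thesis by (simp add: Q_def)
  qed
  then show ?thesis by (simp add: D_def)
qed

end

section \<open>The maximum principle estimate\<close>

text \<open>\<open>1 - \<i> * z\<close> has real part at least 1 and modulus at least
  \<open>norm z\<close>, and the real part of \<open>csqrt\<close> is explicit in these two. This is
  the majorant of square root growth on the whole closed half-plane.\<close>

lemma Re_csqrt_ge:
  assumes "0 \<le> Im z" shows "sqrt ((1 + norm z) / 2) \<le> Re (csqrt (1 - \<i> * z))"
proof -
  have "(norm z)\<^sup>2 \<le> (norm (1 - \<i> * z))\<^sup>2"
    using assms unfolding cmod_power2 by (simp add: power2_eq_square algebra_simps)
  then have "norm z \<le> norm (1 - \<i> * z)" by (rule power2_le_imp_le) simp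
  moreover have "1 \<le> Re (1 - \<i> * z)" using assms by simp
  ultimately have "(1 + norm z) / 2 \<le> (norm (1 - \<i> * z) + Re (1 - \<i> * z)) / 2" by simp
  then show ?thesis by (simp only: csqrt.sel real_sqrt_le_mono)
qed

context graph_flat
begin

text \<open>Above height 1 integrate \<open>deriv_growth\<close>; below it compare with the
  derivative at height 1, where the horizontal error is at most the modulus of that
  derivative.\<close>

lemma increment_growth_complex:
  assumes z: "0 \<le> Im z" and h: "0 < h" "h \<le> 1"
  shows "norm (ext (z + of_real h) - ext z) \<le> 4 * norm (deriv f \<i>) * (norm z + 1) powr (1 / 4)"
proof -
  define c where "c = norm (deriv f \<i>)"
  define N where "N = norm z + 1"
  have N: "1 \<le> N" "\<bar>Re z\<bar> + 1 \<le> N" "\<bar>Im z\<bar> + 1 \<le> N" using abs_Re_le_cmod[of z] abs_Im_le_cmod[of z] by (auto simp: N_def)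
  have zz: "z = Complex (Re z) (Im z)" "z + of_real h = Complex (Re z + h) (Im z)" by (auto simp: complex_eq_iff)
  have "norm (ext (z + of_real h) - ext z) \<le> 4 * c * N powr (1 / 4)"
  proof (cases "1 \<le> Im z")
    case True
    let ?S = "{v. Im v = Im z} \<inter> ({v. Re z \<le> Re v} \<inter> {v. Re v \<le> Re z + h})"
    have "convex {v. Im v = Im z}" using convex_hyperplane[of \<i> "Im z"] by (simp add: inner_complex_def)
    then have cS: "convex ?S" by (intro convex_Int convex_halfspace_Re_ge convex_halfspace_Re_le)
    have "norm (f (z + of_real h) - f z) \<le> (2 * c * N powr (1 / 4)) * norm ((z + of_real h) - z)"
    proof (rule field_differentiable_bound[OF cS, where f' = "deriv f"])
      fix v assume v: "v \<in> ?S"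
      show "(f has_field_derivative deriv f v) (at v within ?S)"
        by (rule has_field_derivative_at_within[OF has_deriv_second_deriv(1)]) (use v True in auto)
      show "norm (deriv f v) \<le> 2 * c * N powr (1 / 4)"
        unfolding c_def by (rule deriv_growth) (use v True N h in auto)
    qed (use h in auto)
    also have "\<dots> \<le> (2 * c * N powr (1 / 4)) * 2" using h by (intro mult_left_mono) (auto simp: c_def)
    finally show ?thesis using True by (simp add: ext_eq)
  next
    case False
    let ?c = "deriv f (Complex (Re z) 1)"
    have c1: "norm ?c \<le> 2 * c * N powr (1 / 4)" unfolding c_def by (rule deriv_growth) (use N in auto)
    have "norm (ext (z + of_real h) - ext z - ?c * h) \<le> 10 * \<delta> * 1 * norm ?c"
    proof (cases "Im z = 0")
      case True
      then have "z = of_real (Re z)" "z + of_real h = of_real (Re z + h)" by (auto simp: complex_eq_iff)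
      then show ?thesis using ext_horizontal_diff[of 1 h "Re z"] h by simp
    next
      case F: False
      then have "0 < Im z" using z by simp
      then show ?thesis using f_horizontal_diff[of "Im z" 1 h "Re z"] h False
        by (simp add: ext_eq flip: zz)
    qed
    also have "\<dots> \<le> 1 * norm ?c" using d20 by (intro mult_right_mono) auto
    finally have "norm (ext (z + of_real h) - ext z - ?c * h) \<le> norm ?c" by simp
    moreover have "norm (?c * h) \<le> norm ?c" using h by (simp add: norm_mult mult_left_le)
    moreover have "norm (ext (z + of_real h) - ext z) \<le> norm (?c * h) + norm (ext (z + of_real h) - ext z - ?c * h)"
      by (rule norm_triangle_sub)
    ultimately show ?thesis using c1 by linarith
  qed
  then show ?thesis by (simp add: c_def N_def)
qed

text \<open>The majorant dominates the increment on the real line because of its square root growth; on large half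
  circles it does because the increments of \<open>ext\<close> grow only like the fourth root.\<close>
lemma increment_majorant:
  assumes \<kappa>: "0 < \<kappa>" "\<kappa> \<le> 1" "2 * \<omega> \<le> \<kappa>" "512 / \<kappa> ^ 4 + 1 \<le> R" and h: "0 < h" "h \<le> 1" and z: "z \<in> uhp"
    and \<sigma>: "\<sigma> = 1 \<or> \<sigma> = (-1 :: real)"
  shows "\<sigma> * (Re (f (z + of_real h) - f z) - h * (u 1 - u 0)) \<le> 2 * \<kappa> * (u 1 - u 0) * Re (csqrt (1 - \<i> * z))"
proof -
  define D where "D = u 1 - u 0"
  have D: "0 < D" using u_strict by (auto simp: D_def)
  define c where "c = norm (deriv f \<i>)"
  have c: "0 \<le> c" by (simp add: c_def)
  \<comment> \<open>With \<open>r + 1 = X ^ 4\<close> the fourth root on the half circle is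
    \<open>X\<close> and the square root is \<open>X ^ 2\<close>. The second entry makes
    \<open>(4 * c + D) * X\<close> at most \<open>\<kappa> * D * X ^ 2\<close>, the third puts
    \<open>z\<close> inside.\<close>
  define X where "X = max 1 (max ((4 * c + D) / (\<kappa> * D)) (norm z + 2))"
  have X: "1 \<le> X" "(4 * c + D) / (\<kappa> * D) \<le> X" "norm z + 2 \<le> X" by (auto simp: X_def)
  define r where "r = X ^ 4 - 1"
  have "X \<le> X ^ 4" using X(1) self_le_power[of X 4] by simp
  then have zr: "norm z < r" using X by (simp add: r_def)
  have "(X ^ 4) powr (1 / 4) = (X powr 4) powr (1 / 4)" using X by simp
  also have "\<dots> = X powr (4 * (1 / 4))" by (rule powr_powr)
  finally have Xr: "(r + 1) powr (1 / 4) = X" using X by (simp add: r_def)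
  have Xr2: "sqrt (r + 1) = X ^ 2"
    using X by (simp add: r_def real_sqrt_unique flip: power_mult)
  \<comment> \<open>A holomorphic function whose real part is the difference to be bounded;
    \<open>\<sigma>\<close> treats both signs at once.\<close>
  define A where "A \<zeta> = of_real \<sigma> * (ext (\<zeta> + of_real h) - ext \<zeta> - of_real (h * D)) - of_real (2 * \<kappa> * D) * csqrt (1 - \<i> * \<zeta>)" for \<zeta>
  have ReA: "Re (A \<zeta>) = \<sigma> * (Re (ext (\<zeta> + of_real h) - ext \<zeta>) - h * D) - 2 * \<kappa> * D * Re (csqrt (1 - \<i> * \<zeta>))" for \<zeta>
    by (simp add: A_def)
  have abs: "\<sigma> * v \<le> \<bar>v\<bar>" for v using \<sigma> by auto
  have sq: "sqrt (1 + norm \<zeta>) \<le> 2 * Re (csqrt (1 - \<i> * \<zeta>))" if "0 \<le> Im \<zeta>" for \<zeta>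
  proof -
    have "sqrt (1 + norm \<zeta>) \<le> 2 * sqrt ((1 + norm \<zeta>) / 2)"
      by (rule power2_le_imp_le) (auto simp: power_mult_distrib)
    then show ?thesis using Re_csqrt_ge[OF that] by linarith
  qed
  let ?S = "uhp \<inter> ball 0 r"
  have oS: "open ?S" using open_uhp by blast
  have clS: "closure ?S \<subseteq> {\<zeta>. 0 \<le> Im \<zeta>} \<inter> cball 0 r"
    by (rule closure_minimal) (auto intro!: closed_Int closed_halfspace_Im_ge)
  have "Re (A z) \<le> 0"
  proof (rule maximum_real_frontier[of A ?S])
    have nn: "1 - \<i> * \<zeta> \<notin> \<real>\<^sub>\<le>\<^sub>0" if "0 \<le> Im \<zeta>" for \<zeta> using that by (auto simp: complex_nonpos_Reals_iff)
    have holext: "ext holomorphic_on uhp" by (rule holomorphic_transform[OF hol]) (simp add: ext_eq)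
    have "(\<lambda>\<zeta>. ext (\<zeta> + of_real h)) holomorphic_on uhp"
      by (rule holomorphic_on_compose_gen[OF _ holext, unfolded o_def]) (auto intro!: holomorphic_intros)
    then have "A holomorphic_on uhp" unfolding A_def
      by (intro holomorphic_intros holext) (use nn in auto)
    then show "A holomorphic_on interior ?S" using interior_open[OF oS] by (auto intro: holomorphic_on_subset)
    have "continuous_on {\<zeta>. 0 \<le> Im \<zeta>} (\<lambda>\<zeta>. ext (\<zeta> + of_real h))"
      by (rule continuous_on_compose2[OF ext_continuous]) (auto intro!: continuous_intros)
    moreover have "(\<lambda>\<zeta>. csqrt (1 - \<i> * \<zeta>)) holomorphic_on {\<zeta>. 0 \<le> Im \<zeta>}"
      by (intro holomorphic_intros) (use nn in auto)
    then have "continuous_on {\<zeta>. 0 \<le> Im \<zeta>} (\<lambda>\<zeta>. csqrt (1 - \<i> * \<zeta>))"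
      by (rule holomorphic_on_imp_continuous_on)
    ultimately have "continuous_on {\<zeta>. 0 \<le> Im \<zeta>} A" unfolding A_def
      by (intro continuous_intros ext_continuous)
    then show "continuous_on (closure ?S) A" using clS by (auto intro: continuous_on_subset)
    show "bounded ?S" using bounded_ball bounded_Int by blast
    show "z \<in> ?S" using z zr by simp
    fix \<zeta> assume "\<zeta> \<in> frontier ?S"
    then have "\<zeta> \<in> {\<zeta>. 0 \<le> Im \<zeta>} \<inter> cball 0 r" and "\<zeta> \<notin> ?S"
      using clS unfolding frontier_def interior_open[OF oS] by blast+
    then have z1: "0 \<le> Im \<zeta>" "norm \<zeta> \<le> r" "\<zeta> \<notin> ?S" by auto
    show "Re (A \<zeta>) \<le> 0"
    proof (cases "Im \<zeta> = 0")
      case True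
      define t where "t = Re \<zeta>"
      have zt: "\<zeta> = of_real t" using True by (simp add: t_def complex_eq_iff)
      have zth: "\<zeta> + of_real h = of_real (t + h)" by (simp add: zt)
      have e: "Re (ext (\<zeta> + of_real h) - ext \<zeta>) = u (t + h) - u t" unfolding zth unfolding zt by (simp add: u_def)
      have "\<bar>u (t + h) - u t - h * D\<bar> \<le> \<kappa> * D * sqrt (1 + \<bar>t\<bar>)"
        unfolding D_def by (rule increment_near_linear[OF \<kappa> h])
      also have "sqrt (1 + \<bar>t\<bar>) = sqrt (1 + norm \<zeta>)" by (simp add: zt)
      also have "\<kappa> * D * sqrt (1 + norm \<zeta>) \<le> \<kappa> * D * (2 * Re (csqrt (1 - \<i> * \<zeta>)))"
        using \<kappa> D by (intro mult_left_mono sq z1(1)) auto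
      finally have "\<bar>u (t + h) - u t - h * D\<bar> \<le> 2 * \<kappa> * D * Re (csqrt (1 - \<i> * \<zeta>))" by simp
      then show ?thesis unfolding ReA e using abs[of "u (t + h) - u t - h * D"] by linarith
    next
      case False
      then have nr: "norm \<zeta> = r" using z1 by auto
      have "\<bar>Re (ext (\<zeta> + of_real h) - ext \<zeta>)\<bar> \<le> norm (ext (\<zeta> + of_real h) - ext \<zeta>)" by (rule abs_Re_le_cmod)
      also have "\<dots> \<le> 4 * c * X" using increment_growth_complex[OF z1(1) h] by (simp add: c_def nr Xr)
      finally have 1: "\<bar>Re (ext (\<zeta> + of_real h) - ext \<zeta>)\<bar> \<le> 4 * c * X" .
      have "0 \<le> h * D" "h * D \<le> D" using h D by auto
      then have "\<bar>Re (ext (\<zeta> + of_real h) - ext \<zeta>) - h * D\<bar> \<le> 4 * c * X + D" using 1 by linarith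
      also have "\<dots> \<le> (4 * c + D) * X" using X(1) D by (simp add: algebra_simps mult_le_cancel_left1)
      also have "\<dots> \<le> (X * (\<kappa> * D)) * X" using X(1,2) \<kappa> D by (intro mult_right_mono) (auto simp: pos_divide_le_eq)
      also have "\<dots> = \<kappa> * D * sqrt (1 + norm \<zeta>)" unfolding nr by (simp add: add.commute[of 1] Xr2 power2_eq_square mult_ac)
      also have "\<dots> \<le> \<kappa> * D * (2 * Re (csqrt (1 - \<i> * \<zeta>)))"
        using \<kappa> D by (intro mult_left_mono sq z1(1)) auto
      finally have "\<bar>Re (ext (\<zeta> + of_real h) - ext \<zeta>) - h * D\<bar> \<le> 2 * \<kappa> * D * Re (csqrt (1 - \<i> * \<zeta>))" by simp
      then show ?thesis unfolding ReA using abs[of "Re (ext (\<zeta> + of_real h) - ext \<zeta>) - h * D"] by linarith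
    qed
  qed
  moreover have "z + of_real h \<in> uhp" using z by simp
  ultimately show ?thesis using z unfolding ReA by (simp add: ext_eq D_def)
qed

text \<open>On this disc \<open>1 - \<i> * z\<close> has modulus at most 4, so the root in the
  majorant contributes at most 2.\<close>

lemma increment_interior:
  assumes \<kappa>: "0 < \<kappa>" "\<kappa> \<le> 1" "2 * \<omega> \<le> \<kappa>" "512 / \<kappa> ^ 4 + 1 \<le> R" and h: "0 < h" "h \<le> 1" and z: "z \<in> ball \<i> (1 / 2)"
  shows "\<bar>Re (f (z + of_real h) - f z) - h * (u 1 - u 0)\<bar> \<le> 4 * \<kappa> * (u 1 - u 0)"
proof -
  have D: "0 < u 1 - u 0" using u_strict by auto
  have n: "norm (z - \<i>) < 1 / 2" using z by (simp add: dist_norm norm_minus_commute)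
  then have zu: "z \<in> uhp" using abs_Im_le_cmod[of "z - \<i>"] by auto
  have "norm z \<le> norm (z - \<i>) + 1" using norm_triangle_sub[of z \<i>] by simp
  then have "norm (1 - \<i> * z) \<le> 4"
    using norm_triangle_ineq4[of 1 "\<i> * z"] n by (simp add: norm_mult)
  then have "Re (csqrt (1 - \<i> * z)) \<le> 2"
    using complex_Re_le_cmod[of "csqrt (1 - \<i> * z)"] real_sqrt_le_mono[of "norm (1 - \<i> * z)" 4]
    unfolding norm_csqrt by (simp del: csqrt.sel)
  then have "2 * \<kappa> * (u 1 - u 0) * Re (csqrt (1 - \<i> * z)) \<le> 2 * \<kappa> * (u 1 - u 0) * 2"
    using \<kappa> D by (intro mult_left_mono) auto
  then show ?thesis
    using increment_majorant[OF \<kappa> h zu, of 1] increment_majorant[OF \<kappa> h zu, of "-1"] by auto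
qed

text \<open>The difference of \<open>f\<close> with step \<open>h\<close> has almost constant real
  part near \<open>\<i>\<close>, by \<open>increment_interior\<close>. Hence the derivative of this
  difference is small, and at \<open>\<i>\<close> it approximates \<open>h\<close> times the second
  derivative. Every error is bounded by \<open>a\<close>, the real part of \<open>f'\<close> at
  \<open>\<i>\<close>, never by the modulus. The constant is 76 * 6 / 8 + 96 = 153.\<close>

lemma second_deriv_bound:
  assumes \<kappa>: "0 < \<kappa>" "\<kappa> \<le> 1" "2 * \<omega> \<le> \<kappa>" "512 / \<kappa> ^ 4 + 1 \<le> R" and h: "0 < h" "h \<le> 1 / 8" "8 * \<kappa> \<le> h\<^sup>2"
  shows "norm (deriv (deriv f) \<i>) \<le> 153 * h * Re (deriv f \<i>)"
proof -
  define D where "D = u 1 - u 0"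
  have D: "0 < D" using u_strict by (auto simp: D_def)
  define a where "a = Re (deriv f \<i>)"
  have pos: "0 < Re (deriv f z)" if "z \<in> uhp" for z using gm that by (simp add: graph_map_def)
  have a: "0 < a" using pos[of \<i>] by (simp add: a_def)
  have hold: "deriv f holomorphic_on uhp" by (rule holomorphic_deriv[OF hol open_uhp])
  have hold2: "deriv (deriv f) holomorphic_on uhp" by (rule holomorphic_deriv[OF hold open_uhp])
  have b1: "ball \<i> 1 \<subseteq> uhp"
  proof
    fix z assume "z \<in> ball \<i> 1"
    then show "z \<in> uhp" using abs_Im_le_cmod[of "z - \<i>"] by (auto simp: dist_norm norm_minus_commute)
  qed
  have near: "norm (deriv f z - deriv f \<i>) \<le> 2 * a" if "norm (z - \<i>) \<le> 1 / 2" for z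
  proof -
    have "0 < Re (deriv f w)" if "w \<in> ball \<i> 1" for w using pos b1 that by blast
    then have "norm (deriv f z - deriv f \<i>) \<le> 2 * Re (deriv f \<i>) * ((1 / 2) / (1 - 1 / 2))"
      by (rule Re_pos_Schwarz[OF holomorphic_on_subset[OF hold b1]]) (use that in auto)
    then show ?thesis by (simp add: a_def)
  qed
  have h1: "h \<le> 1" using h by simp
  have "h * h \<le> h * 1" using h by (intro mult_left_mono) auto
  then have hk: "8 * \<kappa> \<le> h" using h(3) unfolding power2_eq_square by linarith
  \<comment> \<open>A first-order expansion bounds the real increment above by
    \<open>3 * a * h\<close>, while it is at least \<open>h * D / 2\<close>; this converts
    \<open>D\<close> into \<open>a\<close>.\<close>
  have D6: "D \<le> 6 * a"
  proof -
    have "norm ((f (\<i> + of_real h) - deriv f \<i> * (\<i> + of_real h)) - (f \<i> - deriv f \<i> * \<i>)) \<le> (2 * a) * norm ((\<i> + of_real h) - \<i>)"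
    proof (rule field_differentiable_bound[OF convex_cball[of \<i> "1 / 2"], where f' = "\<lambda>z. deriv f z - deriv f \<i>"])
      fix z assume z: "z \<in> cball \<i> (1 / 2)"
      then have "z \<in> ball \<i> 1" by simp
      then have "z \<in> uhp" using b1 by blast
      note D = has_deriv_second_deriv(1)[OF this]
      show "((\<lambda>z. f z - deriv f \<i> * z) has_field_derivative deriv f z - deriv f \<i>) (at z within cball \<i> (1 / 2))"
        by (rule has_field_derivative_at_within) (auto intro!: derivative_eq_intros D)
      show "norm (deriv f z - deriv f \<i>) \<le> 2 * a" using z by (intro near) (simp add: dist_norm norm_minus_commute)
    qed (use h in \<open>auto simp: dist_norm\<close>)
    then have n: "norm (f (\<i> + of_real h) - f \<i> - deriv f \<i> * of_real h) \<le> 2 * a * h" using h by (simp add: algebra_simps)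
    have "Re (f (\<i> + of_real h) - f \<i>) = Re (f (\<i> + of_real h) - f \<i> - deriv f \<i> * of_real h) + a * h" by (simp add: a_def)
    then have "Re (f (\<i> + of_real h) - f \<i>) \<le> 3 * a * h"
      using n complex_Re_le_cmod[of "f (\<i> + of_real h) - f \<i> - deriv f \<i> * of_real h"] by linarith
    moreover have "h * D - 4 * \<kappa> * D \<le> Re (f (\<i> + of_real h) - f \<i>)"
      using increment_interior[OF \<kappa> h(1) h1, of \<i>] by (simp add: D_def)
    moreover have "4 * \<kappa> * D \<le> h / 2 * D" using hk D by (intro mult_right_mono) auto
    ultimately have "h * (D / 2) \<le> h * (3 * a)" by (simp add: mult_ac)
    then show ?thesis using h by simp
  qed
  define G where "G z = f (z + of_real h) - f z - of_real (h * D)" for z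
  have up: "z + of_real h \<in> uhp" if "z \<in> uhp" for z using that by simp
  have dG: "(G has_field_derivative (deriv f (z + of_real h) - deriv f z)) (at z)" if z: "z \<in> uhp" for z
  proof -
    have "((\<lambda>z. f (z + of_real h)) has_field_derivative deriv f (z + of_real h)) (at z)"
      using has_deriv_second_deriv(1)[OF up[OF z]] by (subst DERIV_shift[symmetric]) (simp add: add.commute)
    then show ?thesis unfolding G_def[abs_def] using has_deriv_second_deriv(1)[OF z] by (auto intro!: derivative_eq_intros)
  qed
  have holG: "G holomorphic_on uhp"
    unfolding holomorphic_on_open[OF open_uhp] using dG by blast
  have bh: "ball \<i> (1 / 2) \<subseteq> uhp" using b1 by (auto simp: subset_iff)
  have ReG: "\<bar>Re (G z)\<bar> \<le> 4 * \<kappa> * D" if "z \<in> ball \<i> (1 / 2)" for z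
    using increment_interior[OF \<kappa> h(1) h1 that] by (simp add: G_def D_def)
  have kD: "0 < \<kappa> * D" using \<kappa> D by simp
  \<comment> \<open>Adding \<open>5 * (\<kappa> * D)\<close> makes the real part positive, so that
    \<open>Re_pos_Schwarz\<close> applies; 18 is 2 * (4 + 5).\<close>
  have Gnear: "norm (G z - G \<i>) \<le> 18 * (\<kappa> * D)" if "norm (z - \<i>) \<le> 1 / 4" for z
  proof -
    have "norm ((G z + of_real (5 * (\<kappa> * D))) - (G \<i> + of_real (5 * (\<kappa> * D)))) \<le> 2 * Re (G \<i> + of_real (5 * (\<kappa> * D))) * ((1 / 2) / (1 - 1 / 2))"
    proof (rule Re_pos_Schwarz[of "\<lambda>z. G z + of_real (5 * (\<kappa> * D))" \<i> "1 / 2"])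
      show "(\<lambda>z. G z + of_real (5 * (\<kappa> * D))) holomorphic_on ball \<i> (1 / 2)"
        by (intro holomorphic_intros holomorphic_on_subset[OF holG bh])
      show "0 < Re (G z + of_real (5 * (\<kappa> * D)))" if "z \<in> ball \<i> (1 / 2)" for z using ReG[OF that] kD by simp
    qed (use that in auto)
    moreover have "Re (G \<i>) \<le> 4 * (\<kappa> * D)" using ReG[of \<i>] by simp
    ultimately show ?thesis by simp
  qed
  \<comment> \<open>Cauchy's estimate on radius 1/4, with 19 in place of 18 because the target disc
    is open; 76 is 4 * 19.\<close>
  have "norm ((deriv ^^ 1) G \<i>) \<le> fact 1 * (19 * (\<kappa> * D)) / (1 / 4) ^ 1"
  proof (rule Cauchy_higher_deriv_bound)
    have sub: "cball \<i> (1 / 4) \<subseteq> uhp" using bh by (auto simp: subset_iff)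
    then show "G holomorphic_on ball \<i> (1 / 4)" using ball_subset_cball by (intro holomorphic_on_subset[OF holG]) blast
    show "continuous_on (cball \<i> (1 / 4)) G" by (rule holomorphic_on_imp_continuous_on[OF holomorphic_on_subset[OF holG sub]])
    show "G w \<in> ball (G \<i>) (19 * (\<kappa> * D))" if "w \<in> ball \<i> (1 / 4)" for w
      using Gnear[of w] that kD by (simp add: dist_norm norm_minus_commute)
  qed auto
  then have "norm (deriv f (\<i> + of_real h) - deriv f \<i>) \<le> 76 * (\<kappa> * D)"
    using DERIV_imp_deriv[OF dG[of \<i>]] by simp
  moreover have "norm (deriv f (\<i> + of_real h) - deriv f \<i> - deriv (deriv f) \<i> * of_real h) \<le> 96 * a * h * h"
  proof -
    \<comment> \<open>Cauchy's estimate for \<open>deriv f\<close> on radius 1/4, with values within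
      \<open>3 * a\<close> of the one at \<open>\<i>\<close>: 2 * 3 * 16 = 96.\<close>
    have d3: "norm (deriv (deriv (deriv f)) z) \<le> 96 * a" if z: "norm (z - \<i>) \<le> 1 / 8" for z
    proof -
      have bz: "norm (w - \<i>) \<le> 1 / 2" if "w \<in> cball z (1 / 4)" for w
        using that z norm_triangle_ineq[of "w - z" "z - \<i>"] by (simp add: dist_norm norm_minus_commute)
      then have "cball z (1 / 4) \<subseteq> ball \<i> 1" by (force simp: dist_norm norm_minus_commute)
      then have sub: "cball z (1 / 4) \<subseteq> uhp" using b1 by blast
      have "norm ((deriv ^^ 2) (deriv f) z) \<le> fact 2 * (3 * a) / (1 / 4) ^ 2"
      proof (rule Cauchy_higher_deriv_bound)
        show "deriv f holomorphic_on ball z (1 / 4)" using sub ball_subset_cball by (intro holomorphic_on_subset[OF hold]) blast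
        show "continuous_on (cball z (1 / 4)) (deriv f)" by (rule holomorphic_on_imp_continuous_on[OF holomorphic_on_subset[OF hold sub]])
        show "deriv f w \<in> ball (deriv f \<i>) (3 * a)" if "w \<in> ball z (1 / 4)" for w
          using near[OF bz[of w]] that a by (simp add: dist_norm norm_minus_commute)
      qed auto
      then show ?thesis by (simp add: numeral_2_eq_2 power2_eq_square)
    qed
    have b8: "z \<in> uhp" "norm (z - \<i>) \<le> 1 / 8" if "z \<in> cball \<i> h" for z
    proof -
      show n: "norm (z - \<i>) \<le> 1 / 8" using that h by (simp add: dist_norm norm_minus_commute)
      then show "z \<in> uhp" using bh by (auto simp: subset_iff dist_norm norm_minus_commute)
    qed
    have d2: "norm (deriv (deriv f) z - deriv (deriv f) \<i>) \<le> 96 * a * h" if z: "z \<in> cball \<i> h" for z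
    proof -
      have "norm (deriv (deriv f) z - deriv (deriv f) \<i>) \<le> (96 * a) * norm (z - \<i>)"
      proof (rule field_differentiable_bound[OF convex_cball[of \<i> h], where f' = "deriv (deriv (deriv f))"])
        fix w assume w: "w \<in> cball \<i> h"
        show "(deriv (deriv f) has_field_derivative deriv (deriv (deriv f)) w) (at w within cball \<i> h)"
          by (rule has_field_derivative_at_within[OF holomorphic_derivI[OF hold2 open_uhp b8(1)[OF w]]])
        show "norm (deriv (deriv (deriv f)) w) \<le> 96 * a" by (rule d3[OF b8(2)[OF w]])
      qed (use z h in auto)
      also have "\<dots> \<le> (96 * a) * h" using z a by (intro mult_left_mono) (auto simp: dist_norm norm_minus_commute)
      finally show ?thesis .
    qed
    have "norm ((deriv f (\<i> + of_real h) - deriv (deriv f) \<i> * (\<i> + of_real h)) - (deriv f \<i> - deriv (deriv f) \<i> * \<i>))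
       \<le> (96 * a * h) * norm ((\<i> + of_real h) - \<i>)"
    proof (rule field_differentiable_bound[OF convex_cball[of \<i> h], where f' = "\<lambda>z. deriv (deriv f) z - deriv (deriv f) \<i>"])
      fix z assume z: "z \<in> cball \<i> h"
      note D = has_deriv_second_deriv(2)[OF b8(1)[OF z]]
      show "((\<lambda>z. deriv f z - deriv (deriv f) \<i> * z) has_field_derivative deriv (deriv f) z - deriv (deriv f) \<i>) (at z within cball \<i> h)"
        by (rule has_field_derivative_at_within) (auto intro!: derivative_eq_intros D)
      show "norm (deriv (deriv f) z - deriv (deriv f) \<i>) \<le> 96 * a * h" by (rule d2[OF z])
    qed (use h in \<open>auto simp: dist_norm\<close>)
    then show ?thesis using h by (simp add: algebra_simps)
  qed
  moreover have "norm (deriv (deriv f) \<i> * of_real h) \<le> norm (deriv f (\<i> + of_real h) - deriv f \<i>) + norm (deriv f (\<i> + of_real h) - deriv f \<i> - deriv (deriv f) \<i> * of_real h)"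
    by (metis norm_minus_commute norm_triangle_sub)
  ultimately have "norm (deriv (deriv f) \<i> * of_real h) \<le> 76 * (\<kappa> * D) + 96 * a * h * h" by linarith
  moreover have "\<kappa> * D \<le> (h\<^sup>2 / 8) * (6 * a)" using \<kappa> h D D6 a by (intro mult_mono) auto
  ultimately have "h * norm (deriv (deriv f) \<i>) \<le> 76 * ((h\<^sup>2 / 8) * (6 * a)) + 96 * a * h * h"
    using h by (simp add: norm_mult mult.commute)
  also have "\<dots> = h * (153 * h * a)" by (simp add: power2_eq_square)
  finally show ?thesis using h by (simp add: a_def)
qed

end

text \<open>The constants are fixed in the order of dependence: \<open>h\<close> from
  \<open>k\<close>, then \<open>\<kappa>\<close>, \<open>R\<close>, \<open>\<omega>\<close>,
  \<open>\<epsilon>\<close>, \<open>\<delta>\<close>, and the threshold for \<open>s\<close> last.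
  Dilation and horizontal translation of the domain move an arbitrary \<open>z\<close> to
  \<open>\<i>\<close> without changing the graph.\<close>

lemma graph_map_second_deriv_small:
  assumes k: "0 < k" "k \<le> 1"
  obtains s\<^sub>0 \<delta> where "0 < s\<^sub>0"
    "\<And>s \<gamma> f. 0 < s \<Longrightarrow> s < s\<^sub>0 \<Longrightarrow> qs_curve s \<gamma> \<Longrightarrow> graph_map \<gamma> f \<Longrightarrow> graph_bloch f \<delta> \<gamma> s"
    "\<And>s \<gamma> f z. 0 < s \<Longrightarrow> s < s\<^sub>0 \<Longrightarrow> qs_curve s \<gamma> \<Longrightarrow> graph_map \<gamma> f \<Longrightarrow> z \<in> uhp \<Longrightarrow>
       2 * Im z * norm (deriv (deriv f) z) \<le> k * Re (deriv f z)"
proof -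
  \<comment> \<open>The factor 306 in the next line is twice the constant 153 of
    \<open>second_deriv_bound\<close>; 400 leaves room.\<close>
  define h where "h = k / 400"
  have h: "0 < h" "h \<le> 1 / 8" "306 * h \<le> k" using k by (auto simp: h_def)
  define \<kappa> where "\<kappa> = h\<^sup>2 / 8"
  have h2: "h\<^sup>2 \<le> 1" using h power_le_one[of h 2] by simp
  have \<kappa>: "0 < \<kappa>" "\<kappa> \<le> 1 / 8" "8 * \<kappa> \<le> h\<^sup>2" using h h2 by (auto simp: \<kappa>_def)
  define R where "R = 512 / \<kappa> ^ 4 + 2"
  have RR: "2 \<le> R" "512 / \<kappa> ^ 4 + 1 \<le> R" using \<kappa> by (auto simp: R_def)
  define \<omega> where "\<omega> = \<kappa> / 2"
  have \<omega>: "0 < \<omega>" "2 * \<omega> \<le> \<kappa>" "\<omega> \<le> 1 / 10" using \<kappa> by (auto simp: \<omega>_def)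
  define \<epsilon> where "\<epsilon> = \<omega> / (6 * R^2)"
  have \<epsilon>: "0 < \<epsilon>" "6 * R^2 * \<epsilon> \<le> \<omega>" using \<omega> RR by (auto simp: \<epsilon>_def)
  define \<delta> where "\<delta> = min (1 / 20) (\<epsilon> / (10 * R))"
  have \<delta>: "0 < \<delta>" "\<delta> \<le> 1 / 20" "10 * \<delta> * R \<le> \<epsilon>"
  proof -
    show "0 < \<delta>" "\<delta> \<le> 1 / 20" using \<epsilon> RR by (auto simp: \<delta>_def)
    have "\<delta> \<le> \<epsilon> / (10 * R)" by (simp add: \<delta>_def)
    then show "10 * \<delta> * R \<le> \<epsilon>" using RR by (simp add: pos_le_divide_eq mult_ac)
  qed
  obtain s1 where s1: "0 < s1"
    "\<And>s \<gamma> f z. 0 < s \<Longrightarrow> s < s1 \<Longrightarrow> qs_curve s \<gamma> \<Longrightarrow> graph_map \<gamma> f \<Longrightarrow> z \<in> uhp \<Longrightarrow>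
       Im z * norm (deriv (deriv f) z) \<le> \<delta> * norm (deriv f z)"
    using graph_map_bloch_small[OF \<delta>(1)] by metis
  have gb: "graph_bloch f \<delta> \<gamma> s" if s: "0 < s" "s < min s1 \<epsilon>" and q: "qs_curve s \<gamma>" and g: "graph_map \<gamma> f" for s \<gamma> f
  proof
    show "f holomorphic_on uhp" using g by (simp add: graph_map_def)
    show "deriv f z \<noteq> 0" if "z \<in> uhp" for z using g that by (force simp: graph_map_def)
    show "Im z * norm (deriv (deriv f) z) \<le> \<delta> * norm (deriv f z)" if "z \<in> uhp" for z
      using s1(2)[OF _ _ q g that] s by simp
  qed (use \<delta> s q g in auto)
  have fl: "graph_flat f \<delta> \<gamma> s R \<epsilon> \<omega>" if s: "0 < s" "s < min s1 \<epsilon>" and q: "qs_curve s \<gamma>" and g: "graph_map \<gamma> f" for s \<gamma> f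
    unfolding graph_flat_def graph_flat_axioms_def using gb[OF that] RR \<delta> \<epsilon> \<omega> s by auto
  have main: "2 * Im z * norm (deriv (deriv f) z) \<le> k * Re (deriv f z)"
    if s: "0 < s" "s < min s1 \<epsilon>" and q: "qs_curve s \<gamma>" and g: "graph_map \<gamma> f" and z: "z \<in> uhp" for s \<gamma> f z
  proof -
    define b where "b = Im z"
    have b: "0 < b" using z by (simp add: b_def)
    define F where "F w = (f (of_real b * w + of_real (Re z)) - 0) / of_real 1" for w
    have "graph_map (\<lambda>x. (\<gamma> (1 * x + Re 0) - 0) / of_real 1) F"
      unfolding F_def[abs_def] by (rule graph_map_affine[OF g _ b]) simp
    then have gF: "graph_map \<gamma> F" by simp
    interpret graph_flat F \<delta> \<gamma> s R \<epsilon> \<omega> by (rule fl[OF s q gF])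
    have ii: "\<i> \<in> uhp" by simp
    have holf: "f holomorphic_on uhp" using g by (simp add: graph_map_def)
    have zz: "of_real b * \<i> + of_real (Re z) = z" by (simp add: b_def complex_eq_iff)
    have D: "deriv F \<i> = of_real b * deriv f z" "deriv (deriv F) \<i> = of_real (b\<^sup>2) * deriv (deriv f) z"
      using deriv_affine_comp[OF holf b ii, where a = 1 and x = "Re z" and c = 0] unfolding zz F_def[abs_def] by auto
    have "norm (deriv (deriv F) \<i>) \<le> 153 * h * Re (deriv F \<i>)"
      by (rule second_deriv_bound[OF \<kappa>(1) _ \<omega>(2) RR(2) h(1,2) \<kappa>(3)]) (use \<kappa>(2) in simp)
    then have "b * (b * norm (deriv (deriv f) z)) \<le> b * (153 * h * Re (deriv f z))"
      unfolding D using b by (simp add: norm_mult power2_eq_square mult_ac)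
    then have "2 * (b * norm (deriv (deriv f) z)) \<le> 306 * h * Re (deriv f z)" using b by simp
    also have "\<dots> \<le> k * Re (deriv f z)" using h(3) g z by (intro mult_right_mono) (auto simp: graph_map_def less_imp_le)
    finally show ?thesis by (simp add: b_def)
  qed
  show thesis using that[of "min s1 \<epsilon>" \<delta>] s1(1) \<epsilon>(1) gb main by simp
qed

section \<open>Weak derivatives\<close>

lemma AE_Im_nonzero: "AE z in lborel. Im z \<noteq> 0"
proof -
  have "negligible {z. \<i> \<bullet> z = 0}" by (rule negligible_hyperplane) simp
  then have "AE z in lebesgue. z \<notin> {z. \<i> \<bullet> z = 0}" unfolding negligible_iff_null_sets by (rule AE_not_in)
  then show ?thesis unfolding AE_completion_iff by (rule AE_mp) (auto simp: inner_complex_def)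
qed

text \<open>Cut the disc into strips where \<open>\<bar>Im z\<bar>\<close> has order
  \<open>(1 / 4) ^ n\<close>. There the integrand is at most \<open>2 * 2 ^ n\<close> and the area a
  multiple of \<open>(1 / 4) ^ n\<close>, which gives a convergent geometric series. The exponent
  1/2 covers squares of derivatives bounded by the power -1/4.\<close>

lemma integrable_Im_powr:
  assumes p: "0 \<le> p" "p \<le> 1 / 2"
  shows "integrable lborel (\<lambda>z. indicator (cball (0::complex) R) z *\<^sub>R (\<bar>Im z\<bar> powr (- p)))"
proof (rule integrableI_bounded)
  define R' where "R' = \<bar>R\<bar>"
  define B where "B = cbox (Complex (- R') (- R')) (Complex R' R')"
  define T where "T n = cbox (Complex (- R') (- ((1 / 4) ^ n))) (Complex R' ((1 / 4) ^ n))" for n :: nat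
  let ?g = "\<lambda>z. indicator (cball 0 R) z *\<^sub>R (\<bar>Im z\<bar> powr (- p)) :: real"
  have meas: "(\<lambda>z. \<bar>Im z\<bar> powr (- p)) \<in> borel_measurable borel" by measurable
  show "?g \<in> borel_measurable lborel"
    by (intro borel_measurable_scaleR borel_measurable_indicator) (use meas in auto)
  have sets: "B \<in> sets lborel" "T n \<in> sets lborel" for n by (auto simp: B_def T_def)
  have box: "z \<in> cbox (Complex (- R') (- b)) (Complex R' b)" if "norm z \<le> R" "\<bar>Im z\<bar> \<le> b" for z b
    using that abs_Re_le_cmod[of z] by (auto simp: in_cbox_complex_iff R'_def abs_le_iff)
  have bound: "ennreal (norm (?g z)) \<le> indicator B z + (\<Sum>n. ennreal (2 * 2 ^ n) * indicator (T n) z)" for z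
  proof (cases "z \<in> cball 0 R \<and> Im z \<noteq> 0")
    case False then show ?thesis by (auto simp: indicator_def)
  next
    case True
    then have z: "norm z \<le> R" "0 < \<bar>Im z\<bar>" by auto
    show ?thesis
    proof (cases "1 \<le> \<bar>Im z\<bar>")
      case 1: True
      have "\<bar>Im z\<bar> powr (- p) \<le> \<bar>Im z\<bar> powr 0" using 1 p by (intro powr_mono) auto
      then have "norm (?g z) \<le> 1" using z 1 by simp
      moreover have "z \<in> B" unfolding B_def by (rule box[OF z(1)]) (use z abs_Im_le_cmod[of z] in \<open>auto simp: R'_def\<close>)
      ultimately have "ennreal (norm (?g z)) \<le> indicator B z" by (simp add: ennreal_le_1)
      then show ?thesis by (rule order_trans) simp
    next
      case 2: False
      obtain m where "(1 / 4 :: real) ^ m < \<bar>Im z\<bar>" using real_arch_pow_inv[OF z(2), of "1/4"] by auto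
      moreover have "(1 / 4 :: real) ^ Suc m \<le> (1 / 4) ^ m" by (rule power_decreasing) auto
      ultimately have ex: "\<exists>m. (1 / 4 :: real) ^ Suc m < \<bar>Im z\<bar>" by (intro exI[of _ m]) linarith
      define n where "n = (LEAST m. (1 / 4 :: real) ^ Suc m < \<bar>Im z\<bar>)"
      have n1: "(1 / 4 :: real) ^ Suc n < \<bar>Im z\<bar>" unfolding n_def by (rule LeastI_ex[OF ex])
      have n2: "\<bar>Im z\<bar> \<le> (1 / 4) ^ n"
      proof (cases n)
        case 0 then show ?thesis using 2 by simp
      next
        case (Suc i)
        then show ?thesis using not_less_Least[of i "\<lambda>m. (1 / 4 :: real) ^ Suc m < \<bar>Im z\<bar>"] by (simp add: n_def)
      qed
      have "\<bar>Im z\<bar> powr (- p) \<le> \<bar>Im z\<bar> powr (- (1 / 2))" using z 2 p by (intro powr_mono') auto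
      also have "\<dots> \<le> ((1 / 4) ^ Suc n) powr (- (1 / 2))" using n1 by (intro powr_mono2') auto
      also have "((1 / 4 :: real) ^ Suc n) powr (- (1 / 2)) = 2 * 2 ^ n"
      proof -
        have "((1 / 4 :: real) ^ Suc n) powr (1 / 2) = sqrt (((1 / 2) ^ Suc n)\<^sup>2)"
          by (simp add: powr_half_sqrt power2_eq_square flip: power_mult_distrib)
        then have "((1 / 4 :: real) ^ Suc n) powr (1 / 2) = (1 / 2) ^ Suc n" by simp
        then show ?thesis by (simp add: powr_minus_divide power_one_over)
      qed
      finally have "norm (?g z) \<le> 2 * 2 ^ n" using z by simp
      moreover have "z \<in> T n" unfolding T_def by (rule box[OF z(1) n2])
      ultimately have "ennreal (norm (?g z)) \<le> ennreal (2 * 2 ^ n) * indicator (T n) z"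
        by (simp add: ennreal_leI)
      also have "\<dots> \<le> (\<Sum>n. ennreal (2 * 2 ^ n) * indicator (T n) z)"
      proof -
        define t where "t n = ennreal (2 * 2 ^ n) * indicator (T n) z" for n
        have "sum t {n} \<le> suminf t" by (rule sum_le_suminf) auto
        then have "t n \<le> suminf t" by simp
        then show ?thesis unfolding t_def .
      qed
      finally show ?thesis by (rule order_trans) simp
    qed
  qed
  have "(\<integral>\<^sup>+ z. ennreal (norm (?g z)) \<partial>lborel) \<le> (\<integral>\<^sup>+ z. indicator B z + (\<Sum>n. ennreal (2 * 2 ^ n) * indicator (T n) z) \<partial>lborel)"
    by (intro nn_integral_mono bound)
  also have "\<dots> = emeasure lborel B + (\<Sum>n. ennreal (2 * 2 ^ n) * emeasure lborel (T n))"
    using sets by (simp add: nn_integral_add nn_integral_suminf nn_integral_cmult)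
  also have "\<dots> < \<infinity>"
  proof -
    have eT: "emeasure lborel (T n) = ennreal (4 * R' * (1 / 4) ^ n)" for n
      unfolding T_def emeasure_lborel_cbox_eq by (simp add: Basis_complex_def R'_def inner_complex_def mult_ac)
    have eq: "ennreal (2 * 2 ^ n) * emeasure lborel (T n) = ennreal (8 * R' * (1 / 2) ^ n)" for n
    proof -
      have e1: "(2 :: real) ^ n * (1 / 4) ^ n = (1 / 2) ^ n" by (simp flip: power_mult_distrib)
      have "(2 * 2 ^ n) * (4 * R' * (1 / 4) ^ n) = 8 * R' * ((2 :: real) ^ n * (1 / 4) ^ n)" by simp
      then have "(2 * 2 ^ n) * (4 * R' * (1 / 4) ^ n) = 8 * R' * (1 / 2) ^ n" unfolding e1 .
      moreover have "ennreal (2 * 2 ^ n) * ennreal (4 * R' * (1 / 4) ^ n) = ennreal ((2 * 2 ^ n) * (4 * R' * (1 / 4) ^ n))"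
        by (rule ennreal_mult[symmetric]) (auto simp: R'_def)
      ultimately show ?thesis unfolding eT by (simp only:)
    qed
    have "(\<Sum>n. ennreal (8 * R' * (1 / 2) ^ n)) \<noteq> top"
      by (rule ennreal_suminf_neq_top) (auto simp: R'_def intro!: summable_mult)
    moreover have "emeasure lborel B \<noteq> top" unfolding B_def emeasure_lborel_cbox_eq by auto
    ultimately show ?thesis unfolding eq by (simp add: less_top)
  qed
  finally show "(\<integral>\<^sup>+ z. ennreal (norm (?g z)) \<partial>lborel) < \<infinity>" .
qed

lemma integrable_dominated_Im:
  fixes g :: "complex \<Rightarrow> 'b::{banach, second_countable_topology}"
  assumes p: "0 \<le> p" "p \<le> 1 / 2" and m: "g \<in> borel_measurable borel"
    and b: "\<And>z. norm z \<le> R \<Longrightarrow> norm (g z) \<le> C * \<bar>Im z\<bar> powr (- p)" and K: "K \<subseteq> cball 0 R" "K \<in> sets borel"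
  shows "integrable lborel (\<lambda>z. indicator K z *\<^sub>R g z)"
proof (rule Bochner_Integration.integrable_bound)
  show "integrable lborel (\<lambda>z. C * (indicator (cball (0::complex) R) z *\<^sub>R (\<bar>Im z\<bar> powr (- p))))"
    by (intro integrable_mult_right integrable_Im_powr p)
  show "(\<lambda>z. indicator K z *\<^sub>R g z) \<in> borel_measurable lborel"
    by (intro borel_measurable_scaleR borel_measurable_indicator) (use m K(2) in auto)
  show "AE z in lborel. norm (indicator K z *\<^sub>R g z) \<le> norm (C * (indicator (cball 0 R) z *\<^sub>R (\<bar>Im z\<bar> powr (- p))))"
  proof (intro AE_I2)
    fix z :: complex
    show "norm (indicator K z *\<^sub>R g z) \<le> norm (C * (indicator (cball 0 R) z *\<^sub>R (\<bar>Im z\<bar> powr (- p))))"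
    proof (cases "z \<in> K")
      case True
      then have z: "z \<in> cball 0 R" using K by blast
      have "norm (g z) \<le> C * \<bar>Im z\<bar> powr (- p)" by (rule b) (use z in simp)
      also have "\<dots> \<le> \<bar>C * \<bar>Im z\<bar> powr (- p)\<bar>" by (rule abs_ge_self)
      finally show ?thesis using True z by simp
    qed simp
  qed
qed

lemma lborel_integral_shift:
  fixes g :: "complex \<Rightarrow> complex"
  assumes "g \<in> borel_measurable borel"
  shows "integral\<^sup>L lborel (\<lambda>z. g (c + z)) = integral\<^sup>L lborel g"
    and "integrable lborel g \<Longrightarrow> integrable lborel (\<lambda>z. g (c + z))"
proof -
  have "integral\<^sup>L lborel g = integral\<^sup>L (distr lborel borel ((+) c)) g" by (simp add: lborel_distr_plus)
  also have "\<dots> = integral\<^sup>L lborel (\<lambda>z. g (c + z))" by (rule integral_distr) (use assms in auto)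
  finally show "integral\<^sup>L lborel (\<lambda>z. g (c + z)) = integral\<^sup>L lborel g" ..
  assume "integrable lborel g"
  then have "integrable (distr lborel borel ((+) c)) g" by (simp add: lborel_distr_plus)
  then show "integrable lborel (\<lambda>z. g (c + z))" by (subst (asm) integrable_distr_eq) (use assms in auto)
qed

lemma test_fun_derivative:
  assumes t: "test_fun \<phi>"
  shows "((\<lambda>t. \<phi> (z + of_real t * v)) has_real_derivative dpar v \<phi> (z + of_real t * v)) (at t)"
    and "continuous_on UNIV \<phi>" "continuous_on UNIV (dpar v \<phi>)"
proof -
  have d: "\<phi> differentiable (at z)" "dpar v \<phi> differentiable (at z)" for z
  proof -
    have s: "\<forall>vs z. fold dpar vs \<phi> differentiable (at z)" using t by (simp add: test_fun_def smooth_fun_def)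
    from spec[OF spec[OF s, of "[]"], of z] show "\<phi> differentiable (at z)" by simp
    from spec[OF spec[OF s, of "[v]"], of z] show "dpar v \<phi> differentiable (at z)" by simp
  qed
  show "continuous_on UNIV \<phi>" "continuous_on UNIV (dpar v \<phi>)"
    using d by (auto intro!: continuous_at_imp_continuous_on differentiable_imp_continuous_within)
  have 1: "(\<phi> has_derivative frechet_derivative \<phi> (at (z + of_real t * v))) (at (z + of_real t * v))"
    using d(1) frechet_derivative_works by blast
  have 2: "((\<lambda>t. z + of_real t * v) has_derivative (\<lambda>h. of_real h * v)) (at t)"
    by (auto intro!: derivative_eq_intros)
  have 3: "((\<lambda>t. \<phi> (z + of_real t * v)) has_derivative (\<lambda>h. frechet_derivative \<phi> (at (z + of_real t * v)) (of_real h * v))) (at t)"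
    using has_derivative_compose[OF 2 1] .
  have lin: "linear (frechet_derivative \<phi> (at (z + of_real t * v)))"
    using d(1) linear_frechet_derivative by blast
  have "frechet_derivative \<phi> (at (z + of_real t * v)) (of_real h * v) = h * dpar v \<phi> (z + of_real t * v)" for h
    using linear_cmul[OF lin, of h v] by (simp add: dpar_def scaleR_conv_of_real)
  then have "((\<lambda>t. \<phi> (z + of_real t * v)) has_derivative (\<lambda>h. h * dpar v \<phi> (z + of_real t * v))) (at t)"
    using 3 by (simp only:)
  then show "((\<lambda>t. \<phi> (z + of_real t * v)) has_real_derivative dpar v \<phi> (z + of_real t * v)) (at t)"
    by (simp add: has_field_derivative_def mult_commute_abs)
qed

text \<open>\<open>F\<close> may fail to be differentiable on the real line, so difference quotients
  replace integration by parts: a shift of the measure moves them from \<open>\<phi>\<close> to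
  \<open>F\<close>, and dominated convergence is applied on both sides. The hypothesis
  \<open>inc\<close> on backward differences supplies the integrable majorant on the side of
  \<open>F\<close>.\<close>

lemma weak_partialI:
  fixes F g :: "complex \<Rightarrow> complex" and v :: complex
  assumes v: "norm v = 1" and contF: "continuous_on UNIV F" and gm: "g \<in> borel_measurable borel"
    and gb: "\<And>R. \<exists>C. \<forall>z. norm z \<le> R \<longrightarrow> norm (g z) \<le> C * \<bar>Im z\<bar> powr (- (1 / 4))"
    and lim: "\<And>z. Im z \<noteq> 0 \<Longrightarrow> ((\<lambda>t. F (z + of_real t * v)) has_vector_derivative g z) (at 0)"
    and inc: "\<And>R. \<exists>C\<ge>0. \<forall>z h. Im z \<noteq> 0 \<longrightarrow> norm z \<le> R \<longrightarrow> 0 < h \<longrightarrow> h \<le> 1 \<longrightarrow>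
        norm (F z - F (z - of_real h * v)) \<le> C * h * \<bar>Im z\<bar> powr (- (1 / 4))"
  shows "weak_partial F v g"
  unfolding weak_partial_def
proof (intro conjI allI impI)
  have Fm: "F \<in> borel_measurable borel" by (rule borel_measurable_continuous_onI[OF contF])
  fix K :: "complex set" assume K: "compact K"
  then have Kb: "K \<in> sets borel" by (simp add: compact_imp_closed)
  have "integrable lborel (\<lambda>z. indicator K z *\<^sub>R F z)"
    by (rule borel_integrable_compact[OF K continuous_on_subset[OF contF]]) simp
  then show "set_integrable lebesgue K F" unfolding set_integrable_def
    by (subst integrable_completion) (use Fm Kb in \<open>auto intro!: borel_measurable_scaleR borel_measurable_indicator\<close>)
  obtain R where "\<forall>y\<in>K. dist 0 y \<le> R"
    using compact_imp_bounded[OF K] unfolding bounded_any_center[of _ 0] by (elim exE)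
  then have R: "K \<subseteq> cball 0 R" by (auto simp: subset_iff)
  obtain C where C: "\<And>z. norm z \<le> R \<Longrightarrow> norm (g z) \<le> C * \<bar>Im z\<bar> powr (- (1 / 4))" using gb by blast
  have "integrable lborel (\<lambda>z. indicator K z *\<^sub>R g z)"
    by (rule integrable_dominated_Im[OF _ _ gm C R Kb]) auto
  then show "set_integrable lebesgue K g" unfolding set_integrable_def
    by (subst integrable_completion) (use gm Kb in \<open>auto intro!: borel_measurable_scaleR borel_measurable_indicator\<close>)
next
  fix \<phi> assume t: "test_fun \<phi>"
  have Fm: "F \<in> borel_measurable borel" by (rule borel_measurable_continuous_onI[OF contF])
  note pd = test_fun_derivative(1)[OF t]
  have pc: "continuous_on UNIV \<phi>" and dc: "continuous_on UNIV (dpar v \<phi>)" using test_fun_derivative[OF t] by auto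
  have pm: "\<phi> \<in> borel_measurable borel" and dm: "dpar v \<phi> \<in> borel_measurable borel"
    using borel_measurable_continuous_onI pc dc by auto
  define S where "S = closure {z. \<phi> z \<noteq> 0}"
  have cS: "compact S" using t by (simp add: test_fun_def S_def)
  obtain R where "\<forall>y\<in>S. dist 0 y \<le> R"
    using compact_imp_bounded[OF cS] unfolding bounded_any_center[of _ 0] by (elim exE)
  then have R0: "S \<subseteq> cball 0 R" by (auto simp: subset_iff)
  have out: "\<phi> z = 0" if "z \<notin> cball 0 R" for z
    using that R0 closure_subset[of "{z. \<phi> z \<noteq> 0}"] by (auto simp: S_def)
  have pcpt: "compact (\<phi> ` cball 0 R)" by (intro compact_continuous_image continuous_on_subset[OF pc]) auto
  obtain P where P: "0 \<le> P" "\<And>z. \<bar>\<phi> z\<bar> \<le> P"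
  proof -
    obtain P where "\<And>w. w \<in> \<phi> ` cball 0 R \<Longrightarrow> norm w \<le> P" using compact_imp_bounded[OF pcpt] bounded_iff by metis
    then have "\<bar>\<phi> z\<bar> \<le> max P 0" for z using out[of z] by (cases "z \<in> cball 0 R") (force simp: le_max_iff_disj)+
    then show thesis using that[of "max P 0"] by simp
  qed
  have "compact (dpar v \<phi> ` cball 0 (R + 2))" by (intro compact_continuous_image continuous_on_subset[OF dc]) auto
  then obtain L where L: "\<And>z. z \<in> cball 0 (R + 2) \<Longrightarrow> \<bar>dpar v \<phi> z\<bar> \<le> L"
    using compact_imp_bounded bounded_iff by (metis imageI real_norm_def)
  obtain C where C: "0 \<le> C" "\<And>z h. Im z \<noteq> 0 \<Longrightarrow> norm z \<le> R \<Longrightarrow> 0 < h \<Longrightarrow> h \<le> 1 \<Longrightarrow>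
        norm (F z - F (z - of_real h * v)) \<le> C * h * \<bar>Im z\<bar> powr (- (1 / 4))" using inc[of R] by blast
  define h where "h n = 1 / real (Suc n)" for n
  have h: "0 < h n" "h n \<le> 1" for n by (auto simp: h_def)
  have hl: "h \<longlonglongrightarrow> 0" unfolding h_def[abs_def] using LIMSEQ_inverse_real_of_nat by (simp add: inverse_eq_divide)
  have hat: "filterlim h (at 0) sequentially"
    unfolding filterlim_at using hl h by (auto intro!: always_eventually simp: less_imp_neq[symmetric])
  define A where "A n z = of_real ((\<phi> (z + of_real (h n) * v) - \<phi> z) / h n) * F z" for n z
  define B where "B n z = of_real (\<phi> z) * ((F z - F (z - of_real (h n) * v)) / of_real (h n))" for n z
  have cpt_int: "integrable lborel (\<lambda>z. q z)" if "continuous_on UNIV q" "\<And>z. z \<notin> cball 0 r \<Longrightarrow> q z = 0"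
    for q :: "complex \<Rightarrow> complex" and r
  proof -
    have "integrable lborel (\<lambda>z. indicator (cball 0 r) z *\<^sub>R q z)"
      by (rule borel_integrable_compact[OF compact_cball continuous_on_subset[OF that(1)]]) simp
    moreover have "(\<lambda>z. indicator (cball 0 r) z *\<^sub>R q z) = q" using that(2) by (auto simp: indicator_def)
    ultimately show ?thesis by simp
  qed
  have sh: "continuous_on UNIV (\<lambda>z. q (c + z))" if "continuous_on UNIV q" for q :: "complex \<Rightarrow> 'b::topological_space" and c
    by (intro continuous_on_compose2[OF that] continuous_intros) auto
  text \<open>translation invariance of Lebesgue measure moves the difference quotient from \<open>\<phi>\<close> to \<open>F\<close>\<close>
  have AB: "integral\<^sup>L lborel (A n) = - integral\<^sup>L lborel (B n)" for n
  proof -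
    define c where "c = of_real (h n) * v"
    define q where "q z = of_real (\<phi> z) * F (z - c)" for z
    have Fs: "continuous_on UNIV (\<lambda>z. F (z - c))" using sh[OF contF, of "- c"] by simp
    have cq: "continuous_on UNIV q" unfolding q_def by (intro continuous_intros pc Fs)
    have q0: "q z = 0" if "z \<notin> cball 0 R" for z using out[OF that] by (simp add: q_def)
    have iq: "integrable lborel q" by (rule cpt_int[OF cq q0])
    define p where "p z = of_real (\<phi> z) * F z" for z
    have cp: "continuous_on UNIV p" unfolding p_def by (intro continuous_intros pc contF)
    have ip: "integrable lborel p" by (rule cpt_int[OF cp, of R]) (use out in \<open>simp add: p_def\<close>)
    have qm: "q \<in> borel_measurable borel" by (rule borel_measurable_continuous_onI[OF cq])
    have An: "A n = (\<lambda>z. (q (c + z) - p z) / of_real (h n))"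
      by (auto simp: A_def q_def p_def c_def add.commute field_simps fun_eq_iff)
    have Bn: "B n = (\<lambda>z. (p z - q z) / of_real (h n))"
      by (auto simp: B_def q_def p_def c_def algebra_simps diff_divide_distrib fun_eq_iff)
    have "integral\<^sup>L lborel (A n) = (integral\<^sup>L lborel (\<lambda>z. q (c + z)) - integral\<^sup>L lborel p) / of_real (h n)"
      unfolding An using lborel_integral_shift(2)[OF qm iq] ip by simp
    also have "\<dots> = (integral\<^sup>L lborel q - integral\<^sup>L lborel p) / of_real (h n)"
      unfolding lborel_integral_shift(1)[OF qm] ..
    also have "\<dots> = - integral\<^sup>L lborel (B n)" unfolding Bn using ip iq by (simp add: diff_divide_distrib)
    finally show ?thesis .
  qed
  have Am: "A n \<in> borel_measurable lborel" for n
  proof -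
    have "continuous_on UNIV (A n)" unfolding A_def
      using sh[OF pc, of "of_real (h n) * v"] h[of n] by (auto intro!: continuous_intros pc contF simp: add.commute)
    then show ?thesis using borel_measurable_continuous_onI by simp
  qed
  have Bm: "B n \<in> borel_measurable lborel" for n
  proof -
    have "continuous_on UNIV (B n)" unfolding B_def
      using sh[OF contF, of "- (of_real (h n) * v)"] h[of n] by (auto intro!: continuous_intros pc contF)
    then show ?thesis using borel_measurable_continuous_onI by simp
  qed
  have Al: "(\<lambda>n. integral\<^sup>L lborel (A n)) \<longlonglongrightarrow> integral\<^sup>L lborel (\<lambda>z. of_real (dpar v \<phi> z) * F z)"
  proof (rule integral_dominated_convergence[where w = "\<lambda>z. L * norm (indicator (cball 0 (R + 1)) z *\<^sub>R F z)"])
    show "(\<lambda>z. of_real (dpar v \<phi> z) * F z) \<in> borel_measurable lborel" using dm Fm by simp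
    show "A n \<in> borel_measurable lborel" for n by (rule Am)
    show "integrable lborel (\<lambda>z. L * norm (indicator (cball 0 (R + 1)) z *\<^sub>R F z))"
      by (intro integrable_mult_right integrable_norm borel_integrable_compact compact_cball continuous_on_subset[OF contF]) simp
    show "AE z in lborel. (\<lambda>n. A n z) \<longlonglongrightarrow> of_real (dpar v \<phi> z) * F z"
    proof (intro AE_I2)
      fix z
      have "((\<lambda>t. (\<phi> (z + of_real t * v) - \<phi> z) / t) \<longlongrightarrow> dpar v \<phi> z) (at 0)"
        using pd[of z v 0] by (simp add: has_field_derivative_iff)
      from filterlim_compose[OF this hat]
      show "(\<lambda>n. A n z) \<longlonglongrightarrow> of_real (dpar v \<phi> z) * F z" unfolding A_def by (intro tendsto_intros)
    qed
    fix n
    show "AE z in lborel. norm (A n z) \<le> L * norm (indicator (cball 0 (R + 1)) z *\<^sub>R F z)"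
    proof (intro AE_I2)
      fix z
      have nv: "norm (of_real s * v) \<le> 1" if "0 \<le> s" "s \<le> h n" for s using that h[of n] v by (simp add: norm_mult)
      show "norm (A n z) \<le> L * norm (indicator (cball 0 (R + 1)) z *\<^sub>R F z)"
      proof (cases "z \<in> cball 0 (R + 1)")
        case True
        \<comment> \<open>The mean value theorem bounds the quotient of \<open>\<phi>\<close> by its
          derivative on the ball of radius \<open>R + 2\<close>, since the steps have length at most
          1.\<close>
        have "\<exists>s. 0 < s \<and> s < h n \<and> \<phi> (z + of_real (h n) * v) - \<phi> (z + of_real 0 * v) = (h n - 0) * dpar v \<phi> (z + of_real s * v)"
          by (rule MVT2[OF h(1)]) (rule pd)
        then obtain s where s: "0 < s" "s < h n" "\<phi> (z + of_real (h n) * v) - \<phi> z = h n * dpar v \<phi> (z + of_real s * v)" by auto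
        have "norm (z + of_real s * v) \<le> R + 2" using norm_triangle_ineq[of z "of_real s * v"] nv[of s] s True by simp
        then have "\<bar>dpar v \<phi> (z + of_real s * v)\<bar> \<le> L" by (intro L) simp
        moreover have "norm (A n z) = \<bar>dpar v \<phi> (z + of_real s * v)\<bar> * norm (F z)"
          unfolding A_def s(3) using h(1)[of n] by (simp add: norm_mult)
        ultimately show ?thesis using True by (simp add: mult_right_mono)
      next
        case False
        have "z + of_real (h n) * v \<notin> cball 0 R"
        proof
          assume "z + of_real (h n) * v \<in> cball 0 R"
          then have "norm z \<le> R + 1"
            using norm_triangle_ineq4[of "z + of_real (h n) * v" "of_real (h n) * v"] nv[of "h n"] h(1)[of n] by simp
          then show False using False by simp
        qed
        moreover have "z \<notin> cball 0 R" using False by simp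
        ultimately have "A n z = 0" using out unfolding A_def by simp
        then show ?thesis using False by simp
      qed
    qed
  qed
  have Bl: "(\<lambda>n. integral\<^sup>L lborel (B n)) \<longlonglongrightarrow> integral\<^sup>L lborel (\<lambda>z. of_real (\<phi> z) * g z)"
  proof (rule integral_dominated_convergence[where w = "\<lambda>z. P * C * (indicator (cball (0::complex) R) z *\<^sub>R (\<bar>Im z\<bar> powr (- (1 / 4))))"])
    show "(\<lambda>z. of_real (\<phi> z) * g z) \<in> borel_measurable lborel" using pm gm by simp
    show "B n \<in> borel_measurable lborel" for n by (rule Bm)
    show "integrable lborel (\<lambda>z. P * C * (indicator (cball (0::complex) R) z *\<^sub>R (\<bar>Im z\<bar> powr (- (1 / 4)))))"
      by (intro integrable_mult_right integrable_Im_powr) auto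
    show "AE z in lborel. (\<lambda>n. B n z) \<longlonglongrightarrow> of_real (\<phi> z) * g z"
      using AE_Im_nonzero
    proof eventually_elim
      case (elim z)
      \<comment> \<open>The shift produces backward differences, so the derivative of
        \<open>F\<close> is reached along negative steps.\<close>
      have hm: "filterlim (\<lambda>n. - h n) (at 0) sequentially"
        unfolding filterlim_at using tendsto_minus[OF hl] h by (auto intro!: always_eventually simp: less_imp_neq[symmetric])
      have "((\<lambda>t. (F (z + of_real t * v) - F z) /\<^sub>R t) \<longlongrightarrow> g z) (at 0)"
      proof -
        have "((\<lambda>y. (F (z + of_real y * v) - F (z + of_real 0 * v) - (y - 0) *\<^sub>R g z) /\<^sub>R norm (y - 0)) \<longlongrightarrow> 0) (at 0)"
          using lim[OF elim] unfolding has_vector_derivative_def has_derivative_at_within by simp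
        then have "((\<lambda>y. (F (z + of_real y * v) - F z - y *\<^sub>R g z) /\<^sub>R norm y) \<longlongrightarrow> 0) (at 0)"
          by simp
        then have "((\<lambda>y. norm ((F (z + of_real y * v) - F z - y *\<^sub>R g z) /\<^sub>R norm y)) \<longlongrightarrow> 0) (at 0)"
          by (rule tendsto_norm_zero)
        moreover have "\<forall>\<^sub>F y in at (0::real). norm ((F (z + of_real y * v) - F z - y *\<^sub>R g z) /\<^sub>R norm y)
            = norm ((F (z + of_real y * v) - F z) /\<^sub>R y - g z)"
        proof -
          have "norm ((w - y *\<^sub>R g z) /\<^sub>R norm y) = norm (w /\<^sub>R y - g z)" if "y \<noteq> 0" for y :: real and w
          proof -
            have "w /\<^sub>R y - g z = (w - y *\<^sub>R g z) /\<^sub>R y" using that by (simp add: scaleR_diff_right)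
            then show ?thesis by simp
          qed
          then show ?thesis by (simp add: eventually_at_filter)
        qed
        ultimately have "((\<lambda>y. norm ((F (z + of_real y * v) - F z) /\<^sub>R y - g z)) \<longlongrightarrow> 0) (at 0)"
          by (rule Lim_transform_eventually)
        then show ?thesis by (rule LIM_zero_cancel[OF tendsto_norm_zero_cancel])
      qed
      from filterlim_compose[OF this hm]
      have "(\<lambda>n. (F (z - of_real (h n) * v) - F z) /\<^sub>R (- h n)) \<longlonglongrightarrow> g z" by simp
      moreover have "(F (z - of_real (h n) * v) - F z) /\<^sub>R (- h n) = (F z - F (z - of_real (h n) * v)) / of_real (h n)" for n
        by (simp add: scaleR_conv_of_real divide_inverse algebra_simps)
      ultimately have "(\<lambda>n. (F z - F (z - of_real (h n) * v)) / of_real (h n)) \<longlonglongrightarrow> g z" by simp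
      then show ?case unfolding B_def by (intro tendsto_intros)
    qed
    fix n
    show "AE z in lborel. norm (B n z) \<le> P * C * (indicator (cball 0 R) z *\<^sub>R (\<bar>Im z\<bar> powr (- (1 / 4))))"
      using AE_Im_nonzero
    proof eventually_elim
      case (elim z)
      show ?case
      proof (cases "z \<in> cball 0 R")
        case True
        have "norm (F z - F (z - of_real (h n) * v)) \<le> C * h n * \<bar>Im z\<bar> powr (- (1 / 4))"
          by (rule C(2)[OF elim _ h]) (use True in simp)
        then have "norm (F z - F (z - of_real (h n) * v)) / h n \<le> C * \<bar>Im z\<bar> powr (- (1 / 4))"
          using h(1)[of n] by (simp add: pos_divide_le_eq mult_ac)
        then have "\<bar>\<phi> z\<bar> * (norm (F z - F (z - of_real (h n) * v)) / h n) \<le> P * (C * \<bar>Im z\<bar> powr (- (1 / 4)))"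
          using P h(1)[of n] by (intro mult_mono) auto
        then show ?thesis using True h(1)[of n] by (simp add: B_def norm_mult norm_divide)
      next
        case False
        then show ?thesis using out[OF False] by (simp add: B_def)
      qed
    qed
  qed
  have "integral\<^sup>L lborel (\<lambda>z. of_real (dpar v \<phi> z) * F z) = - integral\<^sup>L lborel (\<lambda>z. of_real (\<phi> z) * g z)"
    using LIMSEQ_unique[OF Al] tendsto_minus[OF Bl] unfolding AB by blast
  then show "integral\<^sup>L lebesgue (\<lambda>z. of_real (dpar v \<phi> z) * F z) = - integral\<^sup>L lebesgue (\<lambda>z. of_real (\<phi> z) * g z)"
    by (subst (1 2) integral_completion) (use dm pm Fm gm in auto)
qed

section \<open>The extension to the lower half-plane\<close>

text \<open>\<open>4 / 3 * \<eta> powr (3 / 4)\<close> is a primitive of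
  \<open>\<eta> powr (- (1 / 4))\<close>. The point is to keep the weight at the upper end
  \<open>y\<close> even if the interval crosses 0. Below 0 the interval points away from the
  singularity; above 0 concavity of the primitive is enough; otherwise 0 splits it into two parts of
  length at most \<open>h\<close>, and \<open>\<bar>y\<bar> < h\<close>.\<close>

lemma increment_across_zero:
  fixes G G' :: "real \<Rightarrow> complex"
  assumes cont: "continuous_on UNIV G" and der: "\<And>\<eta>. \<eta> \<noteq> 0 \<Longrightarrow> (G has_vector_derivative G' \<eta>) (at \<eta>)"
    and bd: "\<And>\<eta>. \<eta> \<noteq> 0 \<Longrightarrow> \<bar>\<eta>\<bar> \<le> \<rho> \<Longrightarrow> norm (G' \<eta>) \<le> M * \<bar>\<eta>\<bar> powr (- (1 / 4))"
    and M: "0 \<le> M" and y: "y \<noteq> 0" "\<bar>y\<bar> + 1 \<le> \<rho>" and h: "0 < h" "h \<le> 1"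
  shows "norm (G y - G (y - h)) \<le> 4 * M * h * \<bar>y\<bar> powr (- (1 / 4))"
proof -
  define \<phi> where "\<phi> \<eta> = 4 / 3 * M * \<eta> powr (3 / 4)" for \<eta> :: real
  have phid: "(\<phi> has_vector_derivative M * \<eta> powr (- (1 / 4))) (at \<eta>)" if "0 < \<eta>" for \<eta>
  proof -
    have "(\<phi> has_real_derivative 4 / 3 * M * (3 / 4 * \<eta> powr (3 / 4 - 1))) (at \<eta>)"
      unfolding \<phi>_def using that by (auto intro!: derivative_eq_intros)
    then show ?thesis by (simp add: has_real_derivative_iff_has_vector_derivative)
  qed
  have phic: "continuous_on A \<phi>" if "A \<subseteq> {0..}" for A
    unfolding \<phi>_def using that by (intro continuous_on_mult_left continuous_on_powr' continuous_on_id continuous_on_const) auto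
  have pos: "norm (G b - G a) \<le> \<phi> b - \<phi> a" if "0 \<le> a" "a < b" "b \<le> \<rho>" for a b
  proof (rule differentiable_bound_general[OF that(2), where f' = G' and \<phi>' = "\<lambda>\<eta>. M * \<eta> powr (- (1 / 4))"])
    show "continuous_on {a..b} G" by (rule continuous_on_subset[OF cont]) simp
    show "continuous_on {a..b} \<phi>" using that by (intro phic) auto
    fix x assume x: "a < x" "x < b"
    show "(G has_vector_derivative G' x) (at x)" using x that by (intro der) auto
    show "(\<phi> has_vector_derivative M * x powr (- (1 / 4))) (at x)" using x that by (intro phid) auto
    show "norm (G' x) \<le> M * x powr (- (1 / 4))" using bd[of x] x that by simp
  qed
  have neg: "norm (G 0 - G (- a)) \<le> \<phi> a" if a: "0 < a" "a \<le> \<rho>" for a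
  proof -
    have "norm (G (- 0) - G (- a)) = norm (G (- a) - G (- 0))" by (rule norm_minus_commute)
    also have "\<dots> \<le> \<phi> a - \<phi> 0"
    proof (rule differentiable_bound_general[OF a(1), where f = "\<lambda>t. G (- t)" and f' = "\<lambda>t. - G' (- t)" and \<phi>' = "\<lambda>\<eta>. M * \<eta> powr (- (1 / 4))"])
      show "continuous_on {0..a} (\<lambda>t. G (- t))" by (intro continuous_on_compose2[OF cont] continuous_intros) auto
      show "continuous_on {0..a} \<phi>" by (intro phic) auto
      fix x assume x: "0 < x" "x < a"
      have "((\<lambda>t. - t) has_real_derivative -1) (at x)" by (auto intro!: derivative_eq_intros)
      then have "((\<lambda>t. - t) has_vector_derivative -1) (at x)" by (simp add: has_real_derivative_iff_has_vector_derivative)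
      from vector_diff_chain_at[OF this, of G "G' (- x)"] der[of "- x"] x
      show "((\<lambda>t. G (- t)) has_vector_derivative - G' (- x)) (at x)" by (simp add: o_def)
      show "(\<phi> has_vector_derivative M * x powr (- (1 / 4))) (at x)" using x by (intro phid) auto
      show "norm (- G' (- x)) \<le> M * x powr (- (1 / 4))" using bd[of "- x"] x a by simp
    qed
    finally show ?thesis by (simp add: \<phi>_def)
  qed
  have mono: "\<phi> a \<le> 4 / 3 * M * h * \<bar>y\<bar> powr (- (1 / 4))" if "0 \<le> a" "a \<le> h" "\<bar>y\<bar> \<le> h" for a
  proof -
    have "a powr (3 / 4) \<le> h powr (3 / 4)" using that h by (intro powr_mono2) auto
    also have "\<dots> = h * h powr (- (1 / 4))" using h powr_add[of h 1 "- (1 / 4)"] by simp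
    also have "\<dots> \<le> h * \<bar>y\<bar> powr (- (1 / 4))" using that h y by (intro mult_left_mono powr_mono2') auto
    finally have "4 / 3 * M * a powr (3 / 4) \<le> 4 / 3 * M * (h * \<bar>y\<bar> powr (- (1 / 4)))" using M by (intro mult_left_mono) auto
    then show ?thesis by (simp add: \<phi>_def mult_ac)
  qed
  have Q: "0 \<le> M * h * \<bar>y\<bar> powr (- (1 / 4))" using M h by simp
  consider "y < 0" | "0 < y" "h \<le> y" | "0 < y" "y < h" using y by linarith
  then show ?thesis
  proof cases
    case 1
    have "norm (G y - G (y - h)) \<le> (M * \<bar>y\<bar> powr (- (1 / 4))) * y - (M * \<bar>y\<bar> powr (- (1 / 4))) * (y - h)"
    proof (rule differentiable_bound_general[where f' = G' and \<phi>' = "\<lambda>\<eta>. M * \<bar>y\<bar> powr (- (1 / 4))"])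
      show "y - h < y" using h by simp
      show "continuous_on {y - h..y} G" by (rule continuous_on_subset[OF cont]) simp
      show "continuous_on {y - h..y} ((*) (M * \<bar>y\<bar> powr (- (1 / 4))))" by (intro continuous_intros)
      fix x assume x: "y - h < x" "x < y"
      show "(G has_vector_derivative G' x) (at x)" using x 1 by (intro der) auto
      show "((*) (M * \<bar>y\<bar> powr (- (1 / 4))) has_vector_derivative M * \<bar>y\<bar> powr (- (1 / 4))) (at x)"
        unfolding has_real_derivative_iff_has_vector_derivative[symmetric] by (rule DERIV_cmult_Id)
      have "norm (G' x) \<le> M * \<bar>x\<bar> powr (- (1 / 4))" using x 1 y h by (intro bd) auto
      also have "\<dots> \<le> M * \<bar>y\<bar> powr (- (1 / 4))" using x 1 M by (intro mult_left_mono powr_mono2') auto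
      finally show "norm (G' x) \<le> M * \<bar>y\<bar> powr (- (1 / 4))" .
    qed
    also have "\<dots> = M * h * \<bar>y\<bar> powr (- (1 / 4))" by (simp add: algebra_simps)
    finally show ?thesis using Q by linarith
  next
    case 2
    have "norm (G y - G (y - h)) \<le> \<phi> y - \<phi> (y - h)" by (rule pos) (use 2 h y in auto)
    also have "\<dots> = 4 / 3 * M * (y powr (3 / 4) - (y - h) powr (3 / 4))" by (simp add: \<phi>_def algebra_simps)
    also have "\<dots> \<le> 4 / 3 * M * (h * y powr (- (1 / 4)))"
    proof (rule mult_left_mono)
      define r where "r = (y - h) / y"
      have r: "0 \<le> r" "r \<le> 1" using 2 h by (auto simp: r_def)
      have "r \<le> r powr (3 / 4)" using r powr_mono'[of "3/4" 1 r] by (cases "r = 0") auto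
      then have "y powr (3 / 4) * r \<le> y powr (3 / 4) * r powr (3 / 4)" by (intro mult_left_mono) auto
      also have "\<dots> = (y - h) powr (3 / 4)" using 2 r by (simp add: r_def flip: powr_mult)
      finally have "y powr (3 / 4) - (y - h) powr (3 / 4) \<le> y powr (3 / 4) * (1 - r)" by (simp add: algebra_simps)
      also have "\<dots> = y powr (3 / 4) * (h / y)" using 2 by (simp add: r_def field_simps)
      also have "\<dots> = h * y powr (- (1 / 4))" using 2 powr_diff[of y "3/4" 1] by simp
      finally show "y powr (3 / 4) - (y - h) powr (3 / 4) \<le> h * y powr (- (1 / 4))" .
    qed (use M in simp)
    finally show ?thesis using Q 2 by simp
  next
    case 3
    have "norm (G y - G 0) \<le> \<phi> y - \<phi> 0" by (rule pos) (use 3 y in auto)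
    then have a: "norm (G y - G 0) \<le> \<phi> y" by (simp add: \<phi>_def)
    have b: "norm (G 0 - G (- (h - y))) \<le> \<phi> (h - y)" by (rule neg) (use 3 h y in auto)
    have "norm (G y - G (y - h)) \<le> norm (G y - G 0) + norm (G 0 - G (- (h - y)))"
      using norm_triangle_ineq[of "G y - G 0" "G 0 - G (- (h - y))"] by simp
    also have "\<dots> \<le> \<phi> y + \<phi> (h - y)" using a b by linarith
    also have "\<dots> \<le> 2 * (4 / 3 * M * h * \<bar>y\<bar> powr (- (1 / 4)))" using mono[of y] mono[of "h - y"] 3 by simp
    finally show ?thesis using Q by simp
  qed
qed

context bloch_map
begin

text \<open>Below the real line this is the first-order Taylor polynomial of \<open>f\<close> at the
  reflected point, Becker's extension of a conformal map of a half-plane.\<close>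

definition reflect :: "complex \<Rightarrow> complex" where
  "reflect z = (if 0 \<le> Im z then ext z else f (cnj z) + deriv f (cnj z) * (z - cnj z))"

text \<open>The derivative of \<open>reflect\<close> in the direction \<open>v\<close> off the real
  line. On the line the value is 0 because \<open>0 powr a = 0\<close>; so the bound by a power of
  \<open>\<bar>Im z\<bar>\<close> holds at every point.\<close>

definition reflect_d :: "complex \<Rightarrow> complex \<Rightarrow> complex" where
  "reflect_d v z = (if 0 < Im z then deriv f z * v
     else if Im z < 0 then deriv f (cnj z) * v + deriv (deriv f) (cnj z) * cnj v * (z - cnj z) else 0)"

text \<open>The Taylor term is at most a multiple of
  \<open>\<bar>Im z\<bar> powr (1 - \<delta>)\<close>, so it vanishes at the real line and the two
  halves fit together.\<close>

lemma reflect_continuous: "continuous_on UNIV reflect"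
proof -
  define E where "E z = (if Im z < 0 then deriv f (cnj z) * (z - cnj z) else 0)" for z
  have lower: "reflect z = ext (cnj z) + E z" if "Im z \<le> 0" for z
  proof (cases "Im z = 0")
    case True
    then have "cnj z = z" by (simp add: complex_eq_iff)
    then show ?thesis using True by (simp add: reflect_def E_def)
  next
    case False
    then show ?thesis using that by (simp add: reflect_def E_def ext_eq)
  qed
  have cE: "continuous_on {z. Im z \<le> 0} E"
    unfolding continuous_on_eq_continuous_within
  proof
    fix z0 assume z0: "z0 \<in> {z. Im z \<le> 0}"
    show "continuous (at z0 within {z. Im z \<le> 0}) E"
    proof (cases "Im z0 < 0")
      case True
      have "continuous_on {z. Im z < 0} E"
      proof (rule continuous_on_eq)
        have c: "continuous_on uhp (deriv f)" by (rule holomorphic_on_imp_continuous_on[OF holomorphic_deriv[OF hol open_uhp]])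
        show "continuous_on {z. Im z < 0} (\<lambda>z. deriv f (cnj z) * (z - cnj z))"
          by (intro continuous_intros continuous_on_compose2[OF c]) auto
      qed (simp add: E_def)
      then have "continuous (at z0) E"
        using True open_halfspace_Im_lt[of 0] by (simp add: continuous_on_eq_continuous_at)
      then show ?thesis by (rule continuous_at_imp_continuous_at_within)
    next
      case False
      then have I0: "Im z0 = 0" using z0 by simp
      define R where "R = norm z0 + 1"
      obtain M where M: "0 < M" "\<And>z. z \<in> uhp \<Longrightarrow> \<bar>Re z\<bar> \<le> R \<Longrightarrow> Im z \<le> R \<Longrightarrow> norm (deriv f z) \<le> M * Im z powr (- \<delta>)"
        by (rule deriv_bound_box[of R]) (simp add: R_def, rule that)
      have "(E \<longlongrightarrow> 0) (at z0 within {z. Im z \<le> 0})"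
      proof (rule Lim_null_comparison)
        show "\<forall>\<^sub>F z in at z0 within {z. Im z \<le> 0}. norm (E z) \<le> 2 * M * \<bar>Im z\<bar> powr (1 - \<delta>)"
          unfolding eventually_at
        proof (intro exI[of _ 1] conjI ballI impI)
          fix z assume z: "z \<in> {z. Im z \<le> 0}" "z \<noteq> z0 \<and> dist z z0 < 1"
          show "norm (E z) \<le> 2 * M * \<bar>Im z\<bar> powr (1 - \<delta>)"
          proof (cases "Im z < 0")
            case True
            have "norm z \<le> R" using z(2) norm_triangle_sub[of z z0] by (simp add: R_def dist_norm)
            then have "norm (deriv f (cnj z)) \<le> M * Im (cnj z) powr (- \<delta>)"
              using True abs_Re_le_cmod[of z] abs_Im_le_cmod[of z] by (intro M(2)) auto
            then have "norm (deriv f (cnj z)) * (2 * \<bar>Im z\<bar>) \<le> (M * \<bar>Im z\<bar> powr (- \<delta>)) * (2 * \<bar>Im z\<bar>)"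
              using True by (intro mult_right_mono) auto
            also have "\<dots> = 2 * M * (\<bar>Im z\<bar> powr (- \<delta>) * \<bar>Im z\<bar> powr 1)"
              unfolding powr_one[OF abs_ge_zero] by (simp only: mult_ac)
            also have "\<dots> = 2 * M * \<bar>Im z\<bar> powr (1 - \<delta>)"
              unfolding powr_add[symmetric] by (simp only: uminus_add_conv_diff)
            finally have "norm (deriv f (cnj z)) * (2 * \<bar>Im z\<bar>) \<le> 2 * M * \<bar>Im z\<bar> powr (1 - \<delta>)" .
            moreover have "norm (E z) = norm (deriv f (cnj z)) * (2 * \<bar>Im z\<bar>)"
              using True by (simp add: E_def norm_mult complex_diff_cnj)
            ultimately show ?thesis by simp
          qed (use M(1) in \<open>simp add: E_def\<close>)
        qed simp
        have "((\<lambda>z. \<bar>Im z\<bar> powr (1 - \<delta>)) \<longlongrightarrow> 0) (at z0 within {z. Im z \<le> 0})"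
        proof (rule tendsto_zero_powrI[where b = "1 - \<delta>"])
          have "((\<lambda>z. \<bar>Im z\<bar>) \<longlongrightarrow> \<bar>Im z0\<bar>) (at z0 within {z. Im z \<le> 0})" by (intro tendsto_intros)
          then show "((\<lambda>z. \<bar>Im z\<bar>) \<longlongrightarrow> 0) (at z0 within {z. Im z \<le> 0})" using I0 by simp
        qed (use d in auto)
        from tendsto_mult_right_zero[OF this, of "2 * M"]
        show "((\<lambda>z. 2 * M * \<bar>Im z\<bar> powr (1 - \<delta>)) \<longlongrightarrow> 0) (at z0 within {z. Im z \<le> 0})" .
      qed
      then show ?thesis using I0 by (simp add: continuous_within E_def)
    qed
  qed
  have "continuous_on {z. Im z \<le> 0} (\<lambda>z. ext (cnj z) + E z)"
    by (intro continuous_intros cE continuous_on_compose2[OF ext_continuous]) auto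
  then have "continuous_on {z. Im z \<le> 0} reflect" by (rule continuous_on_eq) (simp add: lower)
  moreover have "continuous_on {z. 0 \<le> Im z} reflect" using ext_continuous by (rule continuous_on_eq) (simp add: reflect_def)
  ultimately have "continuous_on ({z. Im z \<le> 0} \<union> {z. 0 \<le> Im z}) reflect"
    by (intro continuous_on_closed_Un closed_halfspace_Im_le closed_halfspace_Im_ge)
  moreover have "{z. Im z \<le> 0} \<union> {z. 0 \<le> Im z} = UNIV" by auto
  ultimately show ?thesis by simp
qed

lemma reflect_derivative:
  assumes z: "Im z \<noteq> 0"
  shows "((\<lambda>t. reflect (z + of_real t * v)) has_vector_derivative reflect_d v z) (at 0)"
proof -
  have line: "((\<lambda>t. c + of_real t * v) has_vector_derivative v) (at 0)" for c v :: complex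
    unfolding has_vector_derivative_def by (auto intro!: derivative_eq_intros simp: scaleR_conv_of_real)
  have op: "open {t. P (Im (z + of_real t * v))}" if "open {x. P x}" for P
  proof -
    have "open ((\<lambda>t. Im (z + of_real t * v)) -` {x. P x})" by (intro open_vimage[OF that] continuous_intros)
    then show ?thesis by (simp add: vimage_def)
  qed
  have half: "open {x::real. 0 < x}" "open {x::real. x < 0}"
    using open_greaterThan[of "0::real"] open_lessThan[of "0::real"] by (simp_all add: greaterThan_def lessThan_def)
  show ?thesis
  proof (cases "0 < Im z")
    case True
    have "((\<lambda>t. f (z + of_real t * v)) has_vector_derivative v * deriv f z) (at 0)"
      using field_vector_diff_chain_at[OF line, of f "deriv f z" z v] has_deriv_second_deriv(1)[of z] True by (simp add: o_def)
    then have "((\<lambda>t. reflect (z + of_real t * v)) has_vector_derivative v * deriv f z) (at 0)"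
      by (rule has_vector_derivative_transform_within_open[OF _ op[of "\<lambda>x. 0 < x", OF half(1)]])
        (use True in \<open>auto simp: reflect_def ext_eq\<close>)
    then show ?thesis using True by (simp add: reflect_d_def mult.commute)
  next
    case False
    then have L: "Im z < 0" using z by simp
    define w where "w = cnj z"
    have w: "w \<in> uhp" using L by (simp add: w_def)
    have 1: "((\<lambda>t. f (w + of_real t * cnj v)) has_vector_derivative cnj v * deriv f w) (at 0)"
      using field_vector_diff_chain_at[OF line, of f "deriv f w" w "cnj v"] has_deriv_second_deriv(1)[OF w] by (simp add: o_def)
    have 2: "((\<lambda>t. deriv f (w + of_real t * cnj v)) has_vector_derivative cnj v * deriv (deriv f) w) (at 0)"
      using field_vector_diff_chain_at[OF line, of "deriv f" "deriv (deriv f) w" w "cnj v"] has_deriv_second_deriv(2)[OF w] by (simp add: o_def)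
    have 3: "((\<lambda>t. (z - w) + of_real t * (v - cnj v)) has_vector_derivative (v - cnj v)) (at 0)" by (rule line)
    have "((\<lambda>t. f (w + of_real t * cnj v) + deriv f (w + of_real t * cnj v) * ((z - w) + of_real t * (v - cnj v)))
        has_vector_derivative (cnj v * deriv f w + (deriv f (w + of_real 0 * cnj v) * (v - cnj v)
          + (cnj v * deriv (deriv f) w) * ((z - w) + of_real 0 * (v - cnj v))))) (at 0)"
      by (rule has_vector_derivative_add[OF 1 has_vector_derivative_mult[OF 2 3]])
    also have "cnj v * deriv f w + (deriv f (w + of_real 0 * cnj v) * (v - cnj v)
          + (cnj v * deriv (deriv f) w) * ((z - w) + of_real 0 * (v - cnj v))) = reflect_d v z"
      using L by (simp add: reflect_d_def w_def algebra_simps)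
    finally show ?thesis
      by (rule has_vector_derivative_transform_within_open[OF _ op[of "\<lambda>x. x < 0", OF half(2)]])
        (use L in \<open>auto simp: reflect_def w_def algebra_simps\<close>)
  qed
qed

lemma reflect_derivative_at:
  assumes z: "Im (z + of_real t * v) \<noteq> 0"
  shows "((\<lambda>t. reflect (z + of_real t * v)) has_vector_derivative reflect_d v (z + of_real t * v)) (at t)"
proof -
  have "((\<lambda>s. s - t) has_real_derivative 1) (at t)" by (auto intro!: derivative_eq_intros)
  then have "((\<lambda>s. s - t) has_vector_derivative 1) (at t)" by (simp add: has_real_derivative_iff_has_vector_derivative)
  from vector_diff_chain_at[OF this, of "\<lambda>s. reflect ((z + of_real t * v) + of_real s * v)" "reflect_d v (z + of_real t * v)"] reflect_derivative[OF z, of v]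
  show ?thesis by (simp add: o_def algebra_simps)
qed

text \<open>The second derivative is absorbed by the hyperbolic estimate \<open>bl\<close>.
  Weakening the exponent \<open>\<delta>\<close> to the fixed 1/4 gives a bound whose square is
  still covered by \<open>integrable_Im_powr\<close>.\<close>

lemma reflect_d_bound:
  assumes v: "norm v = 1"
  shows "\<exists>M\<ge>0. \<forall>z. norm z \<le> R \<longrightarrow> norm (reflect_d v z) \<le> M * \<bar>Im z\<bar> powr (- (1 / 4))"
proof -
  define R' where "R' = max 1 R"
  have R': "1 \<le> R'" "R \<le> R'" by (auto simp: R'_def)
  obtain M where M: "0 < M" "\<And>z. z \<in> uhp \<Longrightarrow> \<bar>Re z\<bar> \<le> R' \<Longrightarrow> Im z \<le> R' \<Longrightarrow> norm (deriv f z) \<le> M * Im z powr (- \<delta>)"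
    by (rule deriv_bound_box[OF R'(1)]) (rule that)
  have db: "norm (deriv f w) \<le> (M * R') * Im w powr (- (1 / 4))" if w: "w \<in> uhp" "norm w \<le> R" for w
  proof -
    have b: "\<bar>Re w\<bar> \<le> R'" "Im w \<le> R'" using w R' abs_Re_le_cmod[of w] abs_Im_le_cmod[of w] by auto
    have "Im w powr (- \<delta>) = Im w powr (1 / 4 - \<delta>) * Im w powr (- (1 / 4))" by (simp flip: powr_add)
    also have "\<dots> \<le> R' * Im w powr (- (1 / 4))"
    proof (rule mult_right_mono)
      have "Im w powr (1 / 4 - \<delta>) \<le> R' powr (1 / 4 - \<delta>)" using b w d by (intro powr_mono2) auto
      also have "\<dots> \<le> R' powr 1" using R' d by (intro powr_mono) auto
      finally show "Im w powr (1 / 4 - \<delta>) \<le> R'" using R' by simp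
    qed simp
    finally have "M * Im w powr (- \<delta>) \<le> M * (R' * Im w powr (- (1 / 4)))" using M(1) by (intro mult_left_mono) auto
    then show ?thesis using M(2)[OF w(1) b] by (simp add: mult.assoc)
  qed
  have "norm (reflect_d v z) \<le> 2 * (M * R') * \<bar>Im z\<bar> powr (- (1 / 4))" if z: "norm z \<le> R" for z
  proof -
    consider "0 < Im z" | "Im z < 0" | "Im z = 0" by linarith
    then show ?thesis
    proof cases
      case 1
      then have "norm (reflect_d v z) = norm (deriv f z)" using v by (simp add: reflect_d_def norm_mult)
      moreover have "norm (deriv f z) \<le> (M * R') * Im z powr (- (1 / 4))" using db[of z] z 1 by simp
      moreover have "0 \<le> (M * R') * Im z powr (- (1 / 4))" using M(1) R' by simp
      ultimately have "norm (reflect_d v z) \<le> 2 * ((M * R') * Im z powr (- (1 / 4)))" by linarith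
      then show ?thesis using 1 by (simp add: mult.assoc)
    next
      case 2
      let ?w = "cnj z"
      have w: "?w \<in> uhp" "norm ?w \<le> R" using 2 z by auto
      have "norm (reflect_d v z) \<le> norm (deriv f ?w * v) + norm (deriv (deriv f) ?w * cnj v * (z - ?w))"
        using 2 by (simp add: reflect_d_def norm_triangle_ineq)
      also have "\<dots> = norm (deriv f ?w) + 2 * (Im ?w * norm (deriv (deriv f) ?w))"
        using v 2 by (simp add: norm_mult complex_diff_cnj)
      also have "\<dots> \<le> norm (deriv f ?w) + 2 * (\<delta> * norm (deriv f ?w))" using bl[OF w(1)] by simp
      also have "\<dots> \<le> 2 * norm (deriv f ?w)"
        using mult_right_mono[of \<delta> "1/2" "norm (deriv f ?w)"] d by simp
      also have "\<dots> \<le> 2 * ((M * R') * Im ?w powr (- (1 / 4)))" using db[OF w] by simp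
      finally show ?thesis using 2 by simp
    qed (simp add: reflect_d_def)
  qed
  then show ?thesis using M(1) R' by (intro exI[of _ "2 * (M * R')"]) auto
qed

lemma reflect_d_measurable: "reflect_d v \<in> borel_measurable borel"
proof -
  have hd: "deriv f holomorphic_on uhp" by (rule holomorphic_deriv[OF hol open_uhp])
  have c: "continuous_on uhp (deriv f)" "continuous_on uhp (deriv (deriv f))"
    using holomorphic_on_imp_continuous_on[OF hd] holomorphic_on_imp_continuous_on[OF holomorphic_deriv[OF hd open_uhp]] by auto
  have 1: "(\<lambda>z. indicator uhp z *\<^sub>R (deriv f z * v)) \<in> borel_measurable borel"
    by (rule borel_measurable_continuous_on_indicator) (use open_uhp c in \<open>auto intro!: continuous_intros\<close>)
  have 2: "(\<lambda>z. indicator {z. Im z < 0} z *\<^sub>R (deriv f (cnj z) * v + deriv (deriv f) (cnj z) * cnj v * (z - cnj z))) \<in> borel_measurable borel"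
  proof (rule borel_measurable_continuous_on_indicator)
    show "{z. Im z < 0} \<in> sets borel" using open_halfspace_Im_lt[of 0] by simp
    show "continuous_on {z. Im z < 0} (\<lambda>z. deriv f (cnj z) * v + deriv (deriv f) (cnj z) * cnj v * (z - cnj z))"
      by (intro continuous_intros continuous_on_compose2[OF c(1)] continuous_on_compose2[OF c(2)]) auto
  qed
  have "reflect_d v = (\<lambda>z. indicator uhp z *\<^sub>R (deriv f z * v) + indicator {z. Im z < 0} z *\<^sub>R (deriv f (cnj z) * v + deriv (deriv f) (cnj z) * cnj v * (z - cnj z)))"
    by (auto simp: reflect_d_def fun_eq_iff)
  then show ?thesis using borel_measurable_add[OF 1 2] by simp
qed

text \<open>Horizontal steps keep the height, so the bound on the derivative is constant along them;
  vertical steps may cross the real line and use \<open>increment_across_zero\<close>.\<close>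

lemma reflect_increment:
  assumes v: "v = 1 \<or> v = \<i>"
  shows "\<exists>C\<ge>0. \<forall>z h. Im z \<noteq> 0 \<longrightarrow> norm z \<le> R \<longrightarrow> 0 < h \<longrightarrow> h \<le> 1 \<longrightarrow>
        norm (reflect z - reflect (z - of_real h * v)) \<le> C * h * \<bar>Im z\<bar> powr (- (1 / 4))"
proof -
  have nv: "norm v = 1" using v by auto
  obtain M where M: "0 \<le> M" "\<And>z. norm z \<le> 2 * R + 2 \<Longrightarrow> norm (reflect_d v z) \<le> M * \<bar>Im z\<bar> powr (- (1 / 4))"
    using reflect_d_bound[OF nv, of "2 * R + 2"] by blast
  have cl: "continuous_on A (\<lambda>t. reflect (c + of_real t * v))" for c A
    by (intro continuous_on_compose2[OF reflect_continuous] continuous_intros) auto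
  have "norm (reflect z - reflect (z - of_real h * v)) \<le> 4 * M * h * \<bar>Im z\<bar> powr (- (1 / 4))"
    if z: "Im z \<noteq> 0" "norm z \<le> R" and h: "0 < h" "h \<le> 1" for z h
    using v
  proof
    assume v1: "v = 1"
    have "norm (reflect (z + of_real 0 * v) - reflect (z + of_real (- h) * v))
       \<le> (M * \<bar>Im z\<bar> powr (- (1 / 4))) * 0 - (M * \<bar>Im z\<bar> powr (- (1 / 4))) * (- h)"
    proof (rule differentiable_bound_general[where f = "\<lambda>t. reflect (z + of_real t * v)" and f' = "\<lambda>t. reflect_d v (z + of_real t * v)"
          and \<phi> = "\<lambda>t. (M * \<bar>Im z\<bar> powr (- (1 / 4))) * t" and \<phi>' = "\<lambda>t. M * \<bar>Im z\<bar> powr (- (1 / 4))"])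
      fix x assume x: "- h < x" "x < 0"
      show "((\<lambda>t. reflect (z + of_real t * v)) has_vector_derivative reflect_d v (z + of_real x * v)) (at x)"
        by (rule reflect_derivative_at) (use z v1 in simp)
      show "((*) (M * \<bar>Im z\<bar> powr (- (1 / 4))) has_vector_derivative M * \<bar>Im z\<bar> powr (- (1 / 4))) (at x)"
        unfolding has_real_derivative_iff_has_vector_derivative[symmetric] by (rule DERIV_cmult_Id)
      have "norm (of_real x * v) \<le> 1" using x h nv by (simp add: norm_mult)
      then have "norm (z + of_real x * v) \<le> 2 * R + 2"
        using norm_triangle_ineq[of z "of_real x * v"] z norm_ge_zero[of z] by linarith
      then have "norm (reflect_d v (z + of_real x * v)) \<le> M * \<bar>Im (z + of_real x * v)\<bar> powr (- (1 / 4))" by (rule M(2))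
      then show "norm (reflect_d v (z + of_real x * v)) \<le> M * \<bar>Im z\<bar> powr (- (1 / 4))" using v1 by simp
    qed (use h cl in \<open>auto intro!: continuous_intros\<close>)
    then have "norm (reflect z - reflect (z - of_real h * v)) \<le> M * h * \<bar>Im z\<bar> powr (- (1 / 4))" by (simp add: mult_ac)
    moreover have "0 \<le> M * h * \<bar>Im z\<bar> powr (- (1 / 4))" using M h by simp
    ultimately show ?thesis by linarith
  next
    assume vi: "v = \<i>"
    define x where "x = of_real (Re z) + 0 * v"
    have zz: "z = x + of_real (Im z) * v" "z - of_real h * v = x + of_real (Im z - h) * v"
      using vi by (auto simp: x_def complex_eq_iff)
    have Imx: "Im (x + of_real t * v) = t" for t using vi by (simp add: x_def)
    have nx: "norm x \<le> R" using z(2) abs_Re_le_cmod[of z] by (simp add: x_def)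
    have "norm (reflect (x + of_real (Im z) * v) - reflect (x + of_real (Im z - h) * v)) \<le> 4 * M * h * \<bar>Im z\<bar> powr (- (1 / 4))"
    proof (rule increment_across_zero[where G = "\<lambda>t. reflect (x + of_real t * v)" and G' = "\<lambda>t. reflect_d v (x + of_real t * v)" and \<rho> = "R + 1"])
      show "((\<lambda>t. reflect (x + of_real t * v)) has_vector_derivative reflect_d v (x + of_real \<eta> * v)) (at \<eta>)" if "\<eta> \<noteq> 0" for \<eta>
        by (rule reflect_derivative_at) (simp only: Imx that not_False_eq_True)
      show "norm (reflect_d v (x + of_real \<eta> * v)) \<le> M * \<bar>\<eta>\<bar> powr (- (1 / 4))" if "\<bar>\<eta>\<bar> \<le> R + 1" for \<eta>
      proof -
        have "norm (x + of_real \<eta> * v) \<le> 2 * R + 2"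
          using norm_triangle_ineq[of x "of_real \<eta> * v"] nx that nv by (simp add: norm_mult)
        from M(2)[OF this] show ?thesis unfolding Imx .
      qed
      show "\<bar>Im z\<bar> + 1 \<le> R + 1" using z(2) abs_Im_le_cmod[of z] by simp
    qed (use cl M(1) z h in auto)
    then show ?thesis using zz by simp
  qed
  then show ?thesis using M(1) by (intro exI[of _ "4 * M"]) auto
qed

lemma reflect_W12: "W12_loc_with reflect (reflect_d 1) (reflect_d \<i>)"
proof -
  have m: "reflect \<in> borel_measurable borel" by (rule borel_measurable_continuous_onI[OF reflect_continuous])
  have L: "L2_loc g" if gm: "g \<in> borel_measurable borel"
    and int: "\<And>K. compact K \<Longrightarrow> integrable lborel (\<lambda>z. indicator K z *\<^sub>R (norm (g z))\<^sup>2)" for g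
    unfolding L2_loc_def
  proof (intro conjI allI impI)
    show "g \<in> borel_measurable lebesgue" using gm by (intro measurable_completion) simp
    fix K :: "complex set" assume K: "compact K"
    then have "K \<in> sets borel" by (simp add: compact_imp_closed)
    then show "set_integrable lebesgue K (\<lambda>z. (norm (g z))\<^sup>2)" unfolding set_integrable_def
      by (subst integrable_completion) (use gm int[OF K] in \<open>auto intro!: borel_measurable_scaleR borel_measurable_indicator borel_measurable_power\<close>)
  qed
  have Lr: "L2_loc reflect"
    by (rule L[OF m]) (intro borel_integrable_compact continuous_intros continuous_on_subset[OF reflect_continuous], auto)
  have Ld: "L2_loc (reflect_d v)" if nv: "norm v = 1" for v
  proof (rule L[OF reflect_d_measurable])
    fix K :: "complex set" assume K: "compact K"
    obtain R where "\<forall>y\<in>K. dist 0 y \<le> R"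
      using compact_imp_bounded[OF K] unfolding bounded_any_center[of _ 0] by (elim exE)
    then have KR: "K \<subseteq> cball 0 R" by (auto simp: subset_iff)
    obtain M where M: "0 \<le> M" "\<And>z. norm z \<le> R \<Longrightarrow> norm (reflect_d v z) \<le> M * \<bar>Im z\<bar> powr (- (1 / 4))"
      using reflect_d_bound[OF nv, of R] by blast
    show "integrable lborel (\<lambda>z. indicator K z *\<^sub>R (norm (reflect_d v z))\<^sup>2)"
    proof (rule integrable_dominated_Im[of "1 / 2" _ R "M\<^sup>2"])
      show "(\<lambda>z. (norm (reflect_d v z))\<^sup>2) \<in> borel_measurable borel" using reflect_d_measurable[of v] by simp
      show "norm ((norm (reflect_d v z))\<^sup>2) \<le> M\<^sup>2 * \<bar>Im z\<bar> powr (- (1 / 2))" if "norm z \<le> R" for z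
      proof -
        have "(norm (reflect_d v z))\<^sup>2 \<le> (M * \<bar>Im z\<bar> powr (- (1 / 4)))\<^sup>2" using M(2)[OF that] by (intro power_mono) auto
        also have "\<dots> = M\<^sup>2 * \<bar>Im z\<bar> powr (- (1 / 2))" by (simp add: power_mult_distrib power2_eq_square flip: powr_add)
        finally show ?thesis by simp
      qed
      show "K \<in> sets borel" using K by (simp add: compact_imp_closed)
    qed (use KR in auto)
  qed
  have W: "weak_partial reflect v (reflect_d v)" if v: "v = 1 \<or> v = \<i>" for v
  proof (rule weak_partialI[OF _ reflect_continuous reflect_d_measurable])
    show "norm v = 1" using v by auto
    then show "\<exists>C. \<forall>z. norm z \<le> R \<longrightarrow> norm (reflect_d v z) \<le> C * \<bar>Im z\<bar> powr (- (1 / 4))" for R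
      using reflect_d_bound[of v R] by blast
    show "((\<lambda>t. reflect (z + of_real t * v)) has_vector_derivative reflect_d v z) (at 0)" if "Im z \<noteq> 0" for z
      by (rule reflect_derivative[OF that])
    show "\<exists>C\<ge>0. \<forall>z h. Im z \<noteq> 0 \<longrightarrow> norm z \<le> R \<longrightarrow> 0 < h \<longrightarrow> h \<le> 1 \<longrightarrow>
        norm (reflect z - reflect (z - of_real h * v)) \<le> C * h * \<bar>Im z\<bar> powr (- (1 / 4))" for R
      by (rule reflect_increment[OF v])
  qed
  show ?thesis unfolding W12_loc_with_def by (intro conjI Lr Ld W) simp_all
qed

lemma reflect_reduced_qc:
  assumes inj: "inj_on f uhp" and k: "0 \<le> k" "k < 1"
    and b: "\<And>z. z \<in> uhp \<Longrightarrow> 2 * Im z * norm (deriv (deriv f) z) \<le> k * Re (deriv f z)"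
  shows "reduced_qc_const reflect k"
  unfolding reduced_qc_const_def
proof (intro conjI exI)
  show "0 \<le> k" "k < 1" using k by auto
  have "f \<i> \<noteq> f (2 * \<i>)" using inj_onD[OF inj, of \<i> "2 * \<i>"] by auto
  then show "reflect \<i> \<noteq> reflect (2 * \<i>)" by (simp add: reflect_def ext_eq)
  show "continuous_on UNIV reflect" by (rule reflect_continuous)
  show "W12_loc_with reflect (reflect_d 1) (reflect_d \<i>)" by (rule reflect_W12)
  show "AE z in lebesgue. norm ((reflect_d 1 z + \<i> * reflect_d \<i> z) / 2) \<le> k * Re ((reflect_d 1 z - \<i> * reflect_d \<i> z) / 2)"
  proof (intro AE_I2)
    fix z :: complex
    have Re0: "0 \<le> k * Re (deriv f w)" if "w \<in> uhp" for w
    proof -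
      have "0 \<le> 2 * Im w * norm (deriv (deriv f) w)" using that by simp
      then show ?thesis using b[OF that] by linarith
    qed
    consider "0 < Im z" | "Im z < 0" | "Im z = 0" by linarith
    then show "norm ((reflect_d 1 z + \<i> * reflect_d \<i> z) / 2) \<le> k * Re ((reflect_d 1 z - \<i> * reflect_d \<i> z) / 2)"
    proof cases
      case 1
      have "(reflect_d 1 z + \<i> * reflect_d \<i> z) / 2 = 0" "(reflect_d 1 z - \<i> * reflect_d \<i> z) / 2 = deriv f z"
        using 1 unfolding reflect_d_def by (simp_all add: complex_eq_iff)
      then show ?thesis using Re0[of z] 1 by simp
    next
      case 2
      have "(reflect_d 1 z + \<i> * reflect_d \<i> z) / 2 = deriv (deriv f) (cnj z) * (z - cnj z)"
        "(reflect_d 1 z - \<i> * reflect_d \<i> z) / 2 = deriv f (cnj z)"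
        using 2 unfolding reflect_d_def by (simp_all add: complex_eq_iff algebra_simps)
      then show ?thesis using b[of "cnj z"] 2 by (simp add: norm_mult complex_diff_cnj mult_ac)
    next
      case 3
      then show ?thesis by (simp add: reflect_d_def)
    qed
  qed
qed

end

section \<open>The constant as a function of \<open>s\<close>\<close>

lemma reduced_qc_const_mono:
  assumes f: "reduced_qc_const f k" and k: "0 < k" "k \<le> k'" "k' < 1"
  shows "reduced_qc_const f k'"
proof -
  have imp: "x \<le> k' * t" if "x \<le> k * t" "0 \<le> x" for x t :: real
  proof -
    have "0 \<le> k * t" using that by linarith
    \<comment> \<open>The inequality itself forces the real part to be nonnegative, so a larger
      constant weakens it.\<close>
    then have "0 \<le> t" using k by (simp add: zero_le_mult_iff)
    then show ?thesis using that mult_right_mono[OF k(2), of t] by linarith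
  qed
  obtain fx fy where W: "W12_loc_with f fx fy"
    and ae: "AE z in lebesgue. norm ((fx z + \<i> * fy z) / 2) \<le> k * Re ((fx z - \<i> * fy z) / 2)"
    using f by (auto simp: reduced_qc_const_def)
  have "AE z in lebesgue. norm ((fx z + \<i> * fy z) / 2) \<le> k' * Re ((fx z - \<i> * fy z) / 2)"
    using ae by (rule AE_mp) (intro AE_I2 impI imp norm_ge_zero)
  then show ?thesis using f k W unfolding reduced_qc_const_def by auto
qed

text \<open>Here the constant is given first and the threshold for \<open>s\<close> depends on it;
  the theorem inverts this dependence.\<close>

lemma s_qs_graph_reduced_qc:
  assumes \<kappa>: "0 < \<kappa>" "\<kappa> < 1"
  obtains s\<^sub>0 where "0 < s\<^sub>0"
    "\<And>s \<Gamma>. 0 < s \<Longrightarrow> s < s\<^sub>0 \<Longrightarrow> s_qs_graph s \<Gamma> \<Longrightarrow> \<exists>f. reduced_qc_const f \<kappa> \<and> f ` \<real> = \<Gamma>"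
proof (rule graph_map_second_deriv_small[OF \<kappa>(1) less_imp_le[OF \<kappa>(2)]])
  fix s\<^sub>0 \<delta>
  assume s0: "0 < s\<^sub>0"
    and gb: "\<And>s \<gamma> f. 0 < s \<Longrightarrow> s < s\<^sub>0 \<Longrightarrow> qs_curve s \<gamma> \<Longrightarrow> graph_map \<gamma> f \<Longrightarrow> graph_bloch f \<delta> \<gamma> s"
    and b: "\<And>s \<gamma> f z. 0 < s \<Longrightarrow> s < s\<^sub>0 \<Longrightarrow> qs_curve s \<gamma> \<Longrightarrow> graph_map \<gamma> f \<Longrightarrow> z \<in> uhp \<Longrightarrow>
       2 * Im z * norm (deriv (deriv f) z) \<le> \<kappa> * Re (deriv f z)"
  show thesis
  proof (rule that[OF s0])
    fix s \<Gamma> assume s: "0 < s" "s < s\<^sub>0" and G: "s_qs_graph s \<Gamma>"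
    obtain \<gamma> where g: "qs_curve s \<gamma>" and rg: "range \<gamma> = \<Gamma>" by (rule s_qs_graph_imp_qs_curve[OF G s(1)])
    obtain f where f: "graph_map \<gamma> f" by (rule graph_map_exists[OF qs_curve_continuous[OF g] qs_curve_Re[OF g]])
    interpret graph_bloch f \<delta> \<gamma> s by (rule gb[OF s g f])
    have "inj_on f uhp" using f by (simp add: graph_map_def)
    then have "reduced_qc_const reflect \<kappa>" by (rule reflect_reduced_qc) (use \<kappa> b[OF s g f] in auto)
    moreover have "reflect ` \<real> = \<Gamma>"
    proof -
      have "reflect x = ext x" if "x \<in> \<real>" for x using that by (auto simp: reflect_def complex_is_Real_iff)
      then have "reflect ` \<real> = ext ` \<real>" by (rule image_cong[OF HOL.refl])
      then show ?thesis using ext_real_image rg by simp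
    qed
    ultimately show "\<exists>f. reduced_qc_const f \<kappa> \<and> f ` \<real> = \<Gamma>" by blast
  qed
qed

theorem theorem1p1:
  shows "\<exists>s\<^sub>0::real. s\<^sub>0 > 0 \<and> (\<exists>k::real \<Rightarrow> real.
     (\<forall>s. 0 < s \<and> s < s\<^sub>0 \<longrightarrow> 0 \<le> k s \<and> k s < 1) \<and>
     (k \<longlongrightarrow> 0) (at_right 0) \<and>
     (\<forall>s \<Gamma>. 0 < s \<and> s < s\<^sub>0 \<and> s_qs_graph s \<Gamma> \<longrightarrow>
        (\<exists>f. reduced_qc_const f (k s) \<and> f ` \<real> = \<Gamma>)))"
proof -
  define P where "P s \<kappa> \<longleftrightarrow> 0 < \<kappa> \<and> \<kappa> < 1 \<and> (\<forall>\<Gamma>. s_qs_graph s \<Gamma> \<longrightarrow> (\<exists>f. reduced_qc_const f \<kappa> \<and> f ` \<real> = \<Gamma>))"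
    for s \<kappa> :: real
  have ex: "\<exists>s\<^sub>0>0. \<forall>s. 0 < s \<longrightarrow> s < s\<^sub>0 \<longrightarrow> P s \<kappa>" if \<kappa>: "0 < \<kappa>" "\<kappa> < 1" for \<kappa>
  proof (rule s_qs_graph_reduced_qc[OF \<kappa>])
    fix s\<^sub>0 assume "0 < s\<^sub>0" "\<And>s \<Gamma>. 0 < s \<Longrightarrow> s < s\<^sub>0 \<Longrightarrow> s_qs_graph s \<Gamma> \<Longrightarrow> \<exists>f. reduced_qc_const f \<kappa> \<and> f ` \<real> = \<Gamma>"
    then show ?thesis using \<kappa> unfolding P_def by (intro exI[of _ s\<^sub>0]) simp
  qed
  have mono: "P s \<kappa>'" if P: "P s \<kappa>" and le: "\<kappa> \<le> \<kappa>'" "\<kappa>' < 1" for s \<kappa> \<kappa>'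
    unfolding P_def
  proof (intro conjI allI impI)
    show "0 < \<kappa>'" "\<kappa>' < 1" using P le by (auto simp: P_def)
    fix \<Gamma> assume "s_qs_graph s \<Gamma>"
    then obtain f where "reduced_qc_const f \<kappa>" "f ` \<real> = \<Gamma>" using P by (auto simp: P_def)
    then show "\<exists>f. reduced_qc_const f \<kappa>' \<and> f ` \<real> = \<Gamma>"
      using reduced_qc_const_mono[of f \<kappa> \<kappa>'] P le by (auto simp: P_def)
  qed
  text \<open>The infimum of the admissible constants need not be attained, so the final constant is \<open>K s + s\<close>.\<close>
  define K where "K s = Inf {\<kappa>. P s \<kappa>}" for s
  have bdd: "bdd_below {\<kappa>. P s \<kappa>}" for s by (rule bdd_belowI[of _ 0]) (simp add: P_def)
  \<comment> \<open>\<open>Inf\<close> of the empty set is unspecified, so the facts about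
    \<open>K s\<close> presume an admissible constant.\<close>
  have K0: "0 \<le> K s" if "P s \<kappa>" for s \<kappa>
    unfolding K_def by (rule cInf_greatest) (use that in \<open>auto simp: P_def\<close>)
  have K1: "K s \<le> \<kappa>" if "P s \<kappa>" for s \<kappa>
    unfolding K_def by (rule cInf_lower[OF _ bdd]) (simp add: that)
  have PK: "P s (K s + s)" if "P s \<kappa>" "0 < s" "K s + s < 1" for s \<kappa>
  proof -
    have "Inf {\<kappa>. P s \<kappa>} < K s + s" "{\<kappa>. P s \<kappa>} \<noteq> {}" using that by (auto simp: K_def)
    from cInf_lessD[OF this(2,1)] obtain \<kappa>' where "P s \<kappa>'" "\<kappa>' < K s + s" by blast
    then show ?thesis using mono[of s \<kappa>' "K s + s"] that by simp
  qed
  obtain s1 where s1: "0 < s1" "\<And>s. 0 < s \<Longrightarrow> s < s1 \<Longrightarrow> P s (1 / 4)" using ex[of "1 / 4"] by auto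
  define s\<^sub>0 where "s\<^sub>0 = min s1 (1 / 4)"
  have small: "P s (K s + s) \<and> 0 \<le> K s + s \<and> K s + s < 1" if "0 < s" "s < s\<^sub>0" for s
  proof -
    have p: "P s (1 / 4)" using that by (intro s1) (auto simp: s\<^sub>0_def)
    \<comment> \<open>Both summands are at most 1/4 by the choice of the threshold.\<close>
    have "K s + s < 1" using K1[OF p] that by (simp add: s\<^sub>0_def)
    then show ?thesis using PK[OF p that(1)] K0[OF p] that by auto
  qed
  have lim: "((\<lambda>s. K s + s) \<longlongrightarrow> 0) (at_right 0)"
  proof (rule tendstoI)
    fix e :: real assume e: "0 < e"
    \<comment> \<open>Half of \<open>e\<close> is for \<open>K s\<close>, the other half for the
      summand \<open>s\<close>.\<close>
    define \<kappa> where "\<kappa> = min (e / 2) (1 / 2)"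
    have "0 < \<kappa>" "\<kappa> < 1" using e by (auto simp: \<kappa>_def min_def)
    from ex[OF this] obtain s2 where s2: "0 < s2" "\<And>s. 0 < s \<Longrightarrow> s < s2 \<Longrightarrow> P s \<kappa>" by auto
    have "dist (K s + s) 0 < e" if "0 < s" "s < min s2 (e / 2)" for s
    proof -
      have "P s \<kappa>" using that by (intro s2) auto
      then show ?thesis using K0[of s \<kappa>] K1[of s \<kappa>] that by (simp add: \<kappa>_def)
    qed
    then show "\<forall>\<^sub>F s in at_right 0. dist (K s + s) 0 < e"
      unfolding eventually_at_right_field by (intro exI[of _ "min s2 (e / 2)"]) (use s2 e in auto)
  qed
  show ?thesis
  proof (intro exI[of _ s\<^sub>0] exI[of _ "\<lambda>s. K s + s"] conjI allI impI lim)
    show "0 < s\<^sub>0" using s1 by (simp add: s\<^sub>0_def)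
  qed (use small in \<open>auto simp: P_def\<close>)
qed

end
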